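(* Fix integers $n \geq 2$ and $k \geq 2$. Suppose there is a constant $C_s$ such that for all $f \in H^s(\mathbb{R}^n)$, $$\Big\|\sup_{0<t<1} |T_t^{(P_k)} f|\, \Big\|_{L^1(B_n(0,1))} \leq C_s \|f\|_{H^s(\mathbb{R}^n)}.$$ Then $s \geq \frac{1}{4} + \frac{n-1}{4((k-1)n+1)}.$
   Context: For $\xi \in \mathbb{R}^n$ let $P_k(\xi) = \xi_1^k + \cdots + \xi_n^k$. For $t \in \mathbb{R}$ define (initially for $f$ of Schwartz class on $\mathbb{R}^n$) $$T_t^{(P_k)}f(x)=\frac{1}{(2\pi)^n} \int_{\mathbb{R}^n} \hat{f}(\xi)e^{i(\xi \cdot x+P_k(\xi)t)}\, d\xi, \qquad \hat f(\xi) = \int_{\mathbb{R}^n} f(x) e^{-ix\cdot \xi}\,dx.$$ $B_n(0,1)$ is the Euclidean unit ball centered at the origin in $\mathbb{R}^n$. $H^s(\mathbb{R}^n)$ is the Sobolev space of tempered distributions $f$ with finite norm given by $\|f\|_{H^s(\mathbb{R}^n)}^2 = \frac{1}{(2\pi)^n}\int_{\mathbb{R}^n} (1+|\xi|^2)^{s}|\hat{f}(\xi)|^2 d\xi$. *)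

theory Defs
  imports "HOL-Analysis.Analysis"
begin

definition partial_deriv :: "'n::finite \<Rightarrow> (real^'n \<Rightarrow> complex) \<Rightarrow> real^'n \<Rightarrow> complex" where
  "partial_deriv i f x = frechet_derivative f (at x) (axis i 1)"

definition partial_derivs :: "'n::finite list \<Rightarrow> (real^'n \<Rightarrow> complex) \<Rightarrow> real^'n \<Rightarrow> complex" where
  "partial_derivs is f = foldr partial_deriv is f"

text \<open>Differentiability of all iterated partial derivatives gives smoothness; the empty list
  covers the function itself.\<close>

definition schwartz :: "(real^'n::finite \<Rightarrow> complex) set" where
  "schwartz = {f. \<forall>is (m::nat).
      (\<forall>x. partial_derivs is f differentiable (at x)) \<and>
      bounded (range (\<lambda>x. (1 + norm x) ^ m *\<^sub>R partial_derivs is f x))}"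

definition schwartz_seminorm :: "nat \<Rightarrow> 'n::finite list \<Rightarrow> (real^'n \<Rightarrow> complex) \<Rightarrow> real" where
  "schwartz_seminorm m is \<phi> = (SUP x. (1 + norm x) ^ m * norm (partial_derivs is \<phi> x))"

text \<open>A distribution is a functional on functions of which only the values on the Schwartz class
  matter.\<close>

type_synonym 'n distribution = "(real^'n \<Rightarrow> complex) \<Rightarrow> complex"

definition tempered_distribution :: "('n::finite) distribution \<Rightarrow> bool" where
  "tempered_distribution L \<longleftrightarrow>
     (\<forall>\<phi>\<in>schwartz. \<forall>\<psi>\<in>schwartz. L (\<lambda>x. \<phi> x + \<psi> x) = L \<phi> + L \<psi>) \<and>
     (\<forall>c. \<forall>\<phi>\<in>schwartz. L (\<lambda>x. c * \<phi> x) = c * L \<phi>) \<and>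
     (\<exists>C N. \<forall>\<phi>\<in>schwartz.
        norm (L \<phi>) \<le> C * (\<Sum>is | length is \<le> N. schwartz_seminorm N is \<phi>))"

definition dist_of :: "(real^'n::finite \<Rightarrow> complex) \<Rightarrow> 'n distribution" where
  "dist_of g \<phi> = (LINT x|lborel. g x * \<phi> x)"

definition given_by_function ::
    "('n::finite) distribution \<Rightarrow> (real^'n \<Rightarrow> complex) \<Rightarrow> bool" where
  "given_by_function L g \<longleftrightarrow> g \<in> borel_measurable borel \<and>
     (\<forall>\<phi>\<in>schwartz. integrable lborel (\<lambda>x. g x * \<phi> x) \<and> L \<phi> = dist_of g \<phi>)"

definition fourier :: "(real^'n::finite \<Rightarrow> complex) \<Rightarrow> real^'n \<Rightarrow> complex" where
  "fourier f \<xi> = (LINT x|lborel. f x * exp (- \<i> * of_real (x \<bullet> \<xi>)))"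

definition dist_fourier :: "('n::finite) distribution \<Rightarrow> 'n distribution" where
  "dist_fourier L \<phi> = L (fourier \<phi>)"

text \<open>The function that is the Fourier transform of a tempered distribution, when there is one;
  it is determined only up to a null set.\<close>

definition fourier_function :: "('n::finite) distribution \<Rightarrow> real^'n \<Rightarrow> complex" where
  "fourier_function L = (SOME g. given_by_function (dist_fourier L) g)"

definition sobolev_space :: "real \<Rightarrow> ('n::finite) distribution set" where
  "sobolev_space s = {f. tempered_distribution f \<and>
     given_by_function (dist_fourier f) (fourier_function f) \<and>
     integrable lborel (\<lambda>\<xi>. (1 + (norm \<xi>)\<^sup>2) powr s * (norm (fourier_function f \<xi>))\<^sup>2)}"

definition sobolev_norm :: "real \<Rightarrow> ('n::finite) distribution \<Rightarrow> real" where
  "sobolev_norm s f = sqrt (1 / (2 * pi) ^ CARD('n) *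
     (LINT \<xi>|lborel. (1 + (norm \<xi>)\<^sup>2) powr s * (norm (fourier_function f \<xi>))\<^sup>2))"

definition power_symbol :: "nat \<Rightarrow> real^'n::finite \<Rightarrow> real" where
  "power_symbol k \<xi> = (\<Sum>i\<in>UNIV. (\<xi> $ i) ^ k)"

definition T_schwartz ::
    "nat \<Rightarrow> real \<Rightarrow> (real^'n::finite \<Rightarrow> complex) \<Rightarrow> real^'n \<Rightarrow> complex" where
  "T_schwartz k t f x = 1 / (2 * pi) ^ CARD('n) *
     (LINT \<xi>|lborel. fourier f \<xi> * exp (\<i> * of_real (\<xi> \<bullet> x + power_symbol k \<xi> * t)))"

text \<open>The operators act on the Sobolev space as the continuous extensions, into the tempered
  distributions, of the operators on the Schwartz class. The following says that for each
  \<open>t \<in> (0,1)\<close> the extended operator sends \<open>f\<close> to the function \<open>u t\<close>: along every sequence of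
  Schwartz functions tending to \<open>f\<close> in the Sobolev norm, the images tend to \<open>u t\<close> as
  distributions. This fixes each \<open>u t\<close> only almost everywhere, which does not determine a supremum
  over uncountably many \<open>t\<close>; continuity in \<open>t\<close>, which holds for Schwartz \<open>f\<close>, fixes
  \<open>\<lambda>t. u t x\<close> on \<open>(0,1)\<close> for almost every \<open>x\<close>. If the maximal inequality holds for Schwartz
  functions, then approximation, together with translation invariance, yields such a \<open>u\<close> for every
  \<open>f\<close> in the Sobolev space.\<close>

definition is_T_of ::
    "real \<Rightarrow> nat \<Rightarrow> ('n::finite) distribution \<Rightarrow> (real \<Rightarrow> real^'n \<Rightarrow> complex) \<Rightarrow> bool" where
  "is_T_of s k f u \<longleftrightarrow>
     (\<forall>t\<in>{0<..<1}. u t \<in> borel_measurable borel \<and>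
        (\<forall>\<phi>\<in>schwartz. integrable lborel (\<lambda>x. u t x * \<phi> x)) \<and>
        (\<forall>F. (\<forall>j::nat. F j \<in> schwartz) \<longrightarrow>
             (\<lambda>j. sobolev_norm s (\<lambda>\<phi>. dist_of (F j) \<phi> - f \<phi>)) \<longlonglongrightarrow> 0 \<longrightarrow>
             (\<forall>\<phi>\<in>schwartz.
                (\<lambda>j. dist_of (T_schwartz k t (F j)) \<phi>) \<longlonglongrightarrow> dist_of (u t) \<phi>))) \<and>
     (AE x in lborel. continuous_on {0<..<1} (\<lambda>t. u t x))"

end

theory Submission
  imports Defs "HOL-Number_Theory.Cong" "HOL-Probability.Probability" "HOL-Real_Asymp.Real_Asymp"
begin

text \<open>The idea, for \<open>n = CARD('n)\<close>, is to feed the maximal inequality a function that focuses, at suitable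
times, on a large set of points, and to compare powers of its frequency \<open>R\<close>. The function is a
product over the coordinates. In one coordinate it is a Gaussian of width \<open>1/S\<close> modulated to the
frequency \<open>R\<close>. In each other coordinate it is a Gaussian of width \<open>1\<close> multiplied by
\<open>\<Sum>m<N. cis (L * m * x)\<close>, where \<open>L * N = R\<close>, so that its frequencies lie on a lattice.

At a time \<open>t = 2 * pi * a / (q * L ^ k)\<close> with \<open>q\<close> prime, the phase of the \<open>m\<close>-th frequency depends
only on \<open>m\<close> modulo \<open>q\<close>. Near a point \<open>2 * pi * b / (q * L)\<close> the factor is therefore about \<open>N / q\<close>
copies of the complete sum of \<open>e((a r^k + b r) / q)\<close> over the residues \<open>r\<close> modulo \<open>q\<close>. For every \<open>a\<close>
prime to \<open>q\<close>, a positive proportion of the \<open>b\<close> give a sum of size about \<open>sqrt q\<close>: the second moment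
over \<open>b\<close> is exactly \<open>q\<^sup>2\<close>, and the fourth moment is at most a constant times \<open>q\<^sup>3\<close>
(\<open>many_large_power_sums\<close>, \<open>count_large_evolution\<close>).

The Gaussian of the first coordinate moves with velocity \<open>- k * R ^ (k - 1)\<close>, so it is of size one at
\<open>x\<close> for the times within about \<open>1 / (S * R ^ (k - 1))\<close> of \<open>- x / (k * R ^ (k - 1))\<close>
(\<open>packet_evolution_lower\<close>). The parameters are balanced so that this window contains an admissible
time for every prime \<open>q\<close> of size about \<open>Q\<close> and every \<open>x\<close> of an interval. Then all the sets, one for
each \<open>q\<close>, of points whose other coordinates are near fractions with denominator \<open>q\<close> contribute, and
because distinct primes give well separated fractions they overlap little
(\<open>near_rationals_overlap\<close>). With about \<open>Q\<close> primes the union has measure one up to a power of \<open>M\<close>, a loss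
explained below.

With \<open>D = (k - 1) * n + 1\<close> and a large \<open>X\<close>, the choice is \<open>R = X ^ (2 * D)\<close>, \<open>S = X ^ D\<close>, \<open>N = X ^ n\<close>
and \<open>Q = X ^ (n - 1)\<close>. The maximal function is then at least \<open>(N / sqrt Q) ^ (n - 1)\<close> on that
set, while the Sobolev norm is at most
\<open>R powr s * S powr (- 1/2) * N powr ((n - 1) / 2)\<close> up to a constant. Comparing exponents of \<open>X\<close> gives the bound on
\<open>s\<close>. As only the exponents matter, factors of a small power of \<open>X\<close> may be lost everywhere: \<open>X\<close> is
taken to be \<open>M ^ K\<close> with \<open>K\<close> large and fixed, \<open>M\<close> tends to infinity, and every loss is a power of \<open>M\<close>
with an exponent that does not depend on \<open>K\<close>.

The hypothesis speaks of distributions and of functions determined only almost everywhere. For a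
Schwartz function the constant sequence shows that the extended operator agrees almost everywhere
with the integral formula at each single time, hence simultaneously at countably many times, and
the times above form a countable set (\<open>schwartz_maximal_lower_bound\<close>).\<close>

section \<open>Power sums modulo a prime\<close>

definition chi :: "nat \<Rightarrow> int \<Rightarrow> complex" where
  "chi q z = cis (2 * pi * real_of_int z / real q)"

lemma chi_0 [simp]: "chi q 0 = 1"
  by (simp add: chi_def)

lemma norm_chi [simp]: "norm (chi q z) = 1"
  by (simp add: chi_def)

lemma cnj_chi: "cnj (chi q z) = chi q (- z)"
  by (simp add: chi_def cis_cnj)

lemma chi_add: "chi q (y + z) = chi q y * chi q z"
  by (simp add: chi_def cis_mult add_divide_distrib distrib_left)

lemma chi_diff: "chi q (y - z) = chi q y * chi q (- z)"
  using chi_add[of q y "- z"] by simp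

lemma chi_mult_modulus [simp]: "q > 0 \<Longrightarrow> chi q (int q * z) = 1"
  using cis_multiple_2pi[of "of_int z"] by (simp add: chi_def mult.assoc)

lemma chi_cong:
  assumes "[y = z] (mod int q)" "q > 0"
  shows "chi q y = chi q z"
proof -
  obtain c where "y = z + int q * c"
    using assms(1) by (metis cong_iff_lin cong_sym)
  then show ?thesis using assms by (simp add: chi_add)
qed

lemma chi_power: "chi q (int b * h) = chi q h ^ b"
proof -
  have "chi q h ^ b = cis (real b * (2 * pi * real_of_int h / real q))"
    by (simp only: chi_def Complex.DeMoivre)
  then show ?thesis by (simp add: chi_def mult_ac)
qed

lemma chi_eq_1_iff:
  assumes "q > 0" shows "chi q h = 1 \<longleftrightarrow> int q dvd h"
proof
  assume "chi q h = 1"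
  then have "cos (2 * pi * real_of_int h / real q) = 1"
    by (simp add: chi_def complex_eq_iff)
  then obtain m :: int where "2 * pi * real_of_int h / real q = of_int m * 2 * pi"
    by (auto simp: cos_one_2pi_int)
  then have "real_of_int h = real_of_int (int q * m)"
    using assms by (simp add: field_simps)
  then show "int q dvd h" by (metis dvd_triv_left of_int_eq_iff)
qed (use assms in auto)

lemma sum_chi:
  assumes "q > 0"
  shows "(\<Sum>b<q. chi q (int b * h)) = (if int q dvd h then of_nat q else 0)"
proof (cases "int q dvd h")
  case True
  then have "chi q h = 1" using assms chi_eq_1_iff by blast
  then have "chi q (int b * h) = 1" for b by (simp add: chi_power)
  then show ?thesis using True by simp
next
  case False
  then have "chi q h \<noteq> 1" using chi_eq_1_iff assms by auto
  moreover have "chi q h ^ q = 1"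
    using chi_mult_modulus[OF assms, of h] chi_power[of q q h] by simp
  ultimately show ?thesis
    using False by (simp add: chi_power geometric_sum)
qed

lemma norm_sum_sq:
  fixes z :: "'a \<Rightarrow> complex"
  shows "of_real ((norm (\<Sum>x\<in>A. z x))\<^sup>2) = (\<Sum>x\<in>A. \<Sum>y\<in>A. z x * cnj (z y))"
proof -
  have "of_real ((norm (\<Sum>x\<in>A. z x))\<^sup>2) = (\<Sum>x\<in>A. z x) * cnj (\<Sum>x\<in>A. z x)"
    using complex_norm_square by blast
  then show ?thesis by (simp add: sum_product)
qed

text \<open>Expanding the square leaves, by orthogonality of the characters, only the terms with equal
residues.\<close>
lemma chi_parseval:
  assumes "q > 0"
  shows "(\<Sum>b<q. (norm (\<Sum>r<q. v r * chi q (int b * int r)))\<^sup>2) = real q * (\<Sum>r<q. (norm (v r))\<^sup>2)"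
proof -
  have dvd: "int q dvd int r - int r' \<longleftrightarrow> r = r'" if "r < q" "r' < q" for r r'
    using that by (metis cong_less_modulus_unique_nat cong_int_iff cong_iff_dvd_diff cong_refl)
  have "complex_of_real (\<Sum>b<q. (norm (\<Sum>r<q. v r * chi q (int b * int r)))\<^sup>2)
      = (\<Sum>b<q. \<Sum>r<q. \<Sum>r'<q. v r * cnj (v r') * chi q (int b * (int r - int r')))"
    by (simp only: of_real_sum norm_sum_sq)
      (simp add: cnj_chi mult_ac right_diff_distrib chi_diff)
  also have "\<dots> = (\<Sum>r<q. \<Sum>r'<q. v r * cnj (v r') * (\<Sum>b<q. chi q (int b * (int r - int r'))))"
    by (subst sum.swap, rule sum.cong[OF refl], subst sum.swap) (simp add: sum_distrib_left)
  also have "\<dots> = (\<Sum>r<q. \<Sum>r'<q. if r' = r then of_nat q * (v r * cnj (v r)) else 0)"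
    by (intro sum.cong refl) (auto simp: sum_chi[OF assms] dvd)
  also have "\<dots> = complex_of_real (real q * (\<Sum>r<q. (norm (v r))\<^sup>2))"
    by (simp add: sum.delta' sum_distrib_left flip: complex_norm_square)
  finally show ?thesis using of_real_eq_iff by blast
qed

text \<open>Dividing by a linear factor preserves the leading coefficient, and a prime that divides a value
of the product divides a value of one of the factors.\<close>
lemma poly_roots_mod_prime:
  fixes f :: "int poly" and p :: nat
  assumes "prime p" "degree f \<le> d" "\<not> int p dvd coeff f d"
  shows "card {x\<in>{..<p}. int p dvd poly f (int x)} \<le> d"
  using assms(2,3)
proof (induction d arbitrary: f)
  case 0
  then obtain c where "f = [:c:]" by (metis degree_eq_zeroE le_zero_eq)
  with 0 show ?case by simp
next
  case (Suc d)
  show ?case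
  proof (cases "\<exists>r<p. int p dvd poly f (int r)")
    case True
    then obtain r where r: "r < p" "int p dvd poly f (int r)" by blast
    define g where "g = synthetic_div f (int r)"
    have dg: "degree g \<le> d" using Suc.prems by (simp add: g_def degree_synthetic_div)
    have "coeff f (Suc d) + int r * coeff g (Suc d) = coeff g d"
      using arg_cong[OF synthetic_div_correct[of f "int r"], of "\<lambda>u. coeff u (Suc d)"]
      by (simp add: g_def)
    then have cg: "coeff g d = coeff f (Suc d)" using dg by (simp add: coeff_eq_0)
    have pf: "poly f x = (x - int r) * poly g x + poly f (int r)" for x
      using arg_cong[OF synthetic_div_correct'[of "int r" f], of "\<lambda>u. poly u x"]
      by (simp add: g_def algebra_simps)
    have "{x\<in>{..<p}. int p dvd poly f (int x)} \<subseteq> insert r {x\<in>{..<p}. int p dvd poly g (int x)}"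
    proof
      fix x assume x: "x \<in> {x\<in>{..<p}. int p dvd poly f (int x)}"
      then have "int p dvd (int x - int r) * poly g (int x)"
        using r pf[of "int x"] by (metis (lifting) dvd_add_left_iff mem_Collect_eq)
      then have "int p dvd int x - int r \<or> int p dvd poly g (int x)"
        using assms(1) by (simp add: prime_dvd_mult_iff)
      moreover have "x = r" if "int p dvd int x - int r"
        using that x r by (metis (lifting) cong_less_modulus_unique_nat cong_int_iff cong_iff_dvd_diff lessThan_iff mem_Collect_eq)
      ultimately show "x \<in> insert r {x\<in>{..<p}. int p dvd poly g (int x)}" using x by auto
    qed
    then have "card {x\<in>{..<p}. int p dvd poly f (int x)} \<le> card (insert r {x\<in>{..<p}. int p dvd poly g (int x)})"
      by (intro card_mono) auto
    also have "\<dots> \<le> Suc (card {x\<in>{..<p}. int p dvd poly g (int x)})"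
      by (simp add: card_insert_if)
    also have "\<dots> \<le> Suc d" using Suc.IH[OF dg] Suc.prems cg by simp
    finally show ?thesis .
  next
    case False
    then have "{x\<in>{..<p}. int p dvd poly f (int x)} = {}" by auto
    then show ?thesis by (metis card.empty zero_le)
  qed
qed

definition power_sum :: "nat \<Rightarrow> nat \<Rightarrow> int \<Rightarrow> int \<Rightarrow> complex" where
  "power_sum k q a b = (\<Sum>x<q. chi q (a * int x ^ k + b * int x))"

lemma power_sum_cong:
  assumes "[a = a'] (mod int q)" "[b = b'] (mod int q)" "q > 0"
  shows "power_sum k q a b = power_sum k q a' b'"
  unfolding power_sum_def
  by (intro sum.cong refl chi_cong cong_add cong_mult assms cong_refl)

lemma bij_betw_mult_mod:
  assumes "prime p" "\<not> p dvd l"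
  shows "bij_betw (\<lambda>x. l * x mod p) {..<p} {..<(p::nat)}"
proof -
  have "inj_on (\<lambda>x. l * x mod p) {..<p}"
  proof (rule inj_onI)
    fix x y assume xy: "x \<in> {..<p}" "y \<in> {..<p}" "l * x mod p = l * y mod p"
    then have "[l * x = l * y] (mod p)" by (simp add: Cong.cong_def)
    moreover have "coprime l p" using assms by (metis coprime_commute prime_imp_coprime)
    ultimately have "[x = y] (mod p)" using cong_mult_lcancel_nat by blast
    then show "x = y" using xy cong_less_modulus_unique_nat by auto
  qed
  moreover have "(\<lambda>x. l * x mod p) ` {..<p} \<subseteq> {..<p}"
    using assms(1) prime_gt_0_nat by auto
  ultimately show ?thesis
    by (simp add: bij_betw_def card_image card_subset_eq)
qed

text \<open>The substitution \<open>x = l * y\<close> turns the coefficients \<open>(a * l ^ k, l * b)\<close> into \<open>(a, b)\<close>, and \<open>l * b\<close>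
runs over all residues together with \<open>b\<close>. So the moment over \<open>b\<close> for one \<open>a\<close> can be computed by
averaging over the \<open>a * l ^ k\<close>.\<close>
lemma sum_power_sum4_dilate:
  assumes "prime q" "\<not> q dvd l"
  shows "(\<Sum>b<q. norm (power_sum k q (a * int l ^ k) (int b)) ^ 4) = (\<Sum>b<q. norm (power_sum k q a (int b)) ^ 4)"
proof -
  have q: "q > 0" using assms(1) prime_gt_0_nat by blast
  have 1: "power_sum k q (a * int l ^ k) (b * int l) = power_sum k q a b" for b
  proof -
    have "power_sum k q (a * int l ^ k) (b * int l) = (\<Sum>x<q. chi q (a * int (l * x mod q) ^ k + b * int (l * x mod q)))"
      unfolding power_sum_def
    proof (intro sum.cong refl chi_cong q)
      fix x
      have "[int l * int x = int (l * x mod q)] (mod int q)"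
        by (metis cong_int_iff cong_mod_right cong_refl of_nat_mult)
      then have "[a * (int l * int x) ^ k + b * (int l * int x) = a * int (l * x mod q) ^ k + b * int (l * x mod q)] (mod int q)"
        by (intro cong_add cong_mult cong_pow cong_refl)
      then show "[a * int l ^ k * int x ^ k + b * int l * int x = a * int (l * x mod q) ^ k + b * int (l * x mod q)] (mod int q)"
        by (simp add: power_mult_distrib mult_ac)
    qed
    also have "\<dots> = power_sum k q a b"
      unfolding power_sum_def
      by (rule sum.reindex_bij_betw[OF bij_betw_mult_mod[OF assms], of "\<lambda>y. chi q (a * int y ^ k + b * int y)"])
    finally show ?thesis .
  qed
  have "(\<Sum>b<q. norm (power_sum k q (a * int l ^ k) (int b)) ^ 4)
     = (\<Sum>b<q. norm (power_sum k q (a * int l ^ k) (int (l * b mod q))) ^ 4)"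
    by (rule sum.reindex_bij_betw[OF bij_betw_mult_mod[OF assms], symmetric])
  also have "\<dots> = (\<Sum>b<q. norm (power_sum k q (a * int l ^ k) (int b * int l)) ^ 4)"
    by (intro sum.cong refl arg_cong[where f="\<lambda>z. norm z ^ 4"] power_sum_cong cong_refl q)
      (metis cong_int_iff cong_mod_left cong_refl of_nat_mult mult.commute)
  finally show ?thesis by (simp add: 1)
qed

text \<open>Put \<open>h = x1 - x3\<close>. Then \<open>x2 = x4 - h\<close>, and \<open>x4\<close> is a root of a polynomial of degree \<open>k - 1\<close> with
leading coefficient \<open>k * h\<close>, so there are at most \<open>k - 1\<close> choices of \<open>x4\<close> unless \<open>h = 0\<close>.\<close>
lemma card_quadruples:
  assumes "prime q" "k \<ge> 2" "k < q"
  shows "card {(x1,x2,x3,x4). x1 < q \<and> x2 < q \<and> x3 < q \<and> x4 < q \<and>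
            int q dvd int x1 + int x2 - int x3 - int x4 \<and>
            int q dvd int x1 ^ k + int x2 ^ k - int x3 ^ k - int x4 ^ k} \<le> k * q ^ 2"
    (is "card ?Z \<le> _")
proof -
  have q: "q > 0" using assms by simp
  define h where "h x1 x3 = int x1 - int x3" for x1 x3 :: nat
  define T where "T x1 x3 = {x\<in>{..<q}. int q dvd int x ^ k - (int x - h x1 x3) ^ k - (int x1 ^ k - int x3 ^ k)}" for x1 x3
  have dvdD: "r = r'" if "int q dvd int r - int r'" "r < q" "r' < q" for r r'
    using that by (metis cong_less_modulus_unique_nat cong_int_iff cong_iff_dvd_diff)
  have cT: "card (T x1 x3) \<le> k - 1" if "x1 < q" "x3 < q" "x1 \<noteq> x3" for x1 x3
  proof -
    define c where "c = h x1 x3"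
    define f where "f = monom 1 k - [:-c, 1:] ^ k - [:int x1 ^ k - int x3 ^ k:]"
    have c0: "\<not> int q dvd c" using that dvdD by (auto simp: c_def h_def)
    have lin: "coeff ([:-c, 1:] ^ k) i = of_nat (k choose i) * (-c) ^ (k - i)" for i
    proof (cases "i \<le> k")
      case True then show ?thesis using coeff_linear_poly_power[of i k "-c" 1] by simp
    next
      case False then show ?thesis by (simp add: coeff_eq_0 degree_linear_power)
    qed
    have "degree f \<le> k - 1"
    proof (rule degree_le, intro allI impI)
      fix i assume "k - 1 < i"
      then show "coeff f i = 0" using assms(2)
        by (cases "i = k") (auto simp: f_def lin coeff_pCons split: nat.splits)
    qed
    moreover have "coeff f (k - 1) = int k * c"
    proof -
      obtain j where j: "k = Suc (Suc j)" using assms(2) by (metis add_2_eq_Suc le_Suc_ex)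
      have "coeff ([:-c, 1:] ^ k) (Suc j) = - int k * c"
        unfolding lin by (simp only: j binomial_Suc_n) (simp add: algebra_simps)
      moreover have "coeff f (k - 1) = - coeff ([:-c, 1:] ^ k) (Suc j)"
        unfolding f_def coeff_diff by (simp add: j del: power_Suc)
      ultimately show ?thesis by simp
    qed
    then have "\<not> int q dvd coeff f (k - 1)"
      using assms c0 by (auto simp: prime_dvd_mult_iff dest: zdvd_imp_le)
    ultimately have "card {x\<in>{..<q}. int q dvd poly f (int x)} \<le> k - 1"
      by (intro poly_roots_mod_prime assms)
    moreover have "poly f x = x ^ k - (x - c) ^ k - (int x1 ^ k - int x3 ^ k)" for x
      by (simp add: f_def poly_monom)
    ultimately show ?thesis by (simp add: T_def c_def)
  qed
  have T_eq: "card (T x1 x1) \<le> q" for x1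
    using card_mono[of "{..<q}" "T x1 x1"] by (auto simp: T_def)
  define F where "F = (\<lambda>(x1::nat, x2::nat, x3::nat, x4::nat). ((x1, x3), x4))"
  have "inj_on F ?Z"
  proof (rule inj_onI, clarsimp simp: F_def)
    fix x1 x2 x3 x4 x2'
    assume "x2 < q" "x2' < q" "int q dvd int x1 + int x2 - int x3 - int x4"
      "int q dvd int x1 + int x2' - int x3 - int x4"
    moreover from this(3,4) have "int q dvd int x2 - int x2'"
      using dvd_diff[of "int q" "int x1 + int x2 - int x3 - int x4" "int x1 + int x2' - int x3 - int x4"] by simp
    ultimately show "x2 = x2'" using dvdD by blast
  qed
  then have "card ?Z = card (F ` ?Z)" by (simp add: card_image)
  also have "F ` ?Z \<subseteq> (SIGMA p:{..<q}\<times>{..<q}. T (fst p) (snd p))"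
  proof (clarsimp simp: F_def T_def)
    fix x1 x2 x3 x4
    assume A: "int q dvd int x1 + int x2 - int x3 - int x4"
      "int q dvd int x1 ^ k + int x2 ^ k - int x3 ^ k - int x4 ^ k"
    have "[int x2 = int x4 - h x1 x3] (mod int q)"
      using A(1) by (simp add: cong_iff_dvd_diff h_def algebra_simps)
    then have "[int x2 ^ k = (int x4 - h x1 x3) ^ k] (mod int q)" by (rule cong_pow)
    then have "int q dvd int x2 ^ k - (int x4 - h x1 x3) ^ k" by (simp add: cong_iff_dvd_diff)
    from dvd_diff[OF this A(2)]
    show "int q dvd int x4 ^ k - (int x4 - h x1 x3) ^ k - (int x1 ^ k - int x3 ^ k)"
      by (simp add: algebra_simps)
  qed
  then have "card (F ` ?Z) \<le> card (SIGMA p:{..<q}\<times>{..<q}. T (fst p) (snd p))"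
    by (intro card_mono) (auto simp: T_def)
  also have "\<dots> = (\<Sum>p\<in>{..<q}\<times>{..<q}. card (T (fst p) (snd p)))"
    by (intro card_SigmaI) (auto simp: T_def)
  also have "\<dots> = (\<Sum>x1<q. \<Sum>x3<q. card (T x1 x3))"
    by (simp add: sum.cartesian_product case_prod_beta)
  also have "\<dots> \<le> (\<Sum>x1<q. \<Sum>x3<q. (k - 1) + (if x3 = x1 then q else 0))"
    using cT T_eq by (intro sum_mono) (auto simp: trans_le_add2)
  also have "\<dots> = q * (q * (k - 1) + q)" by (simp add: sum.distrib)
  also have "\<dots> = k * q ^ 2" using assms(2) by (cases k) (auto simp: power2_eq_square algebra_simps)
  finally show ?thesis .
qed

text \<open>The fourth power is a sum over quadruples, and summing over all \<open>a\<close> and \<open>b\<close> keeps the quadruples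
for which both frequencies vanish modulo \<open>q\<close>.\<close>
lemma sum_power_sum4_total:
  assumes "q > 0"
  shows "(\<Sum>a<q. \<Sum>b<q. norm (power_sum k q (int a) (int b)) ^ 4)
     = real (q ^ 2 * card {(x1,x2,x3,x4). x1 < q \<and> x2 < q \<and> x3 < q \<and> x4 < q \<and>
            int q dvd int x1 + int x2 - int x3 - int x4 \<and>
            int q dvd int x1 ^ k + int x2 ^ k - int x3 ^ k - int x4 ^ k})"
    (is "_ = real (q ^ 2 * card ?Z)")
proof -
  define A where "A = {..<q} \<times> {..<q}"
  define u where "u p = int (fst p) ^ k + int (snd p) ^ k" for p :: "nat \<times> nat"
  define v where "v p = int (fst p) + int (snd p)" for p :: "nat \<times> nat"
  define Z' where "Z' = {pp\<in>A \<times> A. int q dvd v (fst pp) - v (snd pp) \<and> int q dvd u (fst pp) - u (snd pp)}"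
  have sq: "power_sum k q a b * power_sum k q a b = (\<Sum>p\<in>A. chi q (a * u p + b * v p))" for a b
    unfolding power_sum_def A_def sum_product
    by (simp add: sum.cartesian_product case_prod_beta u_def v_def algebra_simps flip: chi_add)
  have "of_real (norm (power_sum k q a b) ^ 4)
      = (\<Sum>p\<in>A. \<Sum>p'\<in>A. chi q (a * (u p - u p')) * chi q (b * (v p - v p')))" for a b
  proof -
    have "norm (power_sum k q a b) ^ 4 = (norm (power_sum k q a b * power_sum k q a b))\<^sup>2"
      by (simp add: norm_mult power2_eq_square power4_eq_xxxx)
    also have "of_real \<dots> = (\<Sum>p\<in>A. \<Sum>p'\<in>A. chi q (a * u p + b * v p) * cnj (chi q (a * u p' + b * v p')))"
      by (simp only: sq norm_sum_sq)
    also have "\<dots> = (\<Sum>p\<in>A. \<Sum>p'\<in>A. chi q (a * (u p - u p')) * chi q (b * (v p - v p')))"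
      by (intro sum.cong refl) (simp add: cnj_chi algebra_simps flip: chi_add)
    finally show ?thesis .
  qed
  then have "complex_of_real (\<Sum>a<q. \<Sum>b<q. norm (power_sum k q (int a) (int b)) ^ 4)
      = (\<Sum>a<q. \<Sum>b<q. \<Sum>p\<in>A. \<Sum>p'\<in>A. chi q (int a * (u p - u p')) * chi q (int b * (v p - v p')))"
    by simp
  also have "\<dots> = (\<Sum>a<q. \<Sum>p\<in>A. \<Sum>p'\<in>A. \<Sum>b<q. chi q (int a * (u p - u p')) * chi q (int b * (v p - v p')))"
    by (rule sum.cong[OF refl], subst sum.swap, rule sum.cong[OF refl], subst sum.swap, rule refl)
  also have "\<dots> = (\<Sum>p\<in>A. \<Sum>p'\<in>A. \<Sum>a<q. \<Sum>b<q. chi q (int a * (u p - u p')) * chi q (int b * (v p - v p')))"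
    by (subst sum.swap, rule sum.cong[OF refl], subst sum.swap, rule refl)
  also have "\<dots> = (\<Sum>p\<in>A. \<Sum>p'\<in>A. (\<Sum>a<q. chi q (int a * (u p - u p'))) * (\<Sum>b<q. chi q (int b * (v p - v p'))))"
    by (simp only: sum_product)
  also have "\<dots> = (\<Sum>p\<in>A. \<Sum>p'\<in>A. if int q dvd v p - v p' \<and> int q dvd u p - u p' then of_nat (q ^ 2) else 0)"
    by (intro sum.cong refl) (simp add: sum_chi[OF assms] power2_eq_square)
  also have "\<dots> = (\<Sum>pp\<in>A\<times>A. if int q dvd v (fst pp) - v (snd pp) \<and> int q dvd u (fst pp) - u (snd pp) then of_nat (q ^ 2) else 0)"
    by (simp add: sum.cartesian_product case_prod_beta)
  also have "\<dots> = (\<Sum>pp\<in>Z'. of_nat (q ^ 2))"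
    by (subst sum.inter_filter[symmetric]) (auto simp: Z'_def A_def)
  also have "\<dots> = of_real (real (q ^ 2 * card Z'))" by simp
  finally have "(\<Sum>a<q. \<Sum>b<q. norm (power_sum k q (int a) (int b)) ^ 4) = real (q ^ 2 * card Z')"
    using of_real_eq_iff by blast
  moreover have "bij_betw (\<lambda>pp. (fst (fst pp), snd (fst pp), fst (snd pp), snd (snd pp))) Z' ?Z"
    by (rule bij_betwI[where g="\<lambda>(x1,x2,x3,x4). ((x1,x2),(x3,x4))"])
      (auto simp: Z'_def A_def u_def v_def algebra_simps)
  ultimately show ?thesis by (metis (no_types, lifting) bij_betw_same_card)
qed

text \<open>By dilation invariance the moment for \<open>a\<close> is the average over \<open>l\<close> of the moments for \<open>a * l ^ k\<close>.
Each residue is of this form for at most \<open>k\<close> values of \<open>l\<close>, so the average is at most \<open>k / (q - 1)\<close>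
times the moment over both coefficients.\<close>
lemma sum_power_sum4_le:
  assumes "prime q" "k \<ge> 2" "k < q" "\<not> int q dvd a"
  shows "(\<Sum>b<q. norm (power_sum k q a (int b)) ^ 4) \<le> 2 * real k ^ 2 * real q ^ 3"
proof -
  have q: "q > 0" using assms by simp
  define F where "F c = (\<Sum>b<q. norm (power_sum k q c (int b)) ^ 4)" for c
  define g where "g l = nat (a * int l ^ k mod int q)" for l :: nat
  have F0: "F c \<ge> 0" for c by (simp add: F_def sum_nonneg)
  have Fg: "F (int (g l)) = F a" if "l \<in> {1..<q}" for l
  proof -
    have "\<not> q dvd l" using that by (auto dest: dvd_imp_le)
    then have "F a = F (a * int l ^ k)"
      unfolding F_def using sum_power_sum4_dilate[OF assms(1)] by metis
    also have "\<dots> = F (int (g l))"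
      unfolding F_def g_def using q
      by (intro sum.cong refl arg_cong[where f="\<lambda>z. norm z ^ 4"] power_sum_cong)
        (auto simp: Cong.cong_def)
    finally show ?thesis by simp
  qed
  have fib: "card {l\<in>{1..<q}. g l = c} \<le> k" for c
  proof -
    have "card {l\<in>{1..<q}. g l = c} \<le> card {x\<in>{..<q}. int q dvd poly (monom a k - [:int c:]) (int x)}"
    proof (intro card_mono subsetI)
      fix l assume l: "l \<in> {l\<in>{1..<q}. g l = c}"
      then have "int c = a * int l ^ k mod int q" using q by (auto simp: g_def)
      then have "int q dvd a * int l ^ k - int c" by (metis dvd_minus_mod)
      with l show "l \<in> {x\<in>{..<q}. int q dvd poly (monom a k - [:int c:]) (int x)}"
        by (simp add: poly_monom)
    qed simp
    also have "\<dots> \<le> k"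
    proof (rule poly_roots_mod_prime[OF assms(1)])
      show "degree (monom a k - [:int c:]) \<le> k"
        by (intro degree_diff_le degree_monom_le) simp
      show "\<not> int q dvd coeff (monom a k - [:int c:]) k"
        using assms by (auto simp: coeff_pCons split: nat.split)
    qed
    finally show ?thesis .
  qed
  have "real (q - 1) * F a = (\<Sum>l\<in>{1..<q}. F (int (g l)))" using Fg by simp
  also have "\<dots> = (\<Sum>c<q. \<Sum>l\<in>{l\<in>{1..<q}. g l = c}. F (int (g l)))"
    by (rule sum.group[symmetric]) (use q in \<open>auto simp: g_def nat_less_iff\<close>)
  also have "\<dots> = (\<Sum>c<q. real (card {l\<in>{1..<q}. g l = c}) * F (int c))" by simp
  also have "\<dots> \<le> (\<Sum>c<q. real k * F (int c))"
    using fib F0 by (intro sum_mono mult_right_mono) auto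
  also have "\<dots> = real k * (\<Sum>c<q. F (int c))" by (simp add: sum_distrib_left)
  also have "(\<Sum>c<q. F (int c)) \<le> real (q ^ 2 * (k * q ^ 2))"
    unfolding F_def sum_power_sum4_total[OF q] of_nat_le_iff
    by (intro mult_left_mono card_quadruples assms) simp
  finally have "real (q - 1) * F a \<le> real k * real (q ^ 2 * (k * q ^ 2))" by (simp add: mult_left_mono)
  moreover have "real q / 2 * F a \<le> real (q - 1) * F a"
    using assms F0 by (intro mult_right_mono) (auto simp: of_nat_diff)
  ultimately have "real q * F a \<le> real q * (2 * real k ^ 2 * real q ^ 3)"
    by (simp add: power2_eq_square power3_eq_cube algebra_simps)
  then show ?thesis using q by (simp add: F_def)
qed

text \<open>The mean of the squared modulus over \<open>b\<close> is \<open>q\<close>, so the \<open>b\<close> at which it is at least \<open>q / 2\<close> carry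
half of the second moment. By Cauchy-Schwarz and the bound on the fourth moment they cannot be
few.\<close>
lemma many_large_power_sums:
  assumes "prime q" "k \<ge> 2" "k < q" "\<not> int q dvd a"
  shows "real q \<le> 8 * real k ^ 2 * card {b\<in>{..<q}. real q / 2 \<le> (norm (power_sum k q a (int b)))\<^sup>2}"
proof -
  have q: "q > 0" using assms by simp
  define S where "S b = (norm (power_sum k q a (int b)))\<^sup>2" for b :: nat
  define A where "A = {b\<in>{..<q}. real q / 2 \<le> S b}"
  have "(\<Sum>b<q. S b) = (\<Sum>b<q. (norm (\<Sum>r<q. chi q (a * int r ^ k) * chi q (int b * int r)))\<^sup>2)"
    by (simp add: S_def power_sum_def chi_add)
  also have "\<dots> = real q * real q" using q by (simp add: chi_parseval)
  finally have tot: "(\<Sum>b<q. S b) = real q * real q" .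
  have "{..<q} = A \<union> ({..<q} - A)" by (auto simp: A_def)
  then have "(\<Sum>b<q. S b) = (\<Sum>b\<in>A. S b) + (\<Sum>b\<in>{..<q} - A. S b)"
    by (metis (no_types, lifting) A_def finite_lessThan mem_Collect_eq subsetI sum.subset_diff add.commute)
  moreover have "(\<Sum>b\<in>{..<q} - A. S b) \<le> (\<Sum>b\<in>{..<q} - A. real q / 2)"
    by (intro sum_mono) (auto simp: A_def)
  moreover have "\<dots> \<le> real q * (real q / 2)"
  proof -
    have "card ({..<q} - A) \<le> q" by (metis Diff_subset card_lessThan card_mono finite_lessThan)
    then show ?thesis by (simp add: mult_mono)
  qed
  ultimately have low: "real q * real q / 2 \<le> (\<Sum>b\<in>A. S b)" using tot by simp
  have "(real q * real q / 2)\<^sup>2 \<le> (\<Sum>b\<in>A. S b)\<^sup>2" by (intro power_mono low) auto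
  also have "\<dots> \<le> (\<Sum>b\<in>A. (S b)\<^sup>2) * real (card A)"
    using sum_squared_le_sum_of_squares[of S A] by (simp add: A_def mult.commute)
  also have "(\<Sum>b\<in>A. (S b)\<^sup>2) \<le> (\<Sum>b<q. (S b)\<^sup>2)" by (intro sum_mono2) (auto simp: A_def)
  also have "\<dots> \<le> 2 * real k ^ 2 * real q ^ 3"
    using sum_power_sum4_le[OF assms] by (simp add: S_def flip: power_mult)
  finally have "(real q * real q / 2)\<^sup>2 \<le> 2 * real k ^ 2 * real q ^ 3 * real (card A)"
    by (simp add: mult_right_mono)
  then have "real q ^ 3 * real q \<le> real q ^ 3 * (8 * real k ^ 2 * real (card A))"
    by (simp add: power2_eq_square power3_eq_cube algebra_simps)
  then show ?thesis using q by (simp add: A_def S_def)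
qed

section \<open>A lower bound for the number of primes\<close>

text \<open>With \<open>L(n, j) = j * (n choose j)\<close>, Leibniz's harmonic triangle says that
\<open>1 / L(l + 1, j + 1) = 1 / L(l, j) - 1 / L(l + 1, j)\<close>. Multiplied by \<open>w\<close> the right hand side is an
integer by induction.\<close>
lemma leibniz_dvd:
  fixes w :: nat
  assumes "\<And>i. 1 \<le> i \<Longrightarrow> i \<le> n \<Longrightarrow> i dvd w" "1 \<le> j" "j \<le> m" "m \<le> n"
  shows "j * (m choose j) dvd w"
  using assms(2-4)
proof (induction j arbitrary: m)
  case 0 then show ?case by simp
next
  case (Suc j)
  show ?case
  proof (cases "j = 0")
    case True
    then show ?thesis using Suc.prems assms(1)[of m] by simp
  next
    case False
    obtain l where l: "m = Suc l" using Suc.prems by (cases m) auto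
    have "j * (l choose j) dvd w" "j * (Suc l choose j) dvd w"
      using Suc.IH[of l] Suc.IH[of "Suc l"] Suc.prems False l by auto
    then obtain u v where u: "w = j * (l choose j) * u" and v: "w = j * (Suc l choose j) * v"
      by (meson dvdE)
    have jl: "j \<le> l" using Suc.prems l by simp
    define c where "c = int (l choose j)"
    have c1: "(int (Suc l) - int j) * int (Suc l choose j) = int (Suc l) * c"
      using binomial_absorb_comp[of "Suc l" j] jl unfolding c_def
      by (metis Suc_diff_le diff_Suc_1 le_SucI of_nat_diff of_nat_mult)
    have "int (Suc l) * c * int v * int j = (int (Suc l) - int j) * int w"
      using v c1 by (simp add: algebra_simps)
    moreover have "int (Suc l) * c * int u * int j = int (Suc l) * int w"
      using u by (simp add: c_def algebra_simps)
    ultimately have "int j * (int (Suc l) * c * (int u - int v)) = int j * int w"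
      by (simp add: algebra_simps)
    then have "int w = int (Suc l) * c * (int u - int v)" using False by simp
    moreover have "int (Suc j * (m choose Suc j)) = int (Suc l) * c"
      by (simp only: l Suc_times_binomial c_def of_nat_mult)
    ultimately have "int (Suc j * (m choose Suc j)) dvd int w" by (metis dvd_triv_left)
    then show ?thesis by (simp only: int_dvd_int_iff)
  qed
qed

text \<open>The product \<open>w\<close> of the largest powers \<open>p ^ e \<le> 2 * m\<close> of the primes \<open>p \<le> 2 * m\<close> is a common multiple of
\<open>1, \<dots>, 2 * m\<close>. It is hence a multiple of \<open>m * (2 * m choose m)\<close>, and it has one factor, at most
\<open>2 * m\<close>, for each prime.\<close>
lemma four_power_le_power_prime_count:
  fixes m :: nat
  assumes "m \<ge> 1"
  shows "4 ^ m \<le> 2 * (2 * m) ^ card {p. prime p \<and> p \<le> 2 * m}"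
proof -
  define n where "n = 2 * m"
  define P where "P = {p. prime p \<and> p \<le> n}"
  define e where "e p = Max {i. p ^ i \<le> n}" for p
  have n: "n \<ge> 2" using assms by (simp add: n_def)
  have finP: "finite P" by (simp add: P_def)
  have fin: "finite {i. p ^ i \<le> n}" if "p \<in> P" for p
  proof (rule finite_subset)
    show "{i. p ^ i \<le> n} \<subseteq> {..n}"
    proof
      fix i assume "i \<in> {i. p ^ i \<le> n}"
      moreover have "i < p ^ i" using that by (auto simp: P_def dest: prime_gt_Suc_0_nat intro!: power_gt_expt)
      ultimately show "i \<in> {..n}" by simp
    qed
  qed simp
  have e: "p ^ e p \<le> n" if "p \<in> P" for p
  proof -
    have "0 \<in> {i. p ^ i \<le> n}" using n by simp
    then have "Max {i. p ^ i \<le> n} \<in> {i. p ^ i \<le> n}"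
      using Max_in[OF fin[OF that]] by blast
    then show ?thesis by (simp add: e_def)
  qed
  define w where "w = (\<Prod>p\<in>P. p ^ e p)"
  have "w > 0" using finP by (auto simp: w_def P_def prime_gt_0_nat intro!: prod_pos)
  have dvd: "i dvd w" if "1 \<le> i" "i \<le> n" for i
  proof (rule multiplicity_le_imp_dvd)
    show "i \<noteq> 0" using that by simp
    fix p :: nat assume p: "prime p"
    show "multiplicity p i \<le> multiplicity p w"
    proof (cases "p \<in> P")
      case True
      have "p ^ multiplicity p i \<le> n"
        using that multiplicity_dvd[of p i] by (meson dvd_imp_le le_trans less_le_trans zero_less_one)
      then have "multiplicity p i \<le> e p"
        using fin[OF True] by (auto simp: e_def intro: Max_ge)
      also have "e p = multiplicity p w"
        unfolding w_def using True finP by (subst multiplicity_prod_prime_powers) (auto simp: P_def p)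
      finally show ?thesis .
    next
      case False
      then have "\<not> p dvd i" using p that by (auto simp: P_def dest: dvd_imp_le)
      then show ?thesis by (simp add: not_dvd_imp_multiplicity_0)
    qed
  qed
  have "m * (2 * m choose m) dvd w"
    by (rule leibniz_dvd[OF dvd]) (use assms in \<open>auto simp: n_def\<close>)
  then have "m * (2 * m choose m) \<le> w" using \<open>w > 0\<close> by (rule dvd_imp_le)
  also have "w \<le> (\<Prod>p\<in>P. n)" unfolding w_def using e by (intro prod_mono) auto
  also have "\<dots> = n ^ card P" by simp
  finally have "real (m * (2 * m choose m)) \<le> real (n ^ card P)" by (simp only: of_nat_le_iff)
  moreover have "4 ^ m / (2 * real m) \<le> real (2 * m choose m)"
    using central_binomial_lower_bound[of m] assms by simp
  then have "4 ^ m \<le> 2 * real (m * (2 * m choose m))" using assms by (simp add: field_simps)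
  ultimately have "real (4 ^ m) \<le> real (2 * n ^ card P)" by simp
  then show ?thesis unfolding P_def n_def by (simp only: of_nat_le_iff)
qed

section \<open>Lebesgue measure on a finite product\<close>

lemma prod_Basis_vec:
  fixes x :: "real^'n::finite"
  shows "(\<Prod>b\<in>Basis. x \<bullet> b) = (\<Prod>i\<in>UNIV. x $ i)"
proof -
  have B: "(Basis :: (real^'n) set) = range (\<lambda>i. axis i 1)" by (auto simp: Basis_vec_def)
  have "inj (\<lambda>i::'n. axis i (1::real))" by (simp add: inj_on_def axis_eq_axis)
  then show ?thesis unfolding B by (subst prod.reindex) (simp_all add: inner_axis)
qed

lemma borel_measurable_vec_lambda [measurable]:
  "(\<lambda>f. \<chi> i. f i) \<in> measurable (\<Pi>\<^sub>M i\<in>(UNIV::'n::finite set). (lborel :: real measure)) (borel :: (real^'n) measure)"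
proof (subst borel_measurable_euclidean_space, rule ballI)
  fix b :: "real^'n" assume "b \<in> Basis"
  then obtain i where "b = axis i 1" by (auto simp: Basis_vec_def)
  then have "(\<lambda>f. (\<chi> i. f i) \<bullet> b) = (\<lambda>f. f i)" by (simp add: inner_axis)
  moreover have "(\<lambda>f. f i) \<in> borel_measurable (\<Pi>\<^sub>M i\<in>(UNIV::'n set). (lborel :: real measure))"
    using measurable_component_singleton[of i UNIV "\<lambda>_. lborel :: real measure"] by simp
  ultimately show "(\<lambda>f. (\<chi> i. f i) \<bullet> b) \<in> borel_measurable (\<Pi>\<^sub>M i\<in>(UNIV::'n set). (lborel :: real measure))"
    by simp
qed

interpretation lborel_product: product_sigma_finite "\<lambda>_::'n::finite. lborel :: real measure" ..

text \<open>The factors are indexed by the coordinates, not by the basis vectors, to suit functions that are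
products over the coordinates. A measure is recognized as Lebesgue measure by its values on
boxes.\<close>
lemma lborel_vec:
  "(lborel :: (real^'n::finite) measure) = distr (\<Pi>\<^sub>M i\<in>(UNIV::'n set). (lborel :: real measure)) borel (\<lambda>f. \<chi> i. f i)"
proof (rule lborel_eqI)
  fix l u :: "real^'n" assume lu: "\<And>b. b \<in> Basis \<Longrightarrow> l \<bullet> b \<le> u \<bullet> b"
  have le: "l $ i \<le> u $ i" for i using lu[of "axis i 1"] by (simp add: inner_axis)
  have "emeasure (distr (\<Pi>\<^sub>M i\<in>(UNIV::'n set). (lborel :: real measure)) borel (\<lambda>f. \<chi> i. f i)) (box l u)
     = emeasure (\<Pi>\<^sub>M i\<in>(UNIV::'n set). (lborel :: real measure)) (\<Pi>\<^sub>E i\<in>UNIV. {l $ i <..< u $ i})"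
    by (subst emeasure_distr) (auto intro!: arg_cong2[where f=emeasure] simp: space_PiM mem_box_cart PiE_def Pi_iff)
  also have "\<dots> = (\<Prod>i\<in>UNIV. ennreal ((u - l) $ i))"
    using le by (subst lborel_product.emeasure_PiM) auto
  also have "\<dots> = ennreal (\<Prod>b\<in>Basis. (u - l) \<bullet> b)"
    using le by (simp add: prod_Basis_vec prod_ennreal)
  finally show "emeasure (distr (\<Pi>\<^sub>M i\<in>(UNIV::'n set). (lborel :: real measure)) borel (\<lambda>f. \<chi> i. f i)) (box l u) = ennreal (\<Prod>b\<in>Basis. (u - l) \<bullet> b)" .
qed simp

lemma emeasure_vec_prod:
  fixes B :: "'n::finite \<Rightarrow> real set"
  assumes [measurable]: "\<And>i. B i \<in> sets borel"
  shows "emeasure lborel {x::real^'n. \<forall>i. x $ i \<in> B i} = (\<Prod>i\<in>UNIV. emeasure lborel (B i))"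
proof -
  have [measurable]: "{x::real^'n. \<forall>i. x $ i \<in> B i} \<in> sets borel" by measurable
  have "emeasure lborel {x::real^'n. \<forall>i. x $ i \<in> B i}
    = emeasure (\<Pi>\<^sub>M i\<in>(UNIV::'n set). (lborel :: real measure)) (\<Pi>\<^sub>E i\<in>UNIV. B i)"
    by (subst lborel_vec, subst emeasure_distr) (auto intro!: arg_cong2[where f=emeasure] simp: space_PiM PiE_def Pi_iff)
  also have "\<dots> = (\<Prod>i\<in>UNIV. emeasure lborel (B i))"
    by (subst lborel_product.emeasure_PiM) auto
  finally show ?thesis .
qed

lemma
  fixes f :: "'n::finite \<Rightarrow> real \<Rightarrow> 'a::{real_normed_field,banach,second_countable_topology}"
  assumes int: "\<And>i. integrable lborel (f i)"
  shows integrable_vec_prod: "integrable lborel (\<lambda>x::real^'n. \<Prod>i\<in>UNIV. f i (x $ i))"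
    and integral_vec_prod: "(LINT x|lborel. (\<Prod>i\<in>UNIV. f i ((x::real^'n) $ i))) = (\<Prod>i\<in>UNIV. (LINT y|lborel. f i y))"
proof -
  have [measurable]: "f i \<in> borel_measurable borel" for i
    using borel_measurable_integrable[OF int[of i]] by simp
  have m: "(\<lambda>x::real^'n. \<Prod>i\<in>UNIV. f i (x $ i)) \<in> borel_measurable borel" by measurable
  show "integrable lborel (\<lambda>x::real^'n. \<Prod>i\<in>UNIV. f i (x $ i))"
    by (subst lborel_vec, subst integrable_distr_eq[OF borel_measurable_vec_lambda m])
      (use lborel_product.product_integrable_prod[of UNIV f] int in simp)
  show "(LINT x|lborel. (\<Prod>i\<in>UNIV. f i ((x::real^'n) $ i))) = (\<Prod>i\<in>UNIV. (LINT y|lborel. f i y))"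
    by (subst lborel_vec, subst integral_distr[OF borel_measurable_vec_lambda m])
      (use lborel_product.product_integral_prod[of UNIV f] int in simp)
qed

section \<open>Schwartz functions that are products over the coordinates\<close>

text \<open>The derivatives are given by a sequence, so that no iterated derivative has to be computed in
order to prove membership.\<close>
definition schwartz1 :: "(real \<Rightarrow> complex) set" where
  "schwartz1 = {f. \<exists>D::nat \<Rightarrow> real \<Rightarrow> complex. D 0 = f \<and>
     (\<forall>l x. (D l has_vector_derivative D (Suc l) x) (at x)) \<and>
     (\<forall>l m. bounded (range (\<lambda>x. (1 + \<bar>x\<bar>) ^ m *\<^sub>R D l x)))}"

lemma has_derivative_vec_prod:
  fixes D :: "'n::finite \<Rightarrow> nat \<Rightarrow> real \<Rightarrow> complex" and x :: "real^'n"
  assumes "\<And>i l x. (D i l has_vector_derivative D i (Suc l) x) (at x)"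
  shows "((\<lambda>x. \<Prod>i\<in>UNIV. D i (c i) (x $ i)) has_derivative
     (\<lambda>h. \<Sum>i\<in>UNIV. (h $ i *\<^sub>R D i (Suc (c i)) (x $ i)) * (\<Prod>j\<in>UNIV - {i}. D j (c j) (x $ j)))) (at x)"
proof (rule has_derivative_prod)
  fix i
  have "((\<lambda>x::real^'n. x $ i) has_derivative (\<lambda>h. h $ i)) (at x)"
    by (rule bounded_linear_imp_has_derivative[OF bounded_linear_vec_nth])
  moreover have "(D i (c i) has_derivative (\<lambda>h. h *\<^sub>R D i (Suc (c i)) (x $ i))) (at (x $ i))"
    using assms by (simp add: has_vector_derivative_def)
  ultimately show "((\<lambda>x. D i (c i) (x $ i)) has_derivative (\<lambda>h. h $ i *\<^sub>R D i (Suc (c i)) (x $ i))) (at x)"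
    by (rule has_derivative_compose)
qed

text \<open>A partial derivative of a product over the coordinates differentiates one factor only, so all
iterated partial derivatives are again such products.\<close>
lemma partial_derivs_vec_prod:
  fixes D :: "'n::finite \<Rightarrow> nat \<Rightarrow> real \<Rightarrow> complex"
  assumes "\<And>i l x. (D i l has_vector_derivative D i (Suc l) x) (at x)"
  shows "partial_derivs is (\<lambda>x. \<Prod>i\<in>UNIV. D i 0 (x $ i)) = (\<lambda>x. \<Prod>i\<in>UNIV. D i (count_list is i) (x $ i))"
proof (induction "is")
  case Nil
  then show ?case by (simp add: partial_derivs_def)
next
  case (Cons k "is")
  have "partial_derivs (k # is) (\<lambda>x. \<Prod>i\<in>UNIV. D i 0 (x $ i))
      = partial_deriv k (\<lambda>x. \<Prod>i\<in>UNIV. D i (count_list is i) (x $ i))"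
    using Cons by (simp add: partial_derivs_def)
  also have "\<dots> = (\<lambda>x. \<Prod>i\<in>UNIV. D i (count_list (k # is) i) (x $ i))"
  proof
    fix x :: "real^'n"
    have "partial_deriv k (\<lambda>x. \<Prod>i\<in>UNIV. D i (count_list is i) (x $ i)) x
       = (\<Sum>i\<in>UNIV. (axis k 1 $ i *\<^sub>R D i (Suc (count_list is i)) (x $ i)) * (\<Prod>j\<in>UNIV - {i}. D j (count_list is j) (x $ j)))"
      unfolding partial_deriv_def
      by (subst frechet_derivative_at[OF has_derivative_vec_prod[where D=D, OF assms], symmetric]) simp
    also have "\<dots> = (\<Sum>i\<in>UNIV. if i = k then D k (Suc (count_list is k)) (x $ k) * (\<Prod>j\<in>UNIV - {k}. D j (count_list is j) (x $ j)) else 0)"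
      by (intro sum.cong refl) (auto simp: axis_def)
    also have "\<dots> = D k (Suc (count_list is k)) (x $ k) * (\<Prod>j\<in>UNIV - {k}. D j (count_list is j) (x $ j))"
      by simp
    also have "\<dots> = (\<Prod>i\<in>UNIV. D i (count_list (k # is) i) (x $ i))"
      by (subst prod.remove[of UNIV k]) (auto intro!: prod.cong)
    finally show "partial_deriv k (\<lambda>x. \<Prod>i\<in>UNIV. D i (count_list is i) (x $ i)) x
      = (\<Prod>i\<in>UNIV. D i (count_list (k # is) i) (x $ i))" .
  qed
  finally show ?case .
qed

lemma one_plus_sum_le_prod:
  fixes a :: "'a \<Rightarrow> real"
  assumes "\<And>i. i \<in> A \<Longrightarrow> 0 \<le> a i"
  shows "1 + (\<Sum>i\<in>A. a i) \<le> (\<Prod>i\<in>A. 1 + a i)"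
  using assms
proof (induction A rule: infinite_finite_induct)
  case (insert i A)
  have "1 \<le> (\<Prod>i\<in>A. 1 + a i)" using insert.prems by (intro prod_ge_1) simp
  then have "a i * 1 \<le> a i * (\<Prod>i\<in>A. 1 + a i)" using insert.prems by (intro mult_left_mono) auto
  then show ?case using insert by (simp add: algebra_simps)
qed auto

lemma one_plus_norm_le_prod:
  fixes x :: "real^'n::finite"
  shows "1 + norm x \<le> (\<Prod>i\<in>UNIV. 1 + \<bar>x $ i\<bar>)"
  using norm_le_l1_cart[of x] one_plus_sum_le_prod[of UNIV "\<lambda>i. \<bar>x $ i\<bar>"] by simp

lemma schwartz_vec_prod:
  fixes f :: "'n::finite \<Rightarrow> real \<Rightarrow> complex"
  assumes "\<And>i. f i \<in> schwartz1"
  shows "(\<lambda>x. \<Prod>i\<in>UNIV. f i (x $ i)) \<in> schwartz"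
proof -
  have "\<exists>D::nat \<Rightarrow> real \<Rightarrow> complex. D 0 = f i \<and>
     (\<forall>l x. (D l has_vector_derivative D (Suc l) x) (at x)) \<and>
     (\<forall>l m. bounded (range (\<lambda>x. (1 + \<bar>x\<bar>) ^ m *\<^sub>R D l x)))" for i
    using assms[of i] by (simp add: schwartz1_def)
  then obtain D :: "'n \<Rightarrow> nat \<Rightarrow> real \<Rightarrow> complex" where D0: "\<And>i. D i 0 = f i"
    and D1: "\<And>i l x. (D i l has_vector_derivative D i (Suc l) x) (at x)"
    and D2: "\<And>i l m. bounded (range (\<lambda>x. (1 + \<bar>x\<bar>) ^ m *\<^sub>R D i l x))" by metis
  have pd: "partial_derivs is (\<lambda>x. \<Prod>i\<in>UNIV. f i (x $ i)) = (\<lambda>x. \<Prod>i\<in>UNIV. D i (count_list is i) (x $ i))" for "is"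
    using partial_derivs_vec_prod[where D=D, OF D1] by (simp add: D0)
  show ?thesis unfolding schwartz_def
  proof (intro CollectI allI conjI)
    fix "is" :: "'n list" and m x
    show "partial_derivs is (\<lambda>x. \<Prod>i\<in>UNIV. f i (x $ i)) differentiable at x"
      unfolding pd differentiable_def using has_derivative_vec_prod[where D=D, OF D1] by blast
    have "\<exists>B. \<forall>x. norm ((1 + \<bar>x\<bar>) ^ m *\<^sub>R D i l x) \<le> B" for i l
      using D2[where m=m] by (force simp: bounded_iff)
    then obtain B where B: "\<And>i l x. norm ((1 + \<bar>x\<bar>) ^ m *\<^sub>R D i l x) \<le> B i l" by metis
    show "bounded (range (\<lambda>x. (1 + norm x) ^ m *\<^sub>R partial_derivs is (\<lambda>x. \<Prod>i\<in>UNIV. f i (x $ i)) x))"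
      unfolding pd bounded_iff
    proof (intro exI ballI, elim rangeE, hypsubst)
      fix x :: "real^'n"
      have "norm ((1 + norm x) ^ m *\<^sub>R (\<Prod>i\<in>UNIV. D i (count_list is i) (x $ i)))
        = (1 + norm x) ^ m * (\<Prod>i\<in>UNIV. norm (D i (count_list is i) (x $ i)))"
        by (simp add: prod_norm)
      also have "\<dots> \<le> (\<Prod>i\<in>UNIV. 1 + \<bar>x $ i\<bar>) ^ m * (\<Prod>i\<in>UNIV. norm (D i (count_list is i) (x $ i)))"
        by (intro mult_right_mono power_mono one_plus_norm_le_prod prod_nonneg) auto
      also have "\<dots> = (\<Prod>i\<in>UNIV. norm ((1 + \<bar>x $ i\<bar>) ^ m *\<^sub>R D i (count_list is i) (x $ i)))"
        by (simp add: prod.distrib prod_power_distrib)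
      also have "\<dots> \<le> (\<Prod>i\<in>UNIV. B i (count_list is i))"
        by (intro prod_mono conjI B norm_ge_zero)
      finally show "norm ((1 + norm x) ^ m *\<^sub>R (\<Prod>i\<in>UNIV. D i (count_list is i) (x $ i))) \<le> (\<Prod>i\<in>UNIV. B i (count_list is i))" .
    qed
  qed
qed

text \<open>A class of rapidly decreasing functions that contains a derivative of each of its members
consists of Schwartz functions.\<close>
lemma schwartz1_coinduct:
  assumes "f \<in> K"
    and deriv: "\<And>f. f \<in> K \<Longrightarrow> \<exists>g\<in>K. \<forall>x. (f has_vector_derivative g x) (at x)"
    and bdd: "\<And>f m. f \<in> K \<Longrightarrow> bounded (range (\<lambda>x. (1 + \<bar>x\<bar>) ^ m *\<^sub>R f x))"
  shows "f \<in> schwartz1"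
proof -
  have "\<exists>D. \<forall>l. (D l \<in> K \<and> (l = 0 \<longrightarrow> D l = f)) \<and> (\<forall>x. (D l has_vector_derivative D (Suc l) x) (at x))"
    using assms(1) deriv by (intro dependent_nat_choice) auto
  then show ?thesis unfolding schwartz1_def using bdd by blast
qed

definition logistic :: "real \<Rightarrow> real \<Rightarrow> real \<Rightarrow> real" where
  "logistic c d x = 1 / (1 + exp (c - d * x))"

lemma logistic_bounds: "0 < logistic c d x" "logistic c d x \<le> 1"
  by (auto simp: logistic_def add_pos_pos)

lemma has_real_derivative_logistic:
  "(logistic c d has_real_derivative d * (logistic c d x - logistic c d x ^ 2)) (at x)"
proof -
  define y where "y = 1 + exp (c - d * x)"
  have y: "y > 0" by (simp add: y_def add_pos_pos)
  have "(logistic c d has_real_derivative d * (y - 1) / y\<^sup>2) (at x)"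
    unfolding logistic_def[abs_def] using y
    by (auto intro!: derivative_eq_intros simp: y_def power2_eq_square)
  moreover have "d * (y - 1) / y\<^sup>2 = d * (1 / y - (1 / y) ^ 2)"
    using y by (simp add: power2_eq_square field_simps)
  ultimately show ?thesis by (simp only: logistic_def y_def)
qed

text \<open>The span of the functions polynomial times Gaussian times character times powers of two logistic
functions. As the derivative of \<open>logistic c d\<close> is a polynomial in \<open>logistic c d\<close>, it is closed under
differentiation. The characters yield wave packets, and the logistic functions smooth
approximations to the indicator of an interval.\<close>
inductive_set test_fns :: "real \<Rightarrow> real \<Rightarrow> real \<Rightarrow> real \<Rightarrow> real \<Rightarrow> (real \<Rightarrow> complex) set"
  for \<alpha> c d c' d' where
  atom: "(\<lambda>x. a * cis (\<beta> * x) * of_real (x ^ i * exp (- \<alpha> * x\<^sup>2) * logistic c d x ^ j * logistic c' d' x ^ l)) \<in> test_fns \<alpha> c d c' d'"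
| add: "f \<in> test_fns \<alpha> c d c' d' \<Longrightarrow> g \<in> test_fns \<alpha> c d c' d' \<Longrightarrow> (\<lambda>x. f x + g x) \<in> test_fns \<alpha> c d c' d'"

lemma power_le_exp_square:
  fixes \<alpha> :: real
  assumes "\<alpha> > 0"
  shows "\<exists>C. \<forall>x. (1 + \<bar>x\<bar>) ^ m \<le> C * exp (\<alpha> * x\<^sup>2)"
proof (cases "m = 0")
  case True
  then show ?thesis using assms by (intro exI[of _ 1]) simp
next
  case False
  define c where "c = 2 + m / \<alpha>"
  have "(1 + \<bar>x\<bar>) ^ m \<le> c ^ m * exp (\<alpha> * x\<^sup>2)" for x
  proof -
    have "0 \<le> (\<bar>x\<bar> - 1)\<^sup>2" by simp
    then have "1 + \<bar>x\<bar> \<le> 2 + x\<^sup>2" by (simp add: power2_diff)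
    also have "\<dots> \<le> c * (1 + \<alpha> * x\<^sup>2 / m)"
      using False assms by (simp add: c_def field_simps)
    finally have "(1 + \<bar>x\<bar>) ^ m \<le> (c * (1 + \<alpha> * x\<^sup>2 / m)) ^ m" by (intro power_mono) auto
    also have "\<dots> = c ^ m * (1 + \<alpha> * x\<^sup>2 / m) ^ m" by (simp add: power_mult_distrib)
    also have "\<dots> \<le> c ^ m * exp (\<alpha> * x\<^sup>2)"
    proof (intro mult_left_mono exp_ge_one_plus_x_over_n_power_n)
      have "0 \<le> \<alpha> * x\<^sup>2" using assms by simp
      then show "- real m \<le> \<alpha> * x\<^sup>2" by linarith
    qed (use assms False in \<open>auto simp: c_def\<close>)
    finally show ?thesis .
  qed
  then show ?thesis by blast
qed

text \<open>The product rule for a member of the span, with the result written as a combination of members;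
\<open>r0\<close> stands for the real factor itself and \<open>r1\<close> to \<open>r4\<close> for the factors with one exponent
changed.\<close>
lemma test_fn_derivative_algebra:
  fixes a :: complex
  shows "a * e * (i * r1 - 2 * \<alpha> * r2 + j * d * (r0 - r3) + l * d' * (r0 - r4)) + a * (b * e) * r0
    = a * b * e * r0 + (a * i * e * r1 + (- 2 * a * \<alpha> * e * r2
       + (a * j * d * e * r0 + (- a * j * d * e * r3 + (a * l * d' * e * r0 + - a * l * d' * e * r4)))))"
  by (simp add: algebra_simps)

lemma test_fns_schwartz1:
  assumes "f \<in> test_fns \<alpha> c d c' d'" "\<alpha> > 0"
  shows "f \<in> schwartz1"
proof (rule schwartz1_coinduct[OF assms(1)])
  let ?K = "test_fns \<alpha> c d c' d'"
  define r where "r i j l x = x ^ i * exp (- \<alpha> * x\<^sup>2) * logistic c d x ^ j * logistic c' d' x ^ l" for i j l x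
  define h where "h a \<beta> i j l = (\<lambda>x. a * cis (\<beta> * x) * of_real (r i j l x))" for a \<beta> i j l
  have h: "h a \<beta> i j l \<in> ?K" for a \<beta> i j l
    unfolding h_def r_def by (rule atom)
  fix f assume "f \<in> ?K"
  then show "\<exists>g\<in>?K. \<forall>x. (f has_vector_derivative g x) (at x)"
  proof induction
    case (atom a \<beta> i j l)
    define g where "g = (\<lambda>x. h (a * \<i> * \<beta>) \<beta> i j l x + (h (a * i) \<beta> (i - 1) j l x + (h (- 2 * a * \<alpha>) \<beta> (i + 1) j l x
       + (h (a * j * d) \<beta> i j l x + (h (- a * j * d) \<beta> i (j + 1) l x + (h (a * l * d') \<beta> i j l x + h (- a * l * d') \<beta> i j (l + 1) x))))))"
    have "g \<in> ?K" unfolding g_def by (intro test_fns.add h)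
    moreover have "(h a \<beta> i j l has_vector_derivative g x) (at x)" for x
    proof -
      define r' where "r' = real i * r (i - 1) j l x - 2 * \<alpha> * r (i + 1) j l x
         + j * d * (r i j l x - r i (j + 1) l x) + l * d' * (r i j l x - r i j (l + 1) x)"
      have pd: "((\<lambda>x. logistic c d x ^ j) has_real_derivative real j * d * (logistic c d x ^ j - logistic c d x ^ (j + 1))) (at x)"
        for c d :: real and j :: nat
        using DERIV_power[OF has_real_derivative_logistic[of c d x], of j]
        by (cases j) (simp_all add: algebra_simps power2_eq_square)
      have "(r i j l has_real_derivative r') (at x)"
        unfolding r_def r'_def
      proof (rule DERIV_cong[OF DERIV_mult[OF DERIV_mult[OF DERIV_mult pd] pd]])
        show "((\<lambda>x. x ^ i) has_real_derivative real i * x ^ (i - 1)) (at x)"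
          by (auto intro!: derivative_eq_intros)
        show "((\<lambda>x. exp (- \<alpha> * x\<^sup>2)) has_real_derivative - 2 * \<alpha> * x * exp (- \<alpha> * x\<^sup>2)) (at x)"
          by (auto intro!: derivative_eq_intros)
      qed (simp add: algebra_simps)
      then have d1: "((\<lambda>x. complex_of_real (r i j l x)) has_vector_derivative of_real r') (at x)"
        by (rule has_vector_derivative_of_real)
      have d2: "((\<lambda>x. a * cis (\<beta> * x)) has_vector_derivative a * (\<i> * \<beta> * cis (\<beta> * x))) (at x)"
        unfolding cis_conv_exp
        by (auto intro!: derivative_eq_intros has_vector_derivative_real_field simp: algebra_simps)
      have "(h a \<beta> i j l has_vector_derivative
          (a * cis (\<beta> * x)) * of_real r' + (a * (\<i> * \<beta> * cis (\<beta> * x))) * of_real (r i j l x)) (at x)"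
        unfolding h_def by (rule has_vector_derivative_mult[OF d2 d1])
      also have "(a * cis (\<beta> * x)) * of_real r' + (a * (\<i> * \<beta> * cis (\<beta> * x))) * of_real (r i j l x) = g x"
        using test_fn_derivative_algebra[of a "cis (\<beta> * x)" "of_nat i" "of_real (r (i - 1) j l x)" "of_real \<alpha>"
            "of_real (r (i + 1) j l x)" "of_nat j" "of_real d" "of_real (r i j l x)" "of_real (r i (j + 1) l x)"
            "of_nat l" "of_real d'" "of_real (r i j (l + 1) x)" "\<i> * \<beta>"]
        unfolding g_def h_def r'_def of_real_add of_real_diff of_real_mult of_real_minus of_real_of_nat_eq of_real_numeral
        by (simp only: mult.assoc)
      finally show ?thesis .
    qed
    ultimately show ?case unfolding h_def r_def by blast
  next
    case (add f g)
    then obtain f' g' where "f' \<in> ?K" "g' \<in> ?K" "\<And>x. (f has_vector_derivative f' x) (at x)"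
      "\<And>x. (g has_vector_derivative g' x) (at x)" by blast
    then show ?case
      by (intro bexI[of _ "\<lambda>x. f' x + g' x"] allI has_vector_derivative_add test_fns.add)
  qed
next
  fix f m assume "f \<in> test_fns \<alpha> c d c' d'"
  then show "bounded (range (\<lambda>x. (1 + \<bar>x\<bar>) ^ m *\<^sub>R f x))"
  proof induction
    case (atom a \<beta> i j l)
    obtain C where C: "\<And>x. (1 + \<bar>x\<bar>) ^ (m + i) \<le> C * exp (\<alpha> * x\<^sup>2)"
      using power_le_exp_square[OF assms(2)] by blast
    show ?case unfolding bounded_iff
    proof (intro exI ballI, elim rangeE, hypsubst)
      fix x
      have "norm ((1 + \<bar>x\<bar>) ^ m *\<^sub>R (a * cis (\<beta> * x) * of_real (x ^ i * exp (- \<alpha> * x\<^sup>2) * logistic c d x ^ j * logistic c' d' x ^ l)))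
        = norm a * ((1 + \<bar>x\<bar>) ^ m * \<bar>x\<bar> ^ i * exp (- \<alpha> * x\<^sup>2) * (logistic c d x ^ j * logistic c' d' x ^ l))"
        using logistic_bounds[of c d x] logistic_bounds[of c' d' x]
        by (simp add: norm_mult norm_power abs_mult)
      also have "\<dots> \<le> norm a * ((1 + \<bar>x\<bar>) ^ m * (1 + \<bar>x\<bar>) ^ i * exp (- \<alpha> * x\<^sup>2) * (1 * 1))"
        using logistic_bounds[of c d x] logistic_bounds[of c' d' x]
        by (intro mult_left_mono mult_mono power_mono mult_right_mono power_le_one) auto
      also have "\<dots> \<le> norm a * (C * exp (\<alpha> * x\<^sup>2) * exp (- \<alpha> * x\<^sup>2))"
        using C[of x] by (intro mult_left_mono) (auto simp: power_add)
      also have "\<dots> = norm a * C" by (simp add: mult.assoc flip: exp_add)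
      finally show "norm ((1 + \<bar>x\<bar>) ^ m *\<^sub>R (a * cis (\<beta> * x) * of_real (x ^ i * exp (- \<alpha> * x\<^sup>2) * logistic c d x ^ j * logistic c' d' x ^ l))) \<le> norm a * C" .
    qed
  next
    case (add f g)
    then show ?case by (simp add: scaleR_add_right bounded_plus_comp)
  qed
qed

section \<open>Schwartz functions separate locally integrable functions\<close>

lemma schwartz_bound:
  assumes "\<phi> \<in> schwartz"
  obtains B where "\<And>x. (1 + norm x) ^ m * norm (\<phi> x) \<le> B"
proof -
  have "bounded (range (\<lambda>x. (1 + norm x) ^ m *\<^sub>R partial_derivs [] \<phi> x))"
    using assms unfolding schwartz_def by blast
  then show ?thesis using that by (auto simp: bounded_iff partial_derivs_def)
qed

lemma schwartz_measurable:
  assumes "\<phi> \<in> schwartz"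
  shows "\<phi> \<in> borel_measurable borel"
proof -
  have "\<forall>x. partial_derivs [] \<phi> differentiable at x" using assms unfolding schwartz_def by blast
  then have "continuous_on UNIV \<phi>"
    by (simp add: partial_derivs_def continuous_on_eq_continuous_at differentiable_imp_continuous_within)
  then show ?thesis by (rule borel_measurable_continuous_onI)
qed

lemma integrable_inverse_one_plus_square: "integrable lborel (\<lambda>x::real. inverse (1 + x\<^sup>2))"
  using integrable_inverse_1_plus_square by (simp add: set_integrable_def einterval_eq)

lemma schwartz_integrable:
  fixes \<phi> :: "real^'n::finite \<Rightarrow> complex"
  assumes "\<phi> \<in> schwartz"
  shows "integrable lborel \<phi>"
proof -
  obtain B where B: "\<And>x. (1 + norm x) ^ (2 * CARD('n)) * norm (\<phi> x) \<le> B"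
    using schwartz_bound[OF assms] by blast
  have "integrable lborel (\<lambda>x::real^'n. B * (\<Prod>i\<in>UNIV. inverse (1 + (x $ i)\<^sup>2)))"
    by (intro integrable_mult_right integrable_vec_prod[where f="\<lambda>_ x. inverse (1 + x\<^sup>2)"] integrable_inverse_one_plus_square)
  then show ?thesis
  proof (rule Bochner_Integration.integrable_bound)
    show "\<phi> \<in> borel_measurable lborel" using schwartz_measurable[OF assms] by simp
    show "AE x in lborel. norm (\<phi> x) \<le> norm (B * (\<Prod>i\<in>UNIV. inverse (1 + (x $ i)\<^sup>2)))"
    proof (rule AE_I2)
      fix x :: "real^'n"
      have "(\<Prod>i\<in>UNIV. 1 + (x $ i)\<^sup>2) \<le> (\<Prod>i\<in>(UNIV::'n set). (1 + norm x)\<^sup>2)"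
      proof (intro prod_mono conjI)
        fix i
        have "(x $ i)\<^sup>2 \<le> (norm x)\<^sup>2"
          by (metis component_le_norm_cart power_mono abs_ge_zero power2_abs)
        then show "1 + (x $ i)\<^sup>2 \<le> (1 + norm x)\<^sup>2" by (simp add: power2_sum add_increasing2)
      qed (simp add: add_nonneg_nonneg)
      also have "\<dots> = (1 + norm x) ^ (2 * CARD('n))" by (simp add: power_mult)
      finally have "norm (\<phi> x) * (\<Prod>i\<in>UNIV. 1 + (x $ i)\<^sup>2) \<le> B"
        using B[of x] by (smt (verit, ccfv_SIG) mult.commute mult_right_mono norm_ge_zero)
      moreover have "(\<Prod>i\<in>UNIV. 1 + (x $ i)\<^sup>2) > 0" by (intro prod_pos) (simp add: add_pos_nonneg)
      ultimately have "norm (\<phi> x) \<le> B * inverse (\<Prod>i\<in>UNIV. 1 + (x $ i)\<^sup>2)"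
        by (simp add: field_simps)
      then show "norm (\<phi> x) \<le> norm (B * (\<Prod>i\<in>UNIV. inverse (1 + (x $ i)\<^sup>2)))"
        using abs_ge_self order_trans by (fastforce simp: prod_inversef[symmetric] o_def)
    qed
  qed
qed

lemma integrable_bounded_mult_schwartz:
  fixes g \<phi> :: "real^'n::finite \<Rightarrow> complex"
  assumes [measurable]: "g \<in> borel_measurable borel" and "\<And>x. norm (g x) \<le> B" "\<phi> \<in> schwartz"
  shows "integrable lborel (\<lambda>x. g x * \<phi> x)"
proof (rule Bochner_Integration.integrable_bound[OF integrable_mult_right[OF schwartz_integrable[OF assms(3)], of B]])
  have [measurable]: "\<phi> \<in> borel_measurable borel" by (rule schwartz_measurable[OF assms(3)])
  show "(\<lambda>x. g x * \<phi> x) \<in> borel_measurable lborel" by measurable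
  have "B \<ge> 0" using assms(2) norm_ge_zero order_trans by blast
  then show "AE x in lborel. norm (g x * \<phi> x) \<le> norm (complex_of_real B * \<phi> x)"
    using assms(2) by (intro AE_I2) (auto simp: norm_mult intro: mult_right_mono)
qed

text \<open>The sets over which the integral vanishes form a Dynkin system, and the boxes generate the Borel
sets. The vanishing of the whole integral is the case of a complement.\<close>
lemma AE_zero_of_box_integrals:
  fixes g :: "real^'n::finite \<Rightarrow> real"
  assumes g: "integrable lborel g" and "(LINT x|lborel. g x) = 0"
    and box: "\<And>a b. (LINT x:box a b|lborel. g x) = 0"
  shows "AE x in lborel. g x = 0"
proof -
  have si: "set_integrable lborel A g" if "A \<in> sets borel" for A
    using integrable_mult_indicator[OF _ g, of A] that by (simp add: set_integrable_def)
  have "(LINT x:A|lborel. g x) = 0" if A: "A \<in> sets borel" for A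
  proof -
    let ?G = "range (\<lambda>(a, b). box a b :: (real^'n) set)"
    have "Int_stable ?G"
      by (auto simp: Int_stable_def box_Int_box)
    moreover have "?G \<subseteq> Pow UNIV" by simp
    moreover have sb: "sets borel = sigma_sets UNIV ?G" by (simp add: borel_eq_box)
    then have "A \<in> sigma_sets UNIV ?G" using A by simp
    ultimately show ?thesis
    proof (induction rule: sigma_sets_induct_disjoint)
      case (basic A) then show ?case using box by auto
    next
      case empty then show ?case by (simp add: set_lebesgue_integral_def)
    next
      case (compl A)
      then have A: "A \<in> sets borel" using sb by simp
      have "(LINT x:A \<union> (UNIV - A)|lborel. g x) = (LINT x:A|lborel. g x) + (LINT x:UNIV - A|lborel. g x)"
        using A by (intro set_integral_Un si) auto
      then show ?case using compl assms(2) by (simp add: set_lebesgue_integral_def)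
    next
      case (union A)
      then have A: "A i \<in> sets borel" for i using sb by auto
      have "(LINT x:(\<Union>i. A i)|lborel. g x) = (\<Sum>i. (LINT x:A i|lborel. g x))"
        using A union(1) by (intro lebesgue_integral_countable_add si) (auto simp: disjoint_family_on_def)
      then show ?case using union by simp
    qed
  qed
  then show ?thesis
    using density_unique_real[OF g, of "\<lambda>_. 0"] by (simp add: set_lebesgue_integral_def)
qed

text \<open>The shift \<open>m\<close> against the slope \<open>m ^ 2\<close> makes the limit vanish at \<open>y = 0\<close> too, so the limit is the
indicator of an open half line at every point.\<close>
lemma logistic_tendsto_indicator:
  "(\<lambda>m. logistic (real m) (real m ^ 2) y) \<longlonglongrightarrow> (if y > 0 then 1 else 0)"
proof (cases "y > 0")
  case True
  then have "(\<lambda>m. 1 / (1 + exp (real m - real m ^ 2 * y))) \<longlonglongrightarrow> 1" by real_asymp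
  then show ?thesis using True by (simp add: logistic_def)
next
  case False
  have "(\<lambda>m. 1 / (1 + exp (real m))) \<longlonglongrightarrow> 0" by real_asymp
  then have "(\<lambda>m. logistic (real m) (real m ^ 2) y) \<longlonglongrightarrow> 0"
  proof (rule tendsto_sandwich[rotated 3])
    show "\<forall>\<^sub>F m in sequentially. 0 \<le> logistic (real m) (real m ^ 2) y"
      using logistic_bounds(1) by (simp add: less_imp_le)
    have "logistic (real m) (real m ^ 2) y \<le> 1 / (1 + exp (real m))" for m
    proof -
      have "real m ^ 2 * y \<le> 0" using False by (simp add: mult_nonneg_nonpos)
      then show ?thesis unfolding logistic_def by (intro divide_left_mono) (auto simp: add_pos_pos)
    qed
    then show "\<forall>\<^sub>F m in sequentially. logistic (real m) (real m ^ 2) y \<le> 1 / (1 + exp (real m))" by simp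
  qed simp
  then show ?thesis using False by simp
qed

text \<open>Testing against a Gaussian times a product of logistic functions and letting these converge to
the indicator of a box shows that \<open>h\<close> times the Gaussian has integral zero over every box.\<close>
lemma schwartz_separates:
  fixes h :: "real^'n::finite \<Rightarrow> complex"
  assumes [measurable]: "h \<in> borel_measurable borel"
    and int: "\<And>\<phi>. \<phi> \<in> schwartz \<Longrightarrow> integrable lborel (\<lambda>x. h x * \<phi> x)"
    and zero: "\<And>\<phi>. \<phi> \<in> schwartz \<Longrightarrow> (LINT x|lborel. h x * \<phi> x) = 0"
  shows "AE x in lborel. h x = 0"
proof -
  define w where "w x = (\<Prod>i\<in>UNIV. exp (- ((x::real^'n) $ i)\<^sup>2))" for x
  define cut where "cut m a b x = (\<Prod>i\<in>UNIV. logistic (real m) (real m ^ 2) ((x::real^'n) $ i - (a::real^'n) $ i)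
      * logistic (real m) (real m ^ 2) ((b::real^'n) $ i - x $ i))" for m a b x
  define H where "H x = h x * of_real (w x)" for x
  have [measurable]: "w \<in> borel_measurable borel" unfolding w_def[abs_def] by measurable
  have lm [measurable]: "logistic c d \<in> borel_measurable borel" for c d
    unfolding logistic_def[abs_def] by measurable
  have cm [measurable]: "cut m a b \<in> borel_measurable borel" for m a b
    unfolding cut_def[abs_def] by measurable
  have [measurable]: "H \<in> borel_measurable borel" unfolding H_def[abs_def] by measurable
  have "(\<lambda>x. of_real (w x)) \<in> schwartz"
  proof -
    have "(\<lambda>x. 1 * cis (0 * x) * of_real (x ^ 0 * exp (- 1 * x\<^sup>2) * logistic 0 0 x ^ 0 * logistic 0 0 x ^ 0)) \<in> schwartz1"
      by (rule test_fns_schwartz1[OF test_fns.atom]) simp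
    then have "(\<lambda>x::real^'n. \<Prod>i\<in>UNIV. of_real (exp (- (x $ i)\<^sup>2))) \<in> schwartz"
      using schwartz_vec_prod[of "\<lambda>_ x. of_real (exp (- x\<^sup>2))"] by simp
    then show ?thesis by (simp add: w_def)
  qed
  from int[OF this] zero[OF this] have Hint: "integrable lborel H" and H0: "(LINT x|lborel. H x) = 0"
    by (simp_all add: H_def[abs_def])
  have cutS: "(\<lambda>x. of_real (w x * cut m a b x)) \<in> schwartz" for m a b
  proof -
    define g where "g i x = complex_of_real (exp (- x\<^sup>2)
        * (logistic (real m) (real m ^ 2) (x - a $ i) * logistic (real m) (real m ^ 2) (b $ i - x)))" for i x
    have "g i \<in> schwartz1" for i
    proof -
      have "g i = (\<lambda>x. 1 * cis (0 * x) * of_real (x ^ 0 * exp (- 1 * x\<^sup>2)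
        * logistic (real m + real m ^ 2 * a $ i) (real m ^ 2) x ^ 1 * logistic (real m - real m ^ 2 * b $ i) (- (real m ^ 2)) x ^ 1))"
        by (rule ext) (simp add: g_def logistic_def algebra_simps)
      then show ?thesis by (simp only: test_fns_schwartz1[OF test_fns.atom] zero_less_one)
    qed
    then have "(\<lambda>x. \<Prod>i\<in>UNIV. g i (x $ i)) \<in> schwartz" by (rule schwartz_vec_prod)
    then have "(\<lambda>x::real^'n. \<Prod>i\<in>UNIV. of_real (exp (- (x $ i)\<^sup>2)
        * (logistic (real m) (real m ^ 2) (x $ i - a $ i) * logistic (real m) (real m ^ 2) (b $ i - x $ i)))) \<in> schwartz"
      unfolding g_def .
    then show ?thesis by (simp add: w_def cut_def prod.distrib)
  qed
  have boxH: "(LINT x|lborel. H x * indicator (box a b) x) = 0" for a b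
  proof -
    have "(\<lambda>m. LINT x|lborel. H x * of_real (cut m a b x)) \<longlonglongrightarrow> (LINT x|lborel. H x * indicator (box a b) x)"
    proof (rule integral_dominated_convergence[where w="\<lambda>x. norm (H x)"])
      show "AE x in lborel. (\<lambda>m. H x * of_real (cut m a b x)) \<longlonglongrightarrow> H x * indicator (box a b) x"
      proof (rule AE_I2)
        fix x
        have "(\<lambda>m. cut m a b x) \<longlonglongrightarrow> (\<Prod>i\<in>UNIV. (if x $ i - a $ i > 0 then 1 else 0) * (if b $ i - x $ i > 0 then 1 else 0))"
          unfolding cut_def by (intro tendsto_prod tendsto_mult logistic_tendsto_indicator)
        also have "(\<Prod>i\<in>UNIV. (if x $ i - a $ i > 0 then 1 else 0) * (if b $ i - x $ i > 0 then 1 else 0)) = (indicator (box a b) x :: real)"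
          by (auto simp: indicator_def mem_box_cart)
        finally have "(\<lambda>m. H x * of_real (cut m a b x)) \<longlonglongrightarrow> H x * of_real (indicator (box a b) x)"
          by (intro tendsto_intros)
        then show "(\<lambda>m. H x * of_real (cut m a b x)) \<longlonglongrightarrow> H x * indicator (box a b) x"
          by (cases "x \<in> box a b") simp_all
      qed
      show "AE x in lborel. norm (H x * of_real (cut m a b x)) \<le> norm (H x)" for m
      proof (rule AE_I2)
        fix x
        have "0 \<le> cut m a b x" "cut m a b x \<le> 1"
          unfolding cut_def using logistic_bounds less_imp_le
          by (auto intro!: prod_nonneg prod_le_1 mult_le_one simp: less_imp_le)
        then show "norm (H x * of_real (cut m a b x)) \<le> norm (H x)"
          by (simp add: norm_mult mult_left_le)
      qed
      show "integrable lborel (\<lambda>x. norm (H x))" using Hint by simp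
      show "(\<lambda>x. H x * indicator (box a b) x) \<in> borel_measurable lborel" by measurable
    qed measurable
    moreover have "(LINT x|lborel. H x * of_real (cut m a b x)) = 0" for m
      using zero[OF cutS[of m a b]] by (simp add: H_def mult.assoc)
    ultimately show ?thesis by (simp add: LIMSEQ_const_iff)
  qed
  have HB: "integrable lborel (\<lambda>x. H x * indicator (box a b) x)" for a b
  proof -
    have "(\<lambda>x. H x * indicator (box a b) x) = (\<lambda>x. indicator (box a b) x *\<^sub>R H x)"
      by (rule ext) (simp split: split_indicator)
    then show ?thesis using integrable_mult_indicator[OF _ Hint, of "box a b"] by simp
  qed
  have "AE x in lborel. Re (H x) = 0"
  proof (rule AE_zero_of_box_integrals)
    fix a b
    have "(LINT x:box a b|lborel. Re (H x)) = (LINT x|lborel. Re (H x * indicator (box a b) x))"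
      unfolding set_lebesgue_integral_def by (intro Bochner_Integration.integral_cong) (auto simp: indicator_def)
    then show "(LINT x:box a b|lborel. Re (H x)) = 0"
      unfolding integral_Re[OF HB] boxH by simp
  qed (use Hint H0 in \<open>simp_all add: integral_Re\<close>)
  moreover have "AE x in lborel. Im (H x) = 0"
  proof (rule AE_zero_of_box_integrals)
    fix a b
    have "(LINT x:box a b|lborel. Im (H x)) = (LINT x|lborel. Im (H x * indicator (box a b) x))"
      unfolding set_lebesgue_integral_def by (intro Bochner_Integration.integral_cong) (auto simp: indicator_def)
    then show "(LINT x:box a b|lborel. Im (H x)) = 0"
      unfolding integral_Im[OF HB] boxH by simp
  qed (use Hint H0 in \<open>simp_all add: integral_Im\<close>)
  ultimately show ?thesis
  proof eventually_elim
    case (elim x)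
    then have "H x = 0" by (simp add: complex_eq_iff)
    moreover have "w x \<noteq> 0" by (simp add: w_def)
    ultimately show ?case by (simp add: H_def)
  qed
qed

lemma given_by_function_AE_unique:
  assumes "given_by_function L g" "given_by_function L g'"
  shows "AE x in lborel. g x = g' x"
proof -
  have "AE x in lborel. g x - g' x = 0"
  proof (rule schwartz_separates)
    show "(\<lambda>x. g x - g' x) \<in> borel_measurable borel"
      using assms by (auto simp: given_by_function_def)
    fix \<phi> :: "real^'a \<Rightarrow> complex" assume "\<phi> \<in> schwartz"
    then have "integrable lborel (\<lambda>x. g x * \<phi> x)" "integrable lborel (\<lambda>x. g' x * \<phi> x)"
      "dist_of g \<phi> = dist_of g' \<phi>"
      using assms by (auto simp: given_by_function_def)
    then show "integrable lborel (\<lambda>x. (g x - g' x) * \<phi> x)" "(LINT x|lborel. (g x - g' x) * \<phi> x) = 0"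
      by (simp_all add: left_diff_distrib dist_of_def)
  qed
  then show ?thesis by simp
qed

section \<open>From distributions to Schwartz functions\<close>

lemma norm_exp_minus_i_of_real [simp]: "norm (exp (- (\<i> * complex_of_real r))) = 1"
  using norm_exp_i_times[of "- r"] by simp

lemma fourier_bounded: "norm (fourier f \<xi>) \<le> (LINT x|lborel. norm (f x))"
proof -
  have "norm (fourier f \<xi>) \<le> (LINT x|lborel. norm (f x * exp (- \<i> * of_real (x \<bullet> \<xi>))))"
    unfolding fourier_def by (rule integral_norm_bound)
  then show ?thesis by (simp add: norm_mult)
qed

lemma fourier_measurable:
  fixes f :: "real^'n::finite \<Rightarrow> complex"
  assumes [measurable]: "f \<in> borel_measurable borel"
  shows "fourier f \<in> borel_measurable borel"
proof -
  have "(\<lambda>\<xi>. LINT x|lborel. f x * exp (- \<i> * of_real (x \<bullet> \<xi>))) \<in> borel_measurable borel"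
    by (rule lborel.borel_measurable_lebesgue_integral) measurable
  then show ?thesis by (simp add: fourier_def[abs_def])
qed

lemma fourier_swap:
  fixes f g :: "real^'n::finite \<Rightarrow> complex"
  assumes f: "integrable lborel f" and g: "integrable lborel g"
  shows "(LINT x|lborel. f x * fourier g x) = (LINT \<xi>|lborel. fourier f \<xi> * g \<xi>)"
proof -
  have [measurable]: "f \<in> borel_measurable borel" "g \<in> borel_measurable borel"
    using borel_measurable_integrable[OF f] borel_measurable_integrable[OF g] by simp_all
  define F where "F x \<xi> = f x * (g \<xi> * exp (- \<i> * of_real (\<xi> \<bullet> x)))" for x \<xi>
  have m [measurable]: "case_prod F \<in> borel_measurable (lborel \<Otimes>\<^sub>M lborel)"
    unfolding F_def[abs_def] by measurable
  have "integrable (lborel \<Otimes>\<^sub>M lborel) (case_prod F)"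
  proof (rule lborel_pair.Fubini_integrable[OF m])
    have "(\<lambda>x. LINT y|lborel. norm (case_prod F (x, y))) = (\<lambda>x. norm (f x) * (LINT y|lborel. norm (g y)))"
      by (simp add: F_def norm_mult)
    then show "integrable lborel (\<lambda>x. LINT y|lborel. norm (case_prod F (x, y)))"
      using f by simp
    have "integrable lborel (\<lambda>y. f x * (g y * exp (- \<i> * of_real (y \<bullet> x))))" for x
      by (rule integrable_mult_right, rule Bochner_Integration.integrable_bound[OF g]) (auto simp: norm_mult)
    then show "AE x in lborel. integrable lborel (\<lambda>y. case_prod F (x, y))"
      by (simp add: F_def)
  qed
  from lborel_pair.Fubini_integral[OF this]
  have "(LINT x|lborel. LINT \<xi>|lborel. F x \<xi>) = (LINT \<xi>|lborel. LINT x|lborel. F x \<xi>)"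
    by simp
  moreover have "(LINT \<xi>|lborel. F x \<xi>) = f x * fourier g x" for x
    unfolding F_def fourier_def by simp
  moreover have "(LINT x|lborel. F x \<xi>) = fourier f \<xi> * g \<xi>" for \<xi>
  proof -
    have "(LINT x|lborel. F x \<xi>) = (LINT x|lborel. f x * exp (- \<i> * of_real (x \<bullet> \<xi>)) * g \<xi>)"
      unfolding F_def by (intro Bochner_Integration.integral_cong refl) (simp add: inner_commute mult_ac)
    then show ?thesis unfolding fourier_def by simp
  qed
  ultimately show ?thesis by simp
qed

lemma given_by_function_fourier:
  fixes f :: "real^'n::finite \<Rightarrow> complex"
  assumes "integrable lborel f"
  shows "given_by_function (dist_fourier (dist_of f)) (fourier f)"
proof -
  have "f \<in> borel_measurable borel"
    using borel_measurable_integrable[OF assms] by simp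
  note fm = fourier_measurable[OF this]
  show ?thesis
    unfolding given_by_function_def dist_fourier_def dist_of_def
    using fm integrable_bounded_mult_schwartz[OF fm fourier_bounded]
      fourier_swap[OF assms schwartz_integrable] by auto
qed

lemma fourier_function_AE:
  assumes "given_by_function (dist_fourier L) g"
  shows "given_by_function (dist_fourier L) (fourier_function L)"
    and "AE \<xi> in lborel. fourier_function L \<xi> = g \<xi>"
proof -
  show 1: "given_by_function (dist_fourier L) (fourier_function L)"
    unfolding fourier_function_def using assms by (rule someI[of "given_by_function (dist_fourier L)"])
  show "AE \<xi> in lborel. fourier_function L \<xi> = g \<xi>"
    by (rule given_by_function_AE_unique[OF 1 assms])
qed

lemma sobolev_norm_eq:
  fixes L :: "'n::finite distribution"
  assumes g: "given_by_function (dist_fourier L) g"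
  shows "sobolev_norm s L = sqrt (1 / (2 * pi) ^ CARD('n) *
     (LINT \<xi>|lborel. (1 + (norm \<xi>)\<^sup>2) powr s * (norm (g \<xi>))\<^sup>2))"
    and "integrable lborel (\<lambda>\<xi>. (1 + (norm \<xi>)\<^sup>2) powr s * (norm (fourier_function L \<xi>))\<^sup>2)
     \<longleftrightarrow> integrable lborel (\<lambda>\<xi>. (1 + (norm \<xi>)\<^sup>2) powr s * (norm (g \<xi>))\<^sup>2)"
proof -
  have [measurable]: "g \<in> borel_measurable borel" "fourier_function L \<in> borel_measurable borel"
    using g fourier_function_AE(1)[OF g] by (auto simp: given_by_function_def)
  have ae: "AE \<xi> in lborel. (1 + (norm \<xi>)\<^sup>2) powr s * (norm (fourier_function L \<xi>))\<^sup>2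
      = (1 + (norm \<xi>)\<^sup>2) powr s * (norm (g \<xi>))\<^sup>2"
    using fourier_function_AE(2)[OF g] by eventually_elim simp
  show "sobolev_norm s L = sqrt (1 / (2 * pi) ^ CARD('n) *
     (LINT \<xi>|lborel. (1 + (norm \<xi>)\<^sup>2) powr s * (norm (g \<xi>))\<^sup>2))"
    unfolding sobolev_norm_def by (subst integral_cong_AE[OF _ _ ae]) simp_all
  show "integrable lborel (\<lambda>\<xi>. (1 + (norm \<xi>)\<^sup>2) powr s * (norm (fourier_function L \<xi>))\<^sup>2)
     \<longleftrightarrow> integrable lborel (\<lambda>\<xi>. (1 + (norm \<xi>)\<^sup>2) powr s * (norm (g \<xi>))\<^sup>2)"
    by (rule integrable_cong_AE[OF _ _ ae]) simp_all
qed

text \<open>One seminorm suffices, the supremum norm, because \<open>f\<close> is integrable.\<close>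
lemma tempered_dist_of:
  fixes f :: "real^'n::finite \<Rightarrow> complex"
  assumes f: "f \<in> schwartz"
  shows "tempered_distribution (dist_of f)"
  unfolding tempered_distribution_def
proof (intro conjI ballI allI exI)
  obtain B where "\<And>x. norm (f x) \<le> B" using schwartz_bound[OF f, of 0] by auto
  then have int: "integrable lborel (\<lambda>x. f x * \<phi> x)" if "\<phi> \<in> schwartz" for \<phi>
    using integrable_bounded_mult_schwartz[OF schwartz_measurable[OF f] _ that] by blast
  fix \<phi> \<psi> :: "real^'n \<Rightarrow> complex" assume \<phi>: "\<phi> \<in> schwartz"
  show "dist_of f (\<lambda>x. \<phi> x + \<psi> x) = dist_of f \<phi> + dist_of f \<psi>" if "\<psi> \<in> schwartz"
    using int[OF \<phi>] int[OF that] by (simp add: dist_of_def distrib_left)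
  show "dist_of f (\<lambda>x. c * \<phi> x) = c * dist_of f \<phi>" for c
    by (simp add: dist_of_def mult.left_commute)
  obtain B' where B': "\<And>x. norm (\<phi> x) \<le> B'" using schwartz_bound[OF \<phi>, of 0] by auto
  have sup: "norm (\<phi> x) \<le> (\<Sum>is | length is \<le> 0. schwartz_seminorm 0 is \<phi>)" for x
  proof -
    have "norm (\<phi> x) \<le> (SUP x. norm (\<phi> x))"
      using B' by (intro cSUP_upper bdd_aboveI2) auto
    then show ?thesis by (simp add: schwartz_seminorm_def partial_derivs_def)
  qed
  have fphi: "integrable lborel (\<lambda>x. norm (f x) * norm (\<phi> x))"
    using integrable_norm[OF int[OF \<phi>]] by (simp add: norm_mult)
  have "norm (dist_of f \<phi>) \<le> (LINT x|lborel. norm (f x * \<phi> x))"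
    unfolding dist_of_def by (rule integral_norm_bound)
  also have "\<dots> \<le> (LINT x|lborel. norm (f x) * (\<Sum>is | length is \<le> 0. schwartz_seminorm 0 is \<phi>))"
    using fphi schwartz_integrable[OF f] sup
    by (intro integral_mono) (auto simp: norm_mult intro!: mult_left_mono integrable_norm)
  finally show "norm (dist_of f \<phi>) \<le> (LINT x|lborel. norm (f x)) * (\<Sum>is | length is \<le> 0. schwartz_seminorm 0 is \<phi>)"
    by simp
qed

lemma
  fixes f :: "real^'n::finite \<Rightarrow> complex"
  assumes f: "integrable lborel (fourier f)" and [measurable]: "fourier f \<in> borel_measurable borel"
  shows T_schwartz_measurable: "T_schwartz k t f \<in> borel_measurable borel"
    and T_schwartz_bounded: "norm (T_schwartz k t f x) \<le> (LINT \<xi>|lborel. norm (fourier f \<xi>))"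
proof -
  have [measurable]: "power_symbol k \<in> borel_measurable (borel :: (real^'n) measure)"
    unfolding power_symbol_def[abs_def] by measurable
  have "(\<lambda>x. LINT \<xi>|lborel. fourier f \<xi> * exp (\<i> * of_real (\<xi> \<bullet> x + power_symbol k \<xi> * t))) \<in> borel_measurable borel"
    by (rule lborel.borel_measurable_lebesgue_integral) measurable
  then show "T_schwartz k t f \<in> borel_measurable borel"
    unfolding T_schwartz_def[abs_def] by measurable
  have "norm (LINT \<xi>|lborel. fourier f \<xi> * exp (\<i> * of_real (\<xi> \<bullet> x + power_symbol k \<xi> * t)))
      \<le> (LINT \<xi>|lborel. norm (fourier f \<xi> * exp (\<i> * of_real (\<xi> \<bullet> x + power_symbol k \<xi> * t))))"
    by (rule integral_norm_bound)
  also have "\<dots> = (LINT \<xi>|lborel. norm (fourier f \<xi>))" by (simp add: norm_mult)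
  finally have *: "norm (LINT \<xi>|lborel. fourier f \<xi> * exp (\<i> * of_real (\<xi> \<bullet> x + power_symbol k \<xi> * t))) \<le> (LINT \<xi>|lborel. norm (fourier f \<xi>))" .
  have "1 \<le> (2 * pi) ^ CARD('n)" using pi_gt3 by (intro one_le_power) simp
  then have "norm (T_schwartz k t f x) \<le> norm (LINT \<xi>|lborel. fourier f \<xi> * exp (\<i> * of_real (\<xi> \<bullet> x + power_symbol k \<xi> * t)))"
    unfolding T_schwartz_def norm_mult
    by (intro mult_left_le_one_le) (auto simp: norm_divide norm_power norm_mult)
  then show "norm (T_schwartz k t f x) \<le> (LINT \<xi>|lborel. norm (fourier f \<xi>))" using * by linarith
qed

text \<open>The form in which the maximal inequality is used. The Schwartz function \<open>f\<close> is approximated in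
the Sobolev norm by the constant sequence \<open>f\<close>, so at each time the function \<open>u t\<close> defines the same
distribution as the integral formula and agrees with it almost everywhere. For countably many
times the exceptional sets have a null union. The factor \<open>\<bar>C\<bar>\<close> covers a negative \<open>C\<close>, for which the
bound in the hypothesis is truncated to zero.\<close>
lemma schwartz_maximal_lower_bound:
  fixes f :: "real^'n::finite \<Rightarrow> complex"
  assumes hyp: "\<forall>f \<in> (sobolev_space s :: 'n distribution set).
           \<exists>u. is_T_of s k f u \<and>
               (\<integral>\<^sup>+x\<in>ball 0 1. (SUP t\<in>{0<..<1}. ennreal (norm (u t x))) \<partial>lborel)
                 \<le> ennreal (C * sobolev_norm s f)"
    and f: "f \<in> schwartz" and ff: "integrable lborel (fourier f)"
    and fs: "integrable lborel (\<lambda>\<xi>. (1 + (norm \<xi>)\<^sup>2) powr s * (norm (fourier f \<xi>))\<^sup>2)"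
    and Th: "countable \<Theta>" "\<Theta> \<subseteq> {0<..<1}"
    and \<Omega>: "\<Omega> \<in> sets borel" "\<Omega> \<subseteq> ball 0 1" "c \<ge> 0"
    and low: "\<And>x. x \<in> \<Omega> \<Longrightarrow> \<exists>t\<in>\<Theta>. c \<le> norm (T_schwartz k t f x)"
  shows "c * measure lborel \<Omega> \<le> \<bar>C\<bar> * sqrt (1 / (2 * pi) ^ CARD('n) *
     (LINT \<xi>|lborel. (1 + (norm \<xi>)\<^sup>2) powr s * (norm (fourier f \<xi>))\<^sup>2))"
proof -
  have fi: "integrable lborel f" by (rule schwartz_integrable[OF f])
  have fm: "fourier f \<in> borel_measurable borel" by (rule fourier_measurable[OF schwartz_measurable[OF f]])
  note gf = given_by_function_fourier[OF fi]
  have "dist_of f \<in> sobolev_space s"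
    using tempered_dist_of[OF f] fourier_function_AE(1)[OF gf] sobolev_norm_eq(2)[OF gf] fs
    by (simp add: sobolev_space_def)
  then obtain u where u: "is_T_of s k (dist_of f) u"
    and le: "(\<integral>\<^sup>+x\<in>ball 0 1. (SUP t\<in>{0<..<1}. ennreal (norm (u t x))) \<partial>lborel)
                 \<le> ennreal (C * sobolev_norm s (dist_of f))" using hyp by blast
  have "given_by_function (dist_fourier (\<lambda>\<phi>::real^'n \<Rightarrow> complex. 0)) (\<lambda>_. 0)"
    by (simp add: given_by_function_def dist_fourier_def dist_of_def)
  from sobolev_norm_eq(1)[OF this] have z: "sobolev_norm s (\<lambda>\<phi>::real^'n \<Rightarrow> complex. 0) = 0" by simp
  have "AE x in lborel. u t x = T_schwartz k t f x" if "t \<in> \<Theta>" for t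
  proof -
    have t: "t \<in> {0<..<1}" using that Th by auto
    have um: "u t \<in> borel_measurable borel" and ui: "\<And>\<phi>. \<phi> \<in> schwartz \<Longrightarrow> integrable lborel (\<lambda>x. u t x * \<phi> x)"
      using u t by (auto simp: is_T_of_def)
    have lim: "\<And>F \<phi>. (\<And>j::nat. F j \<in> schwartz) \<Longrightarrow>
             (\<lambda>j. sobolev_norm s (\<lambda>\<phi>. dist_of (F j) \<phi> - dist_of f \<phi>)) \<longlonglongrightarrow> 0 \<Longrightarrow> \<phi> \<in> schwartz \<Longrightarrow>
                (\<lambda>j. dist_of (T_schwartz k t (F j)) \<phi>) \<longlonglongrightarrow> dist_of (u t) \<phi>"
      using u t unfolding is_T_of_def by blast
    have eq: "dist_of (T_schwartz k t f) \<phi> = dist_of (u t) \<phi>" if "\<phi> \<in> schwartz" for \<phi>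
      using lim[of "\<lambda>_. f", OF f _ that] by (simp add: z LIMSEQ_const_iff)
    note Tm = T_schwartz_measurable[OF ff fm, of k t] and Tb = T_schwartz_bounded[OF ff fm, of k t]
    have "AE x in lborel. u t x - T_schwartz k t f x = 0"
    proof (rule schwartz_separates)
      show "(\<lambda>x. u t x - T_schwartz k t f x) \<in> borel_measurable borel" using um Tm by measurable
      fix \<phi> :: "real^'n \<Rightarrow> complex" assume \<phi>: "\<phi> \<in> schwartz"
      have "integrable lborel (\<lambda>x. T_schwartz k t f x * \<phi> x)"
        by (rule integrable_bounded_mult_schwartz[OF Tm Tb \<phi>])
      then show "integrable lborel (\<lambda>x. (u t x - T_schwartz k t f x) * \<phi> x)"
        "(LINT x|lborel. (u t x - T_schwartz k t f x) * \<phi> x) = 0"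
        using ui[OF \<phi>] eq[OF \<phi>] by (simp_all add: left_diff_distrib dist_of_def)
    qed
    then show ?thesis by simp
  qed
  then have ae: "AE x in lborel. \<forall>t\<in>\<Theta>. u t x = T_schwartz k t f x"
    using Th(1) by (simp add: AE_ball_countable)
  have "ennreal c * emeasure lborel \<Omega> = (\<integral>\<^sup>+x. ennreal c * indicator \<Omega> x \<partial>lborel)"
    using \<Omega>(1) by (subst nn_integral_cmult_indicator) auto
  also have "\<dots> \<le> (\<integral>\<^sup>+x\<in>ball 0 1. (SUP t\<in>{0<..<1}. ennreal (norm (u t x))) \<partial>lborel)"
  proof (rule nn_integral_mono_AE, use ae in eventually_elim)
    fix x assume x: "\<forall>t\<in>\<Theta>. u t x = T_schwartz k t f x"
    show "ennreal c * indicator \<Omega> x \<le> (SUP t\<in>{0<..<1}. ennreal (norm (u t x))) * indicator (ball 0 1) x"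
    proof (cases "x \<in> \<Omega>")
      case True
      then obtain t where t: "t \<in> \<Theta>" "c \<le> norm (T_schwartz k t f x)" using low by blast
      then have "ennreal c \<le> ennreal (norm (u t x))" using x by (simp add: ennreal_leI)
      also have "\<dots> \<le> (SUP t\<in>{0<..<1}. ennreal (norm (u t x)))"
        using t Th by (intro SUP_upper) auto
      finally show ?thesis using True \<Omega>(2) by (auto simp: indicator_def)
    qed simp
  qed
  also note le
  finally have "ennreal c * emeasure lborel \<Omega> \<le> ennreal (C * sobolev_norm s (dist_of f))" .
  moreover have "emeasure lborel \<Omega> = ennreal (measure lborel \<Omega>)"
  proof (rule emeasure_eq_ennreal_measure)
    have "emeasure lborel \<Omega> \<le> emeasure lborel (ball (0::real^'n) 1)" using \<Omega> by (intro emeasure_mono) auto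
    also have "\<dots> < \<infinity>" by (rule emeasure_lborel_ball_finite)
    finally show "emeasure lborel \<Omega> \<noteq> top" by simp
  qed
  ultimately have "ennreal (c * measure lborel \<Omega>) \<le> ennreal (C * sobolev_norm s (dist_of f))"
    using \<Omega>(3) by (simp add: ennreal_mult)
  moreover have "C * sobolev_norm s (dist_of f) \<le> \<bar>C\<bar> * sobolev_norm s (dist_of f)"
    unfolding sobolev_norm_def by (intro mult_right_mono) (auto intro!: integral_nonneg_AE)
  moreover have "0 \<le> \<bar>C\<bar> * sobolev_norm s (dist_of f)"
    unfolding sobolev_norm_def by (auto intro!: integral_nonneg_AE mult_nonneg_nonneg)
  ultimately have "c * measure lborel \<Omega> \<le> \<bar>C\<bar> * sobolev_norm s (dist_of f)"
    by (metis ennreal_le_iff ennreal_leI order_trans)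
  then show ?thesis by (simp only: sobolev_norm_eq(1)[OF gf])
qed

section \<open>Gaussian wave packets\<close>

text \<open>The transform and the evolution operator in one variable, into which those in \<open>n\<close> variables
factor on products over the coordinates.\<close>
definition fourier1 :: "(real \<Rightarrow> complex) \<Rightarrow> real \<Rightarrow> complex" where
  "fourier1 g \<xi> = (LINT x|lborel. g x * cis (- (x * \<xi>)))"

definition evolution1 :: "nat \<Rightarrow> real \<Rightarrow> (real \<Rightarrow> complex) \<Rightarrow> real \<Rightarrow> complex" where
  "evolution1 k t g x = 1 / (2 * pi) * (LINT \<xi>|lborel. fourier1 g \<xi> * cis (\<xi> * x + \<xi> ^ k * t))"

lemma cis_sum: "cis (\<Sum>i\<in>A. f i) = (\<Prod>i\<in>A. cis (f i))"
  by (induction A rule: infinite_finite_induct) (auto simp: cis_mult[symmetric])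

lemma fourier_vec_prod:
  fixes f :: "'n::finite \<Rightarrow> real \<Rightarrow> complex"
  assumes f: "\<And>i. integrable lborel (f i)"
  shows "fourier (\<lambda>x. \<Prod>i\<in>UNIV. f i (x $ i)) \<xi> = (\<Prod>i\<in>UNIV. fourier1 (f i) (\<xi> $ i))"
proof -
  have "fourier (\<lambda>x. \<Prod>i\<in>UNIV. f i (x $ i)) \<xi>
     = (LINT x|lborel. (\<Prod>i\<in>UNIV. f i (x $ i) * cis (- (x $ i * \<xi> $ i))))"
    unfolding fourier_def
  proof (intro Bochner_Integration.integral_cong refl)
    fix x :: "real^'n"
    have "exp (- \<i> * of_real (x \<bullet> \<xi>)) = cis (\<Sum>i\<in>UNIV. - (x $ i * \<xi> $ i))"
      by (simp add: cis_conv_exp inner_vec_def sum_negf)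
    then show "(\<Prod>i\<in>UNIV. f i (x $ i)) * exp (- \<i> * of_real (x \<bullet> \<xi>)) = (\<Prod>i\<in>UNIV. f i (x $ i) * cis (- (x $ i * \<xi> $ i)))"
      by (simp add: cis_sum prod.distrib)
  qed
  also have "\<dots> = (\<Prod>i\<in>UNIV. fourier1 (f i) (\<xi> $ i))"
    unfolding fourier1_def
    by (rule integral_vec_prod[where f="\<lambda>i y. f i y * cis (- (y * \<xi> $ i))"],
        rule Bochner_Integration.integrable_bound[OF f])
      (use borel_measurable_integrable[OF f] in \<open>auto simp: norm_mult cis_conv_exp\<close>)
  finally show ?thesis .
qed

lemma T_schwartz_vec_prod:
  fixes f :: "'n::finite \<Rightarrow> real \<Rightarrow> complex"
  assumes f: "\<And>i. integrable lborel (f i)" and ff: "\<And>i. integrable lborel (fourier1 (f i))"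
  shows "T_schwartz k t (\<lambda>x. \<Prod>i\<in>UNIV. f i (x $ i)) x = (\<Prod>i\<in>UNIV. evolution1 k t (f i) (x $ i))"
proof -
  have "(LINT \<xi>|lborel. fourier (\<lambda>x. \<Prod>i\<in>UNIV. f i (x $ i)) \<xi> * exp (\<i> * of_real (\<xi> \<bullet> x + power_symbol k \<xi> * t)))
     = (LINT \<xi>|lborel. (\<Prod>i\<in>UNIV. fourier1 (f i) (\<xi> $ i) * cis (\<xi> $ i * x $ i + (\<xi> $ i) ^ k * t)))"
  proof (intro Bochner_Integration.integral_cong refl)
    fix \<xi> :: "real^'n"
    have "exp (\<i> * of_real (\<xi> \<bullet> x + power_symbol k \<xi> * t)) = cis (\<Sum>i\<in>UNIV. \<xi> $ i * x $ i + (\<xi> $ i) ^ k * t)"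
      by (simp add: cis_conv_exp inner_vec_def sum.distrib power_symbol_def sum_distrib_right)
    then show "fourier (\<lambda>x. \<Prod>i\<in>UNIV. f i (x $ i)) \<xi> * exp (\<i> * of_real (\<xi> \<bullet> x + power_symbol k \<xi> * t))
      = (\<Prod>i\<in>UNIV. fourier1 (f i) (\<xi> $ i) * cis (\<xi> $ i * x $ i + (\<xi> $ i) ^ k * t))"
      by (simp add: fourier_vec_prod[OF f] cis_sum prod.distrib)
  qed
  also have "\<dots> = (\<Prod>i\<in>UNIV. LINT y|lborel. fourier1 (f i) y * cis (y * x $ i + y ^ k * t))"
    by (rule integral_vec_prod[where f="\<lambda>i y. fourier1 (f i) y * cis (y * x $ i + y ^ k * t)"],
        rule Bochner_Integration.integrable_bound[OF ff])
      (use borel_measurable_integrable[OF ff] in \<open>auto simp: norm_mult cis_conv_exp\<close>)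
  finally show ?thesis
    by (simp add: T_schwartz_def evolution1_def prod.distrib prod_dividef power_divide)
qed

definition packet :: "real \<Rightarrow> real \<Rightarrow> real \<Rightarrow> complex" where
  "packet S \<omega> x = cis (\<omega> * x) * of_real (exp (- (S * x)\<^sup>2 / 2))"

lemma borel_measurable_cis [measurable (raw)]:
  "f \<in> borel_measurable M \<Longrightarrow> (\<lambda>x. cis (f x)) \<in> borel_measurable M"
  unfolding cis_conv_exp by measurable

text \<open>The Fourier transform of a Gaussian packet is a Gaussian, so after rescaling the frequency the
evolution of a packet is an average over a standard normal frequency \<open>\<eta>\<close>.\<close>
abbreviation gauss :: "real measure" where "gauss \<equiv> std_normal_distribution"

interpretation gauss: prob_space gauss
  by (rule prob_space_normal_density) simp

lemma measure_gauss_UNIV [simp]: "measure gauss UNIV = 1"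
  using gauss.prob_space by simp

lemma integral_gauss:
  fixes f :: "real \<Rightarrow> 'a::{banach,second_countable_topology}"
  assumes "f \<in> borel_measurable borel"
  shows "(LINT x|gauss. f x) = (LINT x|lborel. std_normal_density x *\<^sub>R f x)"
    and "integrable gauss f \<longleftrightarrow> integrable lborel (\<lambda>x. std_normal_density x *\<^sub>R f x)"
  using assms by (simp_all add: integral_density integrable_density normal_density_nonneg)

lemma integrable_gauss_bounded:
  fixes f :: "real \<Rightarrow> complex"
  assumes "f \<in> borel_measurable borel" "\<And>x. norm (f x) \<le> B"
  shows "integrable gauss f"
  using assms by (intro gauss.integrable_const_bound[of _ B]) auto

lemma integral_gauss_cis: "(LINT \<eta>|gauss. cis (\<eta> * y)) = of_real (exp (- y\<^sup>2 / 2))"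
  using fun_cong[OF char_std_normal_distribution, of y] by (simp add: char_def cis_conv_exp mult_ac)

lemma exp_eq_std_normal_density: "exp (- x\<^sup>2 / 2) = sqrt (2 * pi) * std_normal_density x"
  by (simp add: std_normal_density_def)

lemma integrable_gauss_power: "integrable gauss (\<lambda>\<eta>. (1 + \<bar>\<eta>\<bar>) ^ k)"
proof -
  have "integrable gauss (\<lambda>\<eta>. \<Sum>i\<le>k. of_nat (k choose i) * \<bar>\<eta>\<bar> ^ i * 1 ^ (k - i))"
    by (intro Bochner_Integration.integrable_sum integrable_mult_left integrable_mult_right)
      (simp add: integral_gauss integrable_std_normal_moment_abs)
  then show ?thesis by (subst add.commute) (simp add: binomial_ring)
qed

definition gauss_moment :: "nat \<Rightarrow> real" where
  "gauss_moment k = (LINT \<eta>|gauss. (1 + \<bar>\<eta>\<bar>) ^ k)"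

lemma gauss_moment_nonneg: "0 \<le> gauss_moment k"
  unfolding gauss_moment_def by (intro integral_nonneg_AE) auto

lemma fourier1_packet:
  assumes "S > 0"
  shows "fourier1 (packet S \<omega>) \<xi> = of_real (sqrt (2 * pi) / S * exp (- ((\<xi> - \<omega>) / S)\<^sup>2 / 2))"
proof -
  have "fourier1 (packet S \<omega>) \<xi> = (1 / S) *\<^sub>R (LINT y|lborel. packet S \<omega> (0 + 1 / S * y) * cis (- ((0 + 1 / S * y) * \<xi>)))"
    unfolding fourier1_def
    using assms by (subst lborel_integral_real_affine[where c="1 / S" and t=0]) auto
  also have "(\<lambda>y. packet S \<omega> (0 + 1 / S * y) * cis (- ((0 + 1 / S * y) * \<xi>)))
      = (\<lambda>y. sqrt (2 * pi) *\<^sub>R (std_normal_density y *\<^sub>R cis (y * ((\<omega> - \<xi>) / S))))"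
  proof
    fix y
    have "S * (0 + 1 / S * y) = y" using assms by simp
    then have "packet S \<omega> (0 + 1 / S * y) * cis (- ((0 + 1 / S * y) * \<xi>))
       = of_real (exp (- y\<^sup>2 / 2)) * (cis (\<omega> * (y / S)) * cis (- (y / S * \<xi>)))"
      by (simp add: packet_def)
    also have "cis (\<omega> * (y / S)) * cis (- (y / S * \<xi>)) = cis (y * ((\<omega> - \<xi>) / S))"
      by (simp add: cis_mult diff_divide_distrib algebra_simps)
    finally show "packet S \<omega> (0 + 1 / S * y) * cis (- ((0 + 1 / S * y) * \<xi>))
      = sqrt (2 * pi) *\<^sub>R (std_normal_density y *\<^sub>R cis (y * ((\<omega> - \<xi>) / S)))"
      unfolding exp_eq_std_normal_density by (simp add: scaleR_conv_of_real)
  qed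
  also have "(LINT y|lborel. sqrt (2 * pi) *\<^sub>R (std_normal_density y *\<^sub>R cis (y * ((\<omega> - \<xi>) / S))))
      = sqrt (2 * pi) *\<^sub>R (LINT y|gauss. cis (y * ((\<omega> - \<xi>) / S)))"
    by (simp add: integral_gauss del: scaleR_scaleR)
  also have "\<dots> = sqrt (2 * pi) *\<^sub>R of_real (exp (- ((\<xi> - \<omega>) / S)\<^sup>2 / 2))"
    by (simp only: integral_gauss_cis) (simp add: power_divide power2_commute)
  finally show ?thesis by (simp add: scaleR_conv_of_real)
qed

lemma
  assumes "S > 0"
  shows integrable_packet: "integrable lborel (packet S \<omega>)"
    and integrable_fourier1_packet: "integrable lborel (fourier1 (packet S \<omega>))"
proof -
  have g: "integrable lborel (\<lambda>x. exp (- (c * x + d)\<^sup>2 / 2))" if "c \<noteq> 0" for c d :: real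
  proof -
    have "integrable lborel (\<lambda>x. sqrt (2 * pi) * std_normal_density x)" by simp
    then have "integrable lborel (\<lambda>x::real. exp (- x\<^sup>2 / 2))" by (simp only: exp_eq_std_normal_density)
    from lborel_integrable_real_affine[OF this that, of d] show ?thesis by (simp add: add.commute)
  qed
  show "integrable lborel (packet S \<omega>)"
    using g[of S 0] assms
    by (rule_tac Bochner_Integration.integrable_bound[of _ "\<lambda>x. exp (- (S * x)\<^sup>2 / 2)"])
      (auto simp: packet_def[abs_def] norm_mult)
  have "(\<lambda>x. exp (- ((x - \<omega>) / S)\<^sup>2 / 2)) = (\<lambda>x. exp (- (1 / S * x + (- \<omega> / S))\<^sup>2 / 2))"
    by (simp add: diff_divide_distrib)
  then have "integrable lborel (\<lambda>x. exp (- ((x - \<omega>) / S)\<^sup>2 / 2))" using g[of "1 / S" "- \<omega> / S"] assms by simp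
  then show "integrable lborel (fourier1 (packet S \<omega>))"
    using assms by (simp add: fourier1_packet cong: Bochner_Integration.integrable_cong)
qed

lemma evolution1_packet:
  assumes "S > 0"
  shows "evolution1 k t (packet S \<omega>) x = (LINT \<eta>|gauss. cis ((\<omega> + S * \<eta>) * x + (\<omega> + S * \<eta>) ^ k * t))"
proof -
  define F where "F \<xi> = of_real (sqrt (2 * pi) / S * exp (- ((\<xi> - \<omega>) / S)\<^sup>2 / 2)) * cis (\<xi> * x + \<xi> ^ k * t)" for \<xi>
  have "evolution1 k t (packet S \<omega>) x = 1 / (2 * pi) * (LINT \<xi>|lborel. F \<xi>)"
    using assms by (simp add: evolution1_def fourier1_packet F_def)
  also have "(LINT \<xi>|lborel. F \<xi>) = S *\<^sub>R (LINT \<eta>|lborel. F (\<omega> + S * \<eta>))"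
    using assms by (subst lborel_integral_real_affine[where c=S and t=\<omega>]) auto
  also have "(\<lambda>\<eta>. F (\<omega> + S * \<eta>)) = (\<lambda>\<eta>. (2 * pi / S) *\<^sub>R (std_normal_density \<eta> *\<^sub>R cis ((\<omega> + S * \<eta>) * x + (\<omega> + S * \<eta>) ^ k * t)))"
  proof
    fix \<eta>
    have "(\<omega> + S * \<eta> - \<omega>) / S = \<eta>" using assms by simp
    then show "F (\<omega> + S * \<eta>) = (2 * pi / S) *\<^sub>R (std_normal_density \<eta> *\<^sub>R cis ((\<omega> + S * \<eta>) * x + (\<omega> + S * \<eta>) ^ k * t))"
      unfolding F_def exp_eq_std_normal_density by (simp add: scaleR_conv_of_real flip: of_real_mult)
  qed
  also have "(LINT \<eta>|lborel. (2 * pi / S) *\<^sub>R (std_normal_density \<eta> *\<^sub>R cis ((\<omega> + S * \<eta>) * x + (\<omega> + S * \<eta>) ^ k * t)))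
     = (2 * pi / S) *\<^sub>R (LINT \<eta>|gauss. cis ((\<omega> + S * \<eta>) * x + (\<omega> + S * \<eta>) ^ k * t))"
    by (simp add: integral_gauss del: scaleR_scaleR)
  finally show ?thesis using assms by (simp add: scaleR_conv_of_real)
qed

text \<open>Each term with exponent \<open>l \<ge> j\<close> has size at most \<open>S ^ l * R ^ (k - l)\<close>, which is largest for
\<open>l = j\<close> because \<open>S \<le> R\<close>; the remaining binomial sum is at most \<open>(1 + \<bar>\<eta>\<bar>) ^ k\<close>.\<close>
lemma binomial_tail_bound:
  fixes A R S \<eta> :: real
  assumes "j \<le> k" "0 \<le> A" "A \<le> R" "0 \<le> S" "S \<le> R"
  shows "\<bar>\<Sum>l=j..k. real (k choose l) * (S * \<eta>) ^ l * A ^ (k - l)\<bar> \<le> S ^ j * R ^ (k - j) * (1 + \<bar>\<eta>\<bar>) ^ k"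
proof -
  have R: "R \<ge> 0" using assms by simp
  have "\<bar>\<Sum>l=j..k. real (k choose l) * (S * \<eta>) ^ l * A ^ (k - l)\<bar>
     \<le> (\<Sum>l=j..k. \<bar>real (k choose l) * (S * \<eta>) ^ l * A ^ (k - l)\<bar>)" by (rule sum_abs)
  also have "\<dots> \<le> (\<Sum>l=j..k. S ^ j * R ^ (k - j) * (real (k choose l) * \<bar>\<eta>\<bar> ^ l))"
  proof (rule sum_mono)
    fix l assume l: "l \<in> {j..k}"
    have "S ^ l * A ^ (k - l) \<le> (S ^ j * R ^ (l - j)) * R ^ (k - l)"
    proof (intro mult_mono)
      have "S ^ l = S ^ j * S ^ (l - j)" using l by (simp flip: power_add)
      also have "\<dots> \<le> S ^ j * R ^ (l - j)" using assms by (intro mult_left_mono power_mono) auto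
      finally show "S ^ l \<le> S ^ j * R ^ (l - j)" .
    qed (use assms R in \<open>auto intro: power_mono\<close>)
    also have "\<dots> = S ^ j * R ^ (k - j)" using l by (simp add: mult.assoc flip: power_add)
    finally have *: "S ^ l * A ^ (k - l) \<le> S ^ j * R ^ (k - j)" .
    have "\<bar>real (k choose l) * (S * \<eta>) ^ l * A ^ (k - l)\<bar> = (real (k choose l) * \<bar>\<eta>\<bar> ^ l) * (S ^ l * A ^ (k - l))"
      using assms by (simp add: abs_mult power_abs power_mult_distrib)
    also have "\<dots> \<le> (real (k choose l) * \<bar>\<eta>\<bar> ^ l) * (S ^ j * R ^ (k - j))"
      using * by (intro mult_left_mono) auto
    finally show "\<bar>real (k choose l) * (S * \<eta>) ^ l * A ^ (k - l)\<bar> \<le> S ^ j * R ^ (k - j) * (real (k choose l) * \<bar>\<eta>\<bar> ^ l)"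
      by (simp add: mult_ac)
  qed
  also have "\<dots> = S ^ j * R ^ (k - j) * (\<Sum>l=j..k. real (k choose l) * \<bar>\<eta>\<bar> ^ l)"
    by (simp add: sum_distrib_left)
  also have "\<dots> \<le> S ^ j * R ^ (k - j) * (\<Sum>l\<le>k. real (k choose l) * \<bar>\<eta>\<bar> ^ l)"
    using assms R by (intro mult_left_mono sum_mono2) auto
  also have "(\<Sum>l\<le>k. real (k choose l) * \<bar>\<eta>\<bar> ^ l) = (1 + \<bar>\<eta>\<bar>) ^ k"
    by (subst add.commute) (simp add: binomial_ring)
  finally show ?thesis .
qed

lemma power_add_minus_bound:
  fixes A R \<eta> :: real
  assumes "k \<ge> 1" "0 \<le> A" "A \<le> R" "1 \<le> R"
  shows "\<bar>(A + \<eta>) ^ k - A ^ k\<bar> \<le> R ^ (k - 1) * (1 + \<bar>\<eta>\<bar>) ^ k"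
proof -
  have "(A + \<eta>) ^ k = (\<Sum>l\<le>k. real (k choose l) * \<eta> ^ l * A ^ (k - l))"
    by (subst add.commute) (simp add: binomial_ring)
  also have "\<dots> = A ^ k + (\<Sum>l=1..k. real (k choose l) * \<eta> ^ l * A ^ (k - l))"
    by (simp add: atMost_atLeast0 sum.atLeast_Suc_atMost)
  finally show ?thesis using binomial_tail_bound[of 1 k A R 1 \<eta>] assms by simp
qed

lemma power_add_minus_linear_bound:
  fixes R S \<eta> :: real
  assumes "k \<ge> 2" "0 \<le> S" "S \<le> R"
  shows "\<bar>(R + S * \<eta>) ^ k - R ^ k - k * R ^ (k - 1) * (S * \<eta>)\<bar> \<le> S\<^sup>2 * R ^ (k - 2) * (1 + \<bar>\<eta>\<bar>) ^ k"
proof -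
  have "(R + S * \<eta>) ^ k = (\<Sum>l\<le>k. real (k choose l) * (S * \<eta>) ^ l * R ^ (k - l))"
    by (subst add.commute) (simp add: binomial_ring)
  also have "\<dots> = R ^ k + (k * (S * \<eta>) * R ^ (k - 1) + (\<Sum>l=2..k. real (k choose l) * (S * \<eta>) ^ l * R ^ (k - l)))"
    using assms(1) by (simp add: atMost_atLeast0 sum.atLeast_Suc_atMost numeral_2_eq_2)
  finally show ?thesis using binomial_tail_bound[of 2 k R R S \<eta>] assms by (simp add: mult_ac)
qed

lemma norm_cis_minus_one: "norm (cis y - 1) \<le> \<bar>y\<bar>"
proof -
  have "norm (cis y - 1) = norm (exp (\<i> * of_real y) - 1)" by (simp add: cis_conv_exp)
  then show ?thesis using iexp_approx1[of y 0] by simp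
qed

text \<open>The phase is expanded at the frequency \<open>R\<close>. The linear term translates the packet by
\<open>- k * R ^ (k - 1) * t\<close>; the terms of order two and higher are treated as an error, which is small as
long as \<open>t * R ^ (k - 2) * S\<^sup>2\<close> is.\<close>
lemma packet_evolution_lower:
  fixes R S t x :: real
  assumes "k \<ge> 2" "0 < S" "S \<le> R" "0 \<le> t"
  shows "exp (- (S * (x + k * R ^ (k - 1) * t))\<^sup>2 / 2) - t * R ^ (k - 2) * S\<^sup>2 * gauss_moment k
     \<le> norm (evolution1 k t (packet S R) x)"
proof -
  define \<theta> where "\<theta> \<eta> = ((R + S * \<eta>) ^ k - R ^ k - k * R ^ (k - 1) * (S * \<eta>)) * t" for \<eta>
  define z where "z \<eta> = cis (\<eta> * (S * (x + k * R ^ (k - 1) * t)))" for \<eta>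
  have [measurable]: "\<theta> \<in> borel_measurable borel" "z \<in> borel_measurable borel"
    unfolding \<theta>_def[abs_def] z_def[abs_def] by measurable
  have split: "cis ((R + S * \<eta>) * x + (R + S * \<eta>) ^ k * t) = cis (R * x + R ^ k * t) * (z \<eta> * cis (\<theta> \<eta>))" for \<eta>
    by (simp add: z_def \<theta>_def cis_mult algebra_simps)
  have iz: "integrable gauss z" by (rule integrable_gauss_bounded[of _ 1]) (auto simp: z_def)
  have iw: "integrable gauss (\<lambda>\<eta>. z \<eta> * cis (\<theta> \<eta>))"
    by (rule integrable_gauss_bounded[of _ 1]) (auto simp: z_def norm_mult)
  have "norm (evolution1 k t (packet S R) x) = norm (LINT \<eta>|gauss. z \<eta> * cis (\<theta> \<eta>))"
    using assms by (simp add: evolution1_packet split norm_mult)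
  moreover have "(LINT \<eta>|gauss. z \<eta>) = of_real (exp (- (S * (x + k * R ^ (k - 1) * t))\<^sup>2 / 2))"
    unfolding z_def by (rule integral_gauss_cis)
  moreover have "norm ((LINT \<eta>|gauss. z \<eta> * cis (\<theta> \<eta>)) - (LINT \<eta>|gauss. z \<eta>)) \<le> t * R ^ (k - 2) * S\<^sup>2 * gauss_moment k"
  proof -
    have "norm ((LINT \<eta>|gauss. z \<eta> * cis (\<theta> \<eta>)) - (LINT \<eta>|gauss. z \<eta>)) = norm (LINT \<eta>|gauss. z \<eta> * cis (\<theta> \<eta>) - z \<eta>)"
      using iz iw by simp
    also have "\<dots> \<le> (LINT \<eta>|gauss. t * R ^ (k - 2) * S\<^sup>2 * (1 + \<bar>\<eta>\<bar>) ^ k)"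
    proof (rule order_trans[OF integral_norm_bound integral_mono])
      fix \<eta>
      have "z \<eta> * cis (\<theta> \<eta>) - z \<eta> = z \<eta> * (cis (\<theta> \<eta>) - 1)" by (simp add: right_diff_distrib)
      then have "norm (z \<eta> * cis (\<theta> \<eta>) - z \<eta>) = norm (cis (\<theta> \<eta>) - 1)" by (simp add: norm_mult z_def)
      also have "\<dots> \<le> \<bar>\<theta> \<eta>\<bar>" by (rule norm_cis_minus_one)
      also have "\<dots> \<le> S\<^sup>2 * R ^ (k - 2) * (1 + \<bar>\<eta>\<bar>) ^ k * t"
        unfolding \<theta>_def abs_mult using assms
        by (intro mult_mono power_add_minus_linear_bound) auto
      finally show "norm (z \<eta> * cis (\<theta> \<eta>) - z \<eta>) \<le> t * R ^ (k - 2) * S\<^sup>2 * (1 + \<bar>\<eta>\<bar>) ^ k"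
        by (simp add: mult_ac)
    qed (use iz iw integrable_gauss_power in auto)
    finally show ?thesis by (simp add: gauss_moment_def)
  qed
  ultimately show ?thesis
    using norm_triangle_ineq3[of "LINT \<eta>|gauss. z \<eta> * cis (\<theta> \<eta>)" "LINT \<eta>|gauss. z \<eta>"] by simp
qed

section \<open>Sums of wave packets at rational times\<close>

definition packet_sum :: "nat \<Rightarrow> real \<Rightarrow> real \<Rightarrow> complex" where
  "packet_sum N L x = (\<Sum>m<N. packet 1 (L * real m) x)"

lemma integrable_packet_sum: "integrable lborel (packet_sum N L)"
  unfolding packet_sum_def[abs_def] by (intro Bochner_Integration.integrable_sum integrable_packet) simp

lemma fourier1_packet_sum: "fourier1 (packet_sum N L) \<xi> = (\<Sum>m<N. fourier1 (packet 1 (L * real m)) \<xi>)"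
proof -
  have "integrable lborel (\<lambda>x. packet 1 \<omega> x * cis (- (x * \<xi>)))" for \<omega>
    by (rule Bochner_Integration.integrable_bound[OF integrable_packet[of 1 \<omega>]])
      (auto simp: norm_mult packet_def[abs_def])
  then show ?thesis
    by (simp add: fourier1_def packet_sum_def sum_distrib_right)
qed

lemma integrable_fourier1_packet_sum: "integrable lborel (fourier1 (packet_sum N L))"
proof -
  have "integrable lborel (\<lambda>\<xi>. \<Sum>m<N. fourier1 (packet 1 (L * real m)) \<xi>)"
    by (intro Bochner_Integration.integrable_sum integrable_fourier1_packet) simp
  then show ?thesis by (simp add: fourier1_packet_sum cong: Bochner_Integration.integrable_cong)
qed

lemma evolution1_packet_sum:
  "evolution1 k t (packet_sum N L) x
    = (LINT \<eta>|gauss. (\<Sum>m<N. cis ((L * real m + \<eta>) * x + (L * real m + \<eta>) ^ k * t)))"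
proof -
  have int: "integrable lborel (\<lambda>\<xi>. fourier1 (packet 1 \<omega>) \<xi> * cis (\<xi> * x + \<xi> ^ k * t))" for \<omega>
  proof (rule Bochner_Integration.integrable_bound[OF integrable_fourier1_packet[of 1 \<omega>]])
    have [measurable]: "fourier1 (packet 1 \<omega>) \<in> borel_measurable borel"
      using borel_measurable_integrable[OF integrable_fourier1_packet[of 1 \<omega>]] by simp
    show "(\<lambda>\<xi>. fourier1 (packet 1 \<omega>) \<xi> * cis (\<xi> * x + \<xi> ^ k * t)) \<in> borel_measurable lborel" by measurable
  qed (auto simp: norm_mult)
  have "evolution1 k t (packet_sum N L) x = (\<Sum>m<N. evolution1 k t (packet 1 (L * real m)) x)"
    unfolding evolution1_def fourier1_packet_sum sum_distrib_right
    by (subst Bochner_Integration.integral_sum[OF int]) (simp add: sum_distrib_left)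
  also have "\<dots> = (\<Sum>m<N. (LINT \<eta>|gauss. cis ((L * real m + \<eta>) * x + (L * real m + \<eta>) ^ k * t)))"
    by (simp add: evolution1_packet)
  also have "\<dots> = (LINT \<eta>|gauss. (\<Sum>m<N. cis ((L * real m + \<eta>) * x + (L * real m + \<eta>) ^ k * t)))"
    by (rule Bochner_Integration.integral_sum[symmetric], rule integrable_gauss_bounded[of _ 1]) auto
  finally show ?thesis .
qed

lemma sum_chi_residues:
  assumes "q > 0"
  shows "(\<Sum>m<N. chi q (a * int m ^ k + b * int m) * g m)
    = (\<Sum>r<q. chi q (a * int r ^ k + b * int r) * (\<Sum>m\<in>{m\<in>{..<N}. m mod q = r}. g m))"
proof -
  have "(\<Sum>m<N. chi q (a * int m ^ k + b * int m) * g m)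
     = (\<Sum>r<q. \<Sum>m\<in>{m\<in>{..<N}. m mod q = r}. chi q (a * int m ^ k + b * int m) * g m)"
    by (rule sum.group[symmetric]) (use assms in auto)
  also have "\<dots> = (\<Sum>r<q. chi q (a * int r ^ k + b * int r) * (\<Sum>m\<in>{m\<in>{..<N}. m mod q = r}. g m))"
    unfolding sum_distrib_left
  proof (intro sum.cong refl arg_cong2[where f="(*)"])
    fix r m assume "m \<in> {m\<in>{..<N}. m mod q = r}"
    then have "[int m = int r] (mod int q)" by (auto simp: Cong.cong_def zmod_int)
    then show "chi q (a * int m ^ k + b * int m) = chi q (a * int r ^ k + b * int r)"
      using assms by (intro chi_cong cong_add cong_mult cong_pow cong_refl)
  qed
  finally show ?thesis .
qed

lemma card_residue_class:
  assumes "r < q"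
  shows "N div q \<le> card {m\<in>{..<N}. m mod q = r}" "card {m\<in>{..<N}. m mod q = r} \<le> N div q + 1"
proof -
  have inj: "inj_on (\<lambda>j. q * j + r) A" for A using assms by (auto simp: inj_on_def)
  have sub1: "(\<lambda>j. q * j + r) ` {..<N div q} \<subseteq> {m\<in>{..<N}. m mod q = r}"
  proof
    fix m assume "m \<in> (\<lambda>j. q * j + r) ` {..<N div q}"
    then obtain j where j: "m = q * j + r" "j < N div q" by blast
    then have "Suc j \<le> N div q" by simp
    then have "q * Suc j \<le> N" by (metis mult.commute less_eq_div_iff_mult_less_eq assms gr_zeroI not_less0)
    then show "m \<in> {m\<in>{..<N}. m mod q = r}" using j assms by auto
  qed
  have sub2: "{m\<in>{..<N}. m mod q = r} \<subseteq> (\<lambda>j. q * j + r) ` {..N div q}"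
  proof
    fix m assume m: "m \<in> {m\<in>{..<N}. m mod q = r}"
    then have "m = q * (m div q) + r" by auto
    moreover have "m div q \<le> N div q" using m by (simp add: div_le_mono)
    ultimately show "m \<in> (\<lambda>j. q * j + r) ` {..N div q}" by blast
  qed
  show "N div q \<le> card {m\<in>{..<N}. m mod q = r}"
    using card_mono[OF _ sub1] by (simp add: card_image[OF inj])
  show "card {m\<in>{..<N}. m mod q = r} \<le> N div q + 1"
    using card_mono[OF _ sub2] by (simp add: card_image[OF inj])
qed

text \<open>At \<open>t = 2 * pi * a / (q * L ^ k)\<close> and \<open>x = 2 * pi * (b / q + \<beta>) / L\<close> the phase of the \<open>m\<close>-th packet is that
of \<open>chi q (a * m ^ k + b * m)\<close>, up to a common factor \<open>cis (\<eta> * x)\<close> and a small phase \<open>\<psi> \<eta> m\<close> that does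
not depend on \<open>b\<close>. Collecting the \<open>m\<close> of each residue class gives \<open>J\<close> times the complete sum and
an error with coefficients \<open>v \<eta> r\<close> on the residues. The error is controlled on average over \<open>b\<close> only, by
Parseval, as its coefficients need not be regular in \<open>r\<close>. The bound \<open>E b\<close> majorizes it
uniformly in \<open>x\<close>, which makes it periodic in \<open>b\<close>.\<close>
lemma packet_sum_evolution_decomposition:
  fixes L \<beta> t :: real and a :: int and q N k :: nat
  defines "J \<equiv> N div q"
  assumes q: "q > 0" and k: "k \<ge> 1" and L: "0 < L" "1 \<le> L * N" and t: "0 \<le> t" "L ^ k * t = 2 * pi * a / q" and \<beta>: "0 \<le> \<beta>"
  shows "\<exists>E :: nat \<Rightarrow> real.
    (\<forall>b x. x = 2 * pi * (real b / real q + \<beta>) / L \<longrightarrow>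
        J * norm (power_sum k q a (int b)) * exp (- x\<^sup>2 / 2) - E b \<le> norm (evolution1 k t (packet_sum N L) x)) \<and>
    (\<forall>b. 0 \<le> E b) \<and> (\<forall>b c. E (q * c + b) = E b) \<and>
    (\<Sum>b<q. E b) \<le> real q * sqrt (real q) *
       ((real J + 1) * (2 * pi * N * \<beta> + t * (L * N) ^ (k - 1) * gauss_moment k) + 1)"
proof -
  define \<psi> where "\<psi> \<eta> m = 2 * pi * real m * \<beta> + ((L * real m + \<eta>) ^ k - (L * real m) ^ k) * t" for \<eta> :: real and m :: nat
  define \<delta> where "\<delta> \<eta> = 2 * pi * N * \<beta> + t * (L * N) ^ (k - 1) * (1 + \<bar>\<eta>\<bar>) ^ k" for \<eta>
  define v where "v \<eta> r = (\<Sum>m\<in>{m\<in>{..<N}. m mod q = r}. cis (\<psi> \<eta> m)) - of_nat J" for \<eta> r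
  define F where "F b \<eta> = (\<Sum>r<q. (v \<eta> r * chi q (a * int r ^ k)) * chi q (int b * int r))" for b \<eta>
  define E where "E b = (LINT \<eta>|gauss. norm (F b \<eta>))" for b
  have \<delta>0: "0 \<le> \<delta> \<eta>" for \<eta> using t L \<beta> by (simp add: \<delta>_def)
  have \<psi>\<delta>: "\<bar>\<psi> \<eta> m\<bar> \<le> \<delta> \<eta>" if "m < N" for \<eta> m
  proof -
    have "\<bar>(L * real m + \<eta>) ^ k - (L * real m) ^ k\<bar> \<le> (L * N) ^ (k - 1) * (1 + \<bar>\<eta>\<bar>) ^ k"
      using k L that by (intro power_add_minus_bound mult_left_mono) auto
    then have "\<bar>((L * real m + \<eta>) ^ k - (L * real m) ^ k) * t\<bar> \<le> (L * N) ^ (k - 1) * (1 + \<bar>\<eta>\<bar>) ^ k * t"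
      using t by (simp add: abs_mult mult_right_mono)
    moreover have "\<bar>2 * pi * real m * \<beta>\<bar> \<le> 2 * pi * N * \<beta>"
      using that \<beta> by (simp add: mult_right_mono)
    ultimately show ?thesis unfolding \<psi>_def \<delta>_def
      using abs_triangle_ineq[of "2 * pi * real m * \<beta>"] by (smt (verit) mult.commute mult.left_commute)
  qed
  have v\<delta>: "norm (v \<eta> r) \<le> (real J + 1) * \<delta> \<eta> + 1" if "r < q" for \<eta> r
  proof -
    let ?S = "{m\<in>{..<N}. m mod q = r}"
    have "norm (v \<eta> r) = norm ((\<Sum>m\<in>?S. cis (\<psi> \<eta> m) - 1) + (of_nat (card ?S) - of_nat J))"
      by (simp add: v_def sum_subtractf)
    also have "\<dots> \<le> (\<Sum>m\<in>?S. norm (cis (\<psi> \<eta> m) - 1)) + norm (of_nat (card ?S) - of_nat J :: complex)"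
      by (intro order_trans[OF norm_triangle_ineq] add_mono norm_sum order_refl)
    also have "\<dots> \<le> (\<Sum>m\<in>?S. \<delta> \<eta>) + 1"
    proof (rule add_mono)
      show "(\<Sum>m\<in>?S. norm (cis (\<psi> \<eta> m) - 1)) \<le> (\<Sum>m\<in>?S. \<delta> \<eta>)"
        using \<psi>\<delta> by (intro sum_mono order_trans[OF norm_cis_minus_one]) auto
      have "of_nat (card ?S) - of_nat J = (of_nat (card ?S - J) :: complex)"
        using card_residue_class(1)[OF that, of N] by (simp add: J_def of_nat_diff)
      then have "norm (of_nat (card ?S) - of_nat J :: complex) = real (card ?S - J)"
        by (simp only: norm_of_nat)
      then show "norm (of_nat (card ?S) - of_nat J :: complex) \<le> 1"
        using card_residue_class(2)[OF that, of N] by (simp add: J_def)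
    qed
    also have "(\<Sum>m\<in>?S. \<delta> \<eta>) = real (card ?S) * \<delta> \<eta>" by simp
    also have "\<dots> \<le> (real J + 1) * \<delta> \<eta>"
      using card_residue_class(2)[OF that, of N] \<delta>0 by (intro mult_right_mono) (auto simp: J_def)
    finally show ?thesis by simp
  qed
  have F_meas [measurable]: "F b \<in> borel_measurable borel" for b
    unfolding F_def[abs_def] v_def \<psi>_def by measurable
  have F_bdd: "norm (F b \<eta>) \<le> real q * (N + J)" for b \<eta>
  proof -
    have "norm (v \<eta> r) \<le> N + J" for r
    proof -
      have "norm (v \<eta> r) \<le> norm (\<Sum>m\<in>{m\<in>{..<N}. m mod q = r}. cis (\<psi> \<eta> m)) + norm (of_nat J :: complex)"
        unfolding v_def by (rule norm_triangle_ineq4)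
      also have "norm (\<Sum>m\<in>{m\<in>{..<N}. m mod q = r}. cis (\<psi> \<eta> m)) \<le> (\<Sum>m\<in>{m\<in>{..<N}. m mod q = r}. 1)"
        by (rule order_trans[OF norm_sum]) simp
      also have "\<dots> \<le> real N"
        using card_mono[of "{..<N}" "{m\<in>{..<N}. m mod q = r}"] by auto
      finally show ?thesis by simp
    qed
    then have "norm (F b \<eta>) \<le> (\<Sum>r<q. real (N + J))"
      unfolding F_def by (intro order_trans[OF norm_sum] sum_mono) (simp add: norm_mult)
    then show ?thesis by simp
  qed
  have F_int: "integrable gauss (\<lambda>\<eta>. norm (F b \<eta>))" for b
    by (intro integrable_norm integrable_gauss_bounded[OF _ F_bdd]) measurable
  show ?thesis
  proof (intro exI[of _ E] conjI allI impI)
    show "0 \<le> E b" for b unfolding E_def by (intro integral_nonneg_AE) auto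
    have "F (q * c + b) = F b" for b c
      unfolding F_def using q
      by (intro ext sum.cong refl arg_cong2[where f="(*)"] chi_cong cong_mult cong_refl) (auto simp: Cong.cong_def)
    then show "E (q * c + b) = E b" for b c by (simp add: E_def)
    fix b x assume x: "x = 2 * pi * (real b / real q + \<beta>) / L"
    have Lx: "L * x = 2 * pi * (real b / real q + \<beta>)" using L by (simp add: x)
    have "(\<Sum>m<N. cis ((L * real m + \<eta>) * x + (L * real m + \<eta>) ^ k * t))
       = cis (\<eta> * x) * (J * power_sum k q a (int b) + F b \<eta>)" for \<eta>
    proof -
      have "cis ((L * real m + \<eta>) * x + (L * real m + \<eta>) ^ k * t)
          = cis (\<eta> * x) * (chi q (a * int m ^ k + int b * int m) * cis (\<psi> \<eta> m))" for m
      proof -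
        have "(L * real m) ^ k * t = real m ^ k * (L ^ k * t)"
          by (simp add: power_mult_distrib)
        then have "(L * real m) ^ k * t = real m ^ k * (2 * pi * a / q)" by (simp only: t(2))
        moreover have "L * real m * x = real m * (2 * pi * (real b / real q + \<beta>))"
          using Lx by (simp add: mult_ac)
        moreover have "(L * real m + \<eta>) * x + (L * real m + \<eta>) ^ k * t
           = \<eta> * x + L * real m * x + (L * real m) ^ k * t + ((L * real m + \<eta>) ^ k - (L * real m) ^ k) * t"
          by (simp add: algebra_simps)
        ultimately have "(L * real m + \<eta>) * x + (L * real m + \<eta>) ^ k * t
           = \<eta> * x + (2 * pi * real_of_int (a * int m ^ k + int b * int m) / real q + \<psi> \<eta> m)"
          unfolding \<psi>_def by (simp add: add_divide_distrib algebra_simps)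
        then show ?thesis by (simp only: chi_def cis_mult)
      qed
      then have "(\<Sum>m<N. cis ((L * real m + \<eta>) * x + (L * real m + \<eta>) ^ k * t))
         = cis (\<eta> * x) * (\<Sum>m<N. chi q (a * int m ^ k + int b * int m) * cis (\<psi> \<eta> m))"
        by (simp add: sum_distrib_left)
      also have "(\<Sum>m<N. chi q (a * int m ^ k + int b * int m) * cis (\<psi> \<eta> m))
         = (\<Sum>r<q. chi q (a * int r ^ k + int b * int r) * (of_nat J + v \<eta> r))"
        by (subst sum_chi_residues[OF q]) (simp add: v_def)
      also have "\<dots> = J * power_sum k q a (int b) + F b \<eta>"
        by (simp add: distrib_left distrib_right sum.distrib power_sum_def F_def chi_add sum_distrib_left mult_ac)
      finally show ?thesis .
    qed
    then have "evolution1 k t (packet_sum N L) x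
        = (LINT \<eta>|gauss. cis (\<eta> * x) * (J * power_sum k q a (int b)) + cis (\<eta> * x) * F b \<eta>)"
      by (simp add: evolution1_packet_sum distrib_left)
    also have "\<dots> = (LINT \<eta>|gauss. cis (\<eta> * x) * (J * power_sum k q a (int b))) + (LINT \<eta>|gauss. cis (\<eta> * x) * F b \<eta>)"
    proof (rule Bochner_Integration.integral_add)
      show "integrable gauss (\<lambda>\<eta>. cis (\<eta> * x) * (J * power_sum k q a (int b)))"
        by (intro integrable_mult_left integrable_gauss_bounded[of _ 1]) auto
      show "integrable gauss (\<lambda>\<eta>. cis (\<eta> * x) * F b \<eta>)"
        by (rule integrable_gauss_bounded[of _ "real q * (N + J)"]) (use F_bdd in \<open>auto simp: norm_mult\<close>)
    qed
    also have "(LINT \<eta>|gauss. cis (\<eta> * x) * (J * power_sum k q a (int b)))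
       = of_real (exp (- x\<^sup>2 / 2)) * (J * power_sum k q a (int b))"
      by (simp only: integral_mult_left_zero integral_gauss_cis)
    finally have ev: "evolution1 k t (packet_sum N L) x = of_real (exp (- x\<^sup>2 / 2)) * (J * power_sum k q a (int b))
       + (LINT \<eta>|gauss. cis (\<eta> * x) * F b \<eta>)" .
    have "norm (LINT \<eta>|gauss. cis (\<eta> * x) * F b \<eta>) \<le> (LINT \<eta>|gauss. norm (cis (\<eta> * x) * F b \<eta>))"
      by (rule integral_norm_bound)
    also have "\<dots> = E b" by (simp add: E_def norm_mult)
    finally have "norm (LINT \<eta>|gauss. cis (\<eta> * x) * F b \<eta>) \<le> E b" .
    moreover have "norm (of_real (exp (- x\<^sup>2 / 2)) * (J * power_sum k q a (int b)) :: complex)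
        = J * norm (power_sum k q a (int b)) * exp (- x\<^sup>2 / 2)"
      by (simp add: norm_mult)
    ultimately show "J * norm (power_sum k q a (int b)) * exp (- x\<^sup>2 / 2) - E b \<le> norm (evolution1 k t (packet_sum N L) x)"
      unfolding ev using norm_diff_ineq[of "of_real (exp (- x\<^sup>2 / 2)) * (J * power_sum k q a (int b))" "LINT \<eta>|gauss. cis (\<eta> * x) * F b \<eta>"]
      by linarith
  next
    have "(\<Sum>b<q. norm (F b \<eta>)) \<le> real q * sqrt (real q) * ((real J + 1) * \<delta> \<eta> + 1)" for \<eta>
    proof -
      have "(\<Sum>b<q. norm (F b \<eta>))\<^sup>2 \<le> (\<Sum>b<q. (norm (F b \<eta>))\<^sup>2) * real q"
        using sum_squared_le_sum_of_squares[of "\<lambda>b. norm (F b \<eta>)" "{..<q}"] by simp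
      also have "(\<Sum>b<q. (norm (F b \<eta>))\<^sup>2) = real q * (\<Sum>r<q. (norm (v \<eta> r * chi q (a * int r ^ k)))\<^sup>2)"
        unfolding F_def by (rule chi_parseval[OF q])
      also have "(\<Sum>r<q. (norm (v \<eta> r * chi q (a * int r ^ k)))\<^sup>2) \<le> (\<Sum>r<q. ((real J + 1) * \<delta> \<eta> + 1)\<^sup>2)"
        using v\<delta> by (intro sum_mono power_mono) (auto simp: norm_mult)
      finally have "(\<Sum>b<q. norm (F b \<eta>))\<^sup>2 \<le> real q * (real q * ((real J + 1) * \<delta> \<eta> + 1)\<^sup>2) * real q"
        by (simp add: mult_left_mono mult_right_mono)
      also have "\<dots> = (real q * sqrt (real q) * ((real J + 1) * \<delta> \<eta> + 1))\<^sup>2"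
        by (simp add: power_mult_distrib power2_eq_square)
      finally show ?thesis
        by (rule power2_le_imp_le) (use \<delta>0 in \<open>auto intro!: mult_nonneg_nonneg add_nonneg_nonneg\<close>)
    qed
    then have "(LINT \<eta>|gauss. (\<Sum>b<q. norm (F b \<eta>)))
       \<le> (LINT \<eta>|gauss. real q * sqrt (real q) * ((real J + 1) * \<delta> \<eta> + 1))"
      using F_int integrable_gauss_power[of k]
      by (intro integral_mono) (auto simp: \<delta>_def)
    also have "\<dots> = real q * sqrt (real q) * ((real J + 1) * (2 * pi * N * \<beta> + t * (L * N) ^ (k - 1) * gauss_moment k) + 1)"
      using integrable_gauss_power[of k] by (simp add: \<delta>_def gauss_moment_def gauss.prob_space)
    finally show "(\<Sum>b<q. E b) \<le> real q * sqrt (real q) * ((real J + 1) * (2 * pi * N * \<beta> + t * (L * N) ^ (k - 1) * gauss_moment k) + 1)"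
      using F_int by (simp add: E_def)
  qed
qed

text \<open>A proportion \<open>1 / (8 * k\<^sup>2)\<close> of the residues \<open>b\<close> have a complete sum of modulus at least
\<open>sqrt (q / 2)\<close>. By Markov's inequality the error exceeds \<open>J * sqrt q / 16\<close> for at most half as
many, and for the rest the main term prevails, with \<open>7/10 * 1/2 - 1/16 \<ge> 1/4\<close>.\<close>
lemma count_large_evolution:
  fixes L \<beta> t :: real and a :: int and q N k j :: nat
  defines "J \<equiv> N div q"
  assumes q: "prime q" "k < q" "\<not> int q dvd a" and k: "k \<ge> 2" and L: "0 < L" "1 \<le> L * N"
    and t: "0 \<le> t" "L ^ k * t = 2 * pi * a / q" and \<beta>: "0 \<le> \<beta>" and J: "J \<ge> 1"
    and small: "256 * real k ^ 2 * (2 * (2 * pi * N * \<beta> + t * (L * N) ^ (k - 1) * gauss_moment k) + 1 / J) \<le> 1"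
    and range: "\<And>b. b \<in> {q * j..<q * j + q} \<Longrightarrow> 2 * pi * (real b / real q + \<beta>) / L \<le> 1"
  shows "real q \<le> 16 * real k ^ 2 * card {b\<in>{q * j..<q * j + q}.
     J * sqrt q / 4 \<le> norm (evolution1 k t (packet_sum N L) (2 * pi * (real b / real q + \<beta>) / L))}"
proof -
  have q0: "q > 0" using q by simp
  have k1: "1 \<le> k" using k by simp
  define e where "e = 2 * pi * N * \<beta> + t * (L * N) ^ (k - 1) * gauss_moment k"
  have e0: "e \<ge> 0" using \<beta> t L gauss_moment_nonneg[of k] by (simp add: e_def)
  define X where "X b = 2 * pi * (real b / real q + \<beta>) / L" for b :: nat
  obtain E where E: "\<And>b x. x = 2 * pi * (real b / real q + \<beta>) / L \<Longrightarrow>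
        J * norm (power_sum k q a (int b)) * exp (- x\<^sup>2 / 2) - E b \<le> norm (evolution1 k t (packet_sum N L) x)"
    and E2: "\<And>b. 0 \<le> E b" and E3: "\<And>b c. E (q * c + b) = E b"
    and E4: "(\<Sum>b<q. E b) \<le> real q * sqrt (real q) * ((real J + 1) * e + 1)"
    using packet_sum_evolution_decomposition[OF q0 k1 L t \<beta>, folded J_def e_def] by blast
  have E1: "J * norm (power_sum k q a (int b)) * exp (- (X b)\<^sup>2 / 2) - E b
        \<le> norm (evolution1 k t (packet_sum N L) (X b))" for b
    by (rule E) (simp add: X_def)
  define A where "A = {b\<in>{..<q}. real q / 2 \<le> (norm (power_sum k q a (int b)))\<^sup>2}"
  \<comment> \<open>The residues at which the error is not small.\<close>
  define B where "B = {b\<in>{..<q}. J * sqrt q / 16 < E b}"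
  have "real (card B) * (J * sqrt q / 16) \<le> (\<Sum>b\<in>B. E b)"
    by (rule sum_bounded_below) (auto simp: B_def)
  also have "\<dots> \<le> (\<Sum>b<q. E b)" using E2 by (intro sum_mono2) (auto simp: B_def)
  also note E4
  also have "real q * sqrt (real q) * ((real J + 1) * e + 1) \<le> real q * sqrt (real q) * (J * (2 * e + 1 / J))"
  proof (intro mult_left_mono)
    have "(real J + 1) * e \<le> 2 * J * e" using J e0 by (intro mult_right_mono) auto
    then show "(real J + 1) * e + 1 \<le> J * (2 * e + 1 / J)"
      using J by (simp add: distrib_left)
  qed auto
  finally have "(J * sqrt q) * real (card B) \<le> (J * sqrt q) * (16 * real q * (2 * e + 1 / J))"
    using J by (auto simp: algebra_simps)
  then have "real (card B) \<le> 16 * real q * (2 * e + 1 / J)"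
    using J q0 by (subst (asm) mult_le_cancel_left_pos) auto
  then have "16 * real k ^ 2 * card B \<le> 16 * real k ^ 2 * (16 * real q * (2 * e + 1 / J))"
    by (intro mult_left_mono) auto
  also have "\<dots> = real q * (256 * real k ^ 2 * (2 * e + 1 / J))" by simp
  also have "\<dots> \<le> real q * 1" using small by (intro mult_left_mono) (auto simp: e_def)
  finally have cB: "16 * real k ^ 2 * card B \<le> real q" by simp
  have cA: "real q \<le> 8 * real k ^ 2 * card A"
    unfolding A_def by (rule many_large_power_sums) (use q k in auto)
  have "card A \<le> card (A - B) + card B"
    using diff_card_le_card_Diff[of B A] by (simp add: B_def)
  then have "16 * real k ^ 2 * real (card A) \<le> 16 * real k ^ 2 * real (card (A - B) + card B)"
    by (intro mult_left_mono) auto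
  then have cAB: "real q \<le> 16 * real k ^ 2 * card (A - B)"
    using cA cB by (simp add: algebra_simps)
  let ?G = "{b\<in>{q * j..<q * j + q}. J * sqrt q / 4 \<le> norm (evolution1 k t (packet_sum N L) (X b))}"
  have "(\<lambda>b. q * j + b) ` (A - B) \<subseteq> ?G"
  proof
    fix b assume "b \<in> (\<lambda>b. q * j + b) ` (A - B)"
    then obtain c where c: "b = q * j + c" "c \<in> A" "c \<notin> B" by blast
    have b: "b \<in> {q * j..<q * j + q}" using c by (auto simp: A_def)
    have X: "0 \<le> X b" "X b \<le> 1" using range[OF b] \<beta> L by (auto simp: X_def)
    have "power_sum k q a (int b) = power_sum k q a (int c)"
      using q0 by (intro power_sum_cong cong_refl) (auto simp: c Cong.cong_def)
    then have "real q / 2 \<le> (norm (power_sum k q a (int b)))\<^sup>2" using c by (simp add: A_def)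
    moreover have "(7 / 10 * sqrt q)\<^sup>2 \<le> real q / 2" by (simp add: power_mult_distrib power2_eq_square)
    ultimately have "(7 / 10 * sqrt q)\<^sup>2 \<le> (norm (power_sum k q a (int b)))\<^sup>2" by linarith
    then have P: "7 / 10 * sqrt q \<le> norm (power_sum k q a (int b))" by (rule power2_le_imp_le) simp
    have "(X b)\<^sup>2 \<le> 1" using X by (simp add: power_le_one)
    then have ex: "1 / 2 \<le> exp (- (X b)\<^sup>2 / 2)" using exp_ge_add_one_self[of "- (X b)\<^sup>2 / 2"] by linarith
    have "E b = E c" using E3 c by simp
    then have Eb: "E b \<le> J * sqrt q / 16" using c by (auto simp: A_def B_def)
    have "J * (7 / 10 * sqrt q) * (1 / 2) \<le> J * norm (power_sum k q a (int b)) * exp (- (X b)\<^sup>2 / 2)"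
      using P ex by (intro mult_mono mult_left_mono) auto
    then have "J * (7 / 10 * sqrt q) * (1 / 2) - J * sqrt q / 16 \<le> norm (evolution1 k t (packet_sum N L) (X b))"
      using E1[of b] Eb by linarith
    moreover have "J * sqrt q / 4 \<le> J * (7 / 10 * sqrt q) * (1 / 2) - J * sqrt q / 16"
      by (simp add: field_simps)
    ultimately have "J * sqrt q / 4 \<le> norm (evolution1 k t (packet_sum N L) (X b))" by linarith
    then show "b \<in> ?G" using b by simp
  qed
  then have "card ((\<lambda>b. q * j + b) ` (A - B)) \<le> card ?G" by (intro card_mono) auto
  moreover have "card ((\<lambda>b. q * j + b) ` (A - B)) = card (A - B)" by (intro card_image) (auto simp: inj_on_def)
  ultimately have "16 * real k ^ 2 * card (A - B) \<le> 16 * real k ^ 2 * card ?G" by (intro mult_left_mono) auto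
  then show ?thesis using cAB by (simp add: X_def)
qed

section \<open>Weighted norms of wave packets\<close>

text \<open>The weight \<open>1 + \<xi>\<^sup>2 / R\<^sup>2\<close> is bounded on the frequencies up to \<open>R\<close>. It replaces the Sobolev weight
because it can be split into factors, one for each coordinate.\<close>
lemma
  fixes s u R :: real
  assumes "0 < s" "s \<le> R" "0 \<le> u" "u \<le> R"
  shows integrable_weighted_gaussian: "integrable lborel (\<lambda>\<xi>. (1 + \<xi>\<^sup>2 / R\<^sup>2) * exp (- ((\<xi> - u) / s)\<^sup>2 / 2))"
    and integral_weighted_gaussian: "(LINT \<xi>|lborel. (1 + \<xi>\<^sup>2 / R\<^sup>2) * exp (- ((\<xi> - u) / s)\<^sup>2 / 2))
      \<le> s * sqrt (2 * pi) * (1 + gauss_moment 2)"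
proof -
  define f where "f \<xi> = (1 + \<xi>\<^sup>2 / R\<^sup>2) * exp (- ((\<xi> - u) / s)\<^sup>2 / 2)" for \<xi>
  have fe: "f (u + s * \<eta>) = sqrt (2 * pi) *\<^sub>R (std_normal_density \<eta> *\<^sub>R (1 + (u + s * \<eta>)\<^sup>2 / R\<^sup>2))" for \<eta>
  proof -
    have "(u + s * \<eta> - u) / s = \<eta>" using assms by simp
    then show ?thesis unfolding f_def exp_eq_std_normal_density by simp
  qed
  have le: "1 + (u + s * \<eta>)\<^sup>2 / R\<^sup>2 \<le> 1 + (1 + \<bar>\<eta>\<bar>)\<^sup>2" for \<eta>
  proof -
    have "\<bar>u + s * \<eta>\<bar> \<le> u + s * \<bar>\<eta>\<bar>" using abs_triangle_ineq[of u "s * \<eta>"] assms by (simp add: abs_mult)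
    also have "\<dots> \<le> R + R * \<bar>\<eta>\<bar>" using assms by (intro add_mono mult_right_mono) auto
    also have "\<dots> = R * (1 + \<bar>\<eta>\<bar>)" by (simp add: algebra_simps)
    finally have "\<bar>u + s * \<eta>\<bar> / R \<le> 1 + \<bar>\<eta>\<bar>" using assms by (simp add: field_simps)
    then have "(\<bar>u + s * \<eta>\<bar> / R)\<^sup>2 \<le> (1 + \<bar>\<eta>\<bar>)\<^sup>2" using assms by (intro power_mono) auto
    then show ?thesis by (simp add: power_divide)
  qed
  have ig: "integrable gauss (\<lambda>\<eta>. 1 + (1 + \<bar>\<eta>\<bar>)\<^sup>2)"
    using integrable_gauss_power[of 2] by simp
  have i: "integrable gauss (\<lambda>\<eta>. 1 + (u + s * \<eta>)\<^sup>2 / R\<^sup>2)"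
  proof (rule Bochner_Integration.integrable_bound[OF ig])
    show "AE \<eta> in gauss. norm (1 + (u + s * \<eta>)\<^sup>2 / R\<^sup>2) \<le> norm (1 + (1 + \<bar>\<eta>\<bar>)\<^sup>2)"
    proof (rule AE_I2)
      fix \<eta>
      have "0 \<le> 1 + (u + s * \<eta>)\<^sup>2 / R\<^sup>2" by (simp add: add_nonneg_nonneg)
      then show "norm (1 + (u + s * \<eta>)\<^sup>2 / R\<^sup>2) \<le> norm (1 + (1 + \<bar>\<eta>\<bar>)\<^sup>2)"
        using le[of \<eta>] unfolding real_norm_def by linarith
    qed
  qed simp
  then have "integrable lborel (\<lambda>\<eta>. f (u + s * \<eta>))"
    unfolding fe by (intro integrable_scaleR_right) (simp add: integral_gauss)
  then show int: "integrable lborel (\<lambda>\<xi>. (1 + \<xi>\<^sup>2 / R\<^sup>2) * exp (- ((\<xi> - u) / s)\<^sup>2 / 2))"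
    using assms lborel_integrable_real_affine_iff[of s f u] unfolding f_def by simp
  have "(LINT \<xi>|lborel. f \<xi>) = s * (LINT \<eta>|lborel. f (u + s * \<eta>))"
    using assms by (subst lborel_integral_real_affine[where c=s and t=u]) auto
  also have "(LINT \<eta>|lborel. f (u + s * \<eta>)) = sqrt (2 * pi) * (LINT \<eta>|gauss. 1 + (u + s * \<eta>)\<^sup>2 / R\<^sup>2)"
    unfolding fe by (simp add: integral_gauss del: scaleR_scaleR real_scaleR_def) simp
  also have "s * (sqrt (2 * pi) * (LINT \<eta>|gauss. 1 + (u + s * \<eta>)\<^sup>2 / R\<^sup>2))
      \<le> s * (sqrt (2 * pi) * (LINT \<eta>|gauss. 1 + (1 + \<bar>\<eta>\<bar>)\<^sup>2))"
    using assms le i ig by (intro mult_left_mono integral_mono) auto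
  also have "(LINT \<eta>|gauss. 1 + (1 + \<bar>\<eta>\<bar>)\<^sup>2) = 1 + gauss_moment 2"
    using integrable_gauss_power[of 2] by (simp add: gauss_moment_def gauss.prob_space)
  finally show "(LINT \<xi>|lborel. (1 + \<xi>\<^sup>2 / R\<^sup>2) * exp (- ((\<xi> - u) / s)\<^sup>2 / 2)) \<le> s * sqrt (2 * pi) * (1 + gauss_moment 2)"
    by (simp add: f_def)
qed

definition packet_const :: real where
  "packet_const = 2 * pi * sqrt (2 * pi) * (1 + gauss_moment 2)"

lemma packet_const_nonneg: "0 \<le> packet_const"
  using gauss_moment_nonneg[of 2] by (simp add: packet_const_def)

lemma
  assumes "0 < S" "S \<le> R"
  shows integrable_weighted_packet: "integrable lborel (\<lambda>\<xi>. (1 + \<xi>\<^sup>2 / R\<^sup>2) * (norm (fourier1 (packet S R) \<xi>))\<^sup>2)"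
    and integral_weighted_packet: "(LINT \<xi>|lborel. (1 + \<xi>\<^sup>2 / R\<^sup>2) * (norm (fourier1 (packet S R) \<xi>))\<^sup>2) \<le> packet_const / S"
proof -
  define G where "G \<xi> = (1 + \<xi>\<^sup>2 / R\<^sup>2) * exp (- ((\<xi> - R) / S)\<^sup>2 / 2)" for \<xi>
  have G: "integrable lborel G" "(LINT \<xi>|lborel. G \<xi>) \<le> S * sqrt (2 * pi) * (1 + gauss_moment 2)"
    unfolding G_def[abs_def] using assms
    by (intro integrable_weighted_gaussian integral_weighted_gaussian; simp)+
  have G0: "0 \<le> G \<xi>" for \<xi> by (simp add: G_def add_nonneg_nonneg)
  have le: "(1 + \<xi>\<^sup>2 / R\<^sup>2) * (norm (fourier1 (packet S R) \<xi>))\<^sup>2 \<le> 2 * pi / S\<^sup>2 * G \<xi>" for \<xi>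
  proof -
    have "(norm (fourier1 (packet S R) \<xi>))\<^sup>2 = 2 * pi / S\<^sup>2 * exp (- ((\<xi> - R) / S)\<^sup>2 / 2) ^ 2"
      unfolding fourier1_packet[OF assms(1)] norm_of_real power2_abs
      by (simp only: power_mult_distrib power_divide) simp
    also have "\<dots> \<le> 2 * pi / S\<^sup>2 * exp (- ((\<xi> - R) / S)\<^sup>2 / 2)"
      by (intro mult_left_mono) (auto simp: power2_eq_square mult_le_one intro!: mult_left_le)
    finally have "(1 + \<xi>\<^sup>2 / R\<^sup>2) * (norm (fourier1 (packet S R) \<xi>))\<^sup>2 \<le> (1 + \<xi>\<^sup>2 / R\<^sup>2) * (2 * pi / S\<^sup>2 * exp (- ((\<xi> - R) / S)\<^sup>2 / 2))"
      by (intro mult_left_mono) (auto simp: add_nonneg_nonneg)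
    then show ?thesis by (simp add: G_def mult_ac)
  qed
  have [measurable]: "fourier1 (packet S R) \<in> borel_measurable borel"
    using borel_measurable_integrable[OF integrable_fourier1_packet[OF assms(1)]] by simp
  show int: "integrable lborel (\<lambda>\<xi>. (1 + \<xi>\<^sup>2 / R\<^sup>2) * (norm (fourier1 (packet S R) \<xi>))\<^sup>2)"
    by (rule Bochner_Integration.integrable_bound[OF integrable_mult_right[OF G(1), of "2 * pi / S\<^sup>2"]])
      (use le in \<open>auto intro!: AE_I2 order_trans[OF _ abs_ge_self] simp: abs_mult abs_of_nonneg add_nonneg_nonneg G0\<close>)
  have "(LINT \<xi>|lborel. (1 + \<xi>\<^sup>2 / R\<^sup>2) * (norm (fourier1 (packet S R) \<xi>))\<^sup>2) \<le> (LINT \<xi>|lborel. 2 * pi / S\<^sup>2 * G \<xi>)"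
    by (rule integral_mono[OF int integrable_mult_right[OF G(1)] le])
  also have "\<dots> \<le> 2 * pi / S\<^sup>2 * (S * sqrt (2 * pi) * (1 + gauss_moment 2))"
    using G(2) by (simp add: mult_left_mono divide_right_mono)
  also have "\<dots> = packet_const / S"
    using assms by (simp add: packet_const_def power2_eq_square)
  finally show "(LINT \<xi>|lborel. (1 + \<xi>\<^sup>2 / R\<^sup>2) * (norm (fourier1 (packet S R) \<xi>))\<^sup>2) \<le> packet_const / S" .
qed

text \<open>The packets have frequencies separated by \<open>L\<close>, and the product of two distinct ones carries the
factor \<open>exp (- L\<^sup>2 / 8) \<le> 1 / N\<close>. Thus all the off-diagonal terms together are of the size of the
diagonal.\<close>
lemma
  assumes "L * N \<le> R" "L > 0" "sqrt 2 \<le> R" "8 * real N \<le> L\<^sup>2"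
  shows integrable_weighted_packet_sum: "integrable lborel (\<lambda>\<xi>. (1 + \<xi>\<^sup>2 / R\<^sup>2) * (norm (fourier1 (packet_sum N L) \<xi>))\<^sup>2)"
    and integral_weighted_packet_sum: "(LINT \<xi>|lborel. (1 + \<xi>\<^sup>2 / R\<^sup>2) * (norm (fourier1 (packet_sum N L) \<xi>))\<^sup>2) \<le> 4 * packet_const * N"
proof -
  define G where "G m \<xi> = (1 + \<xi>\<^sup>2 / R\<^sup>2) * exp (- ((\<xi> - L * real m) / sqrt 2)\<^sup>2 / 2)" for m :: nat and \<xi>
  have Lm: "L * real m \<le> R" if "m < N" for m
  proof -
    have "L * real m \<le> L * real N" using that assms by (intro mult_left_mono) auto
    then show ?thesis using assms(1) by (rule order_trans)
  qed
  have G: "integrable lborel (G m)" "(LINT \<xi>|lborel. G m \<xi>) \<le> sqrt 2 * sqrt (2 * pi) * (1 + gauss_moment 2)" if "m < N" for m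
    unfolding G_def[abs_def] using assms Lm[OF that]
    by (intro integrable_weighted_gaussian integral_weighted_gaussian; simp)+
  define g where "g m \<xi> = exp (- (\<xi> - L * real m)\<^sup>2 / 2)" for m :: nat and \<xi>
  have gg: "g m \<xi> * g m' \<xi> \<le> exp (- (L * real m - L * real m')\<^sup>2 / 8) * exp (- ((\<xi> - L * real m) / sqrt 2)\<^sup>2 / 2)" for m m' \<xi>
  proof -
    define u v where "u = \<xi> - L * real m" and "v = \<xi> - L * real m'"
    have "0 \<le> 2 * (u + v)\<^sup>2 + 4 * v\<^sup>2" by simp
    then have "(u - v)\<^sup>2 / 8 + u\<^sup>2 / 4 \<le> u\<^sup>2 / 2 + v\<^sup>2 / 2"
      by (simp add: power2_sum power2_diff field_simps)
    moreover have "(L * real m - L * real m')\<^sup>2 = (u - v)\<^sup>2"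
      by (simp add: u_def v_def power2_commute)
    ultimately show ?thesis
      by (simp add: g_def power_divide flip: exp_add u_def v_def)
  qed
  have off: "(\<Sum>m'<N. exp (- (L * real m - L * real m')\<^sup>2 / 8)) \<le> 2" if "m < N" for m
  proof -
    have "exp (- (L * real m - L * real m')\<^sup>2 / 8) \<le> (if m' = m then 1 else 1 / N)" for m'
    proof (cases "m' = m")
      case False
      have "1 \<le> \<bar>real m - real m'\<bar>" using False by linarith
      then have "1 \<le> \<bar>real m - real m'\<bar>\<^sup>2" by (rule one_le_power)
      then have "L\<^sup>2 * 1 \<le> L\<^sup>2 * (real m - real m')\<^sup>2" by (intro mult_left_mono) auto
      then have "8 * real N \<le> L\<^sup>2 * (real m - real m')\<^sup>2" using assms(4) by linarith
      then have "8 * real N \<le> (L * real m - L * real m')\<^sup>2"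
        by (simp add: power_mult_distrib flip: right_diff_distrib)
      then have "real N \<le> exp ((L * real m - L * real m')\<^sup>2 / 8)"
        using exp_ge_add_one_self[of "(L * real m - L * real m')\<^sup>2 / 8"] by linarith
      then have "exp (- ((L * real m - L * real m')\<^sup>2 / 8)) \<le> 1 / N"
        using that by (simp add: exp_minus field_simps)
      then show ?thesis using False by simp
    qed simp
    then have "(\<Sum>m'<N. exp (- (L * real m - L * real m')\<^sup>2 / 8)) \<le> (\<Sum>m'<N. (if m' = m then 1 else 0) + 1 / N)"
      by (intro sum_mono) (smt (verit) divide_nonneg_nonneg of_nat_0_le_iff)
    also have "\<dots> \<le> 2" using that by (simp add: sum.distrib)
    finally show ?thesis .
  qed
  have le: "(1 + \<xi>\<^sup>2 / R\<^sup>2) * (norm (fourier1 (packet_sum N L) \<xi>))\<^sup>2 \<le> (\<Sum>m<N. 4 * pi * G m \<xi>)" for \<xi>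
  proof -
    have "fourier1 (packet_sum N L) \<xi> = of_real (sqrt (2 * pi) * (\<Sum>m<N. g m \<xi>))"
      by (simp add: fourier1_packet_sum fourier1_packet g_def sum_distrib_left)
    then have "(norm (fourier1 (packet_sum N L) \<xi>))\<^sup>2 = 2 * pi * (\<Sum>m<N. g m \<xi>)\<^sup>2"
      by (simp only: norm_of_real power2_abs power_mult_distrib) simp
    also have "(\<Sum>m<N. g m \<xi>)\<^sup>2 = (\<Sum>m<N. \<Sum>m'<N. g m \<xi> * g m' \<xi>)"
      by (simp add: power2_eq_square sum_product)
    also have "\<dots> \<le> (\<Sum>m<N. \<Sum>m'<N. exp (- (L * real m - L * real m')\<^sup>2 / 8) * exp (- ((\<xi> - L * real m) / sqrt 2)\<^sup>2 / 2))"
      by (intro sum_mono gg)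
    also have "\<dots> = (\<Sum>m<N. (\<Sum>m'<N. exp (- (L * real m - L * real m')\<^sup>2 / 8)) * exp (- ((\<xi> - L * real m) / sqrt 2)\<^sup>2 / 2))"
      by (simp only: sum_distrib_right)
    also have "\<dots> \<le> (\<Sum>m<N. 2 * exp (- ((\<xi> - L * real m) / sqrt 2)\<^sup>2 / 2))"
      using off by (intro sum_mono mult_right_mono) auto
    finally have "(norm (fourier1 (packet_sum N L) \<xi>))\<^sup>2 \<le> 2 * pi * (\<Sum>m<N. 2 * exp (- ((\<xi> - L * real m) / sqrt 2)\<^sup>2 / 2))"
      by (simp add: mult_left_mono)
    then have "(1 + \<xi>\<^sup>2 / R\<^sup>2) * (norm (fourier1 (packet_sum N L) \<xi>))\<^sup>2
      \<le> (1 + \<xi>\<^sup>2 / R\<^sup>2) * (2 * pi * (\<Sum>m<N. 2 * exp (- ((\<xi> - L * real m) / sqrt 2)\<^sup>2 / 2)))"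
      by (intro mult_left_mono) (auto simp: add_nonneg_nonneg)
    then show ?thesis by (simp add: G_def sum_distrib_left mult_ac)
  qed
  have GI: "integrable lborel (\<lambda>\<xi>. \<Sum>m<N. 4 * pi * G m \<xi>)"
    using G(1) by (intro Bochner_Integration.integrable_sum integrable_mult_right) auto
  have [measurable]: "fourier1 (packet_sum N L) \<in> borel_measurable borel"
    using borel_measurable_integrable[OF integrable_fourier1_packet_sum] by simp
  show int: "integrable lborel (\<lambda>\<xi>. (1 + \<xi>\<^sup>2 / R\<^sup>2) * (norm (fourier1 (packet_sum N L) \<xi>))\<^sup>2)"
    by (rule Bochner_Integration.integrable_bound[OF GI])
      (use le in \<open>auto intro!: AE_I2 order_trans[OF _ abs_ge_self] simp: abs_mult abs_of_nonneg add_nonneg_nonneg\<close>)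
  have "(LINT \<xi>|lborel. (1 + \<xi>\<^sup>2 / R\<^sup>2) * (norm (fourier1 (packet_sum N L) \<xi>))\<^sup>2) \<le> (LINT \<xi>|lborel. (\<Sum>m<N. 4 * pi * G m \<xi>))"
    by (rule integral_mono[OF int GI le])
  also have "\<dots> = (\<Sum>m<N. 4 * pi * (LINT \<xi>|lborel. G m \<xi>))"
    using G(1) by (subst Bochner_Integration.integral_sum) auto
  also have "\<dots> \<le> (\<Sum>m<N. 4 * pi * (sqrt 2 * sqrt (2 * pi) * (1 + gauss_moment 2)))"
    using G(2) by (intro sum_mono mult_left_mono) auto
  also have "\<dots> = sqrt 2 * (2 * packet_const * N)" by (simp add: packet_const_def mult_ac)
  also have "\<dots> \<le> 2 * (2 * packet_const * N)"
    using packet_const_nonneg by (intro mult_right_mono) (auto intro!: real_le_lsqrt)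
  finally show "(LINT \<xi>|lborel. (1 + \<xi>\<^sup>2 / R\<^sup>2) * (norm (fourier1 (packet_sum N L) \<xi>))\<^sup>2) \<le> 4 * packet_const * N"
    by simp
qed

section \<open>The measure of sets of points near fractions\<close>

text \<open>The first two terms of inclusion and exclusion: each new set loses at most the sum of its
intersections with the previous ones.\<close>
lemma measure_union_pairwise_small:
  assumes "finite F" and "\<And>q. q \<in> F \<Longrightarrow> E q \<in> fmeasurable M"
    and "\<And>q. q \<in> F \<Longrightarrow> \<alpha> \<le> measure M (E q)"
    and "\<And>q q'. q \<in> F \<Longrightarrow> q' \<in> F \<Longrightarrow> q \<noteq> q' \<Longrightarrow> measure M (E q \<inter> E q') \<le> \<beta>"
    and "0 \<le> \<beta>" "real (card F) \<le> P"
  shows "real (card F) * (\<alpha> - P * \<beta>) \<le> measure M (\<Union>q\<in>F. E q)"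
  using assms(1-4,6)
proof (induction F)
  case (insert q F)
  let ?U = "\<Union>q\<in>F. E q"
  have U: "?U \<in> fmeasurable M" using insert by (intro fmeasurable.finite_UN) auto
  have Eq: "E q \<in> fmeasurable M" using insert by auto
  have IH: "real (card F) * (\<alpha> - P * \<beta>) \<le> measure M ?U"
    using insert by (intro insert.IH) auto
  have "measure M (E q \<inter> ?U) \<le> P * \<beta>"
  proof -
    have "E q \<inter> ?U = (\<Union>q'\<in>F. E q \<inter> E q')" by auto
    also have "measure M \<dots> \<le> (\<Sum>q'\<in>F. measure M (E q \<inter> E q'))"
      using insert by (intro measure_UNION_le) (auto simp: fmeasurable_def)
    also have "\<dots> \<le> (\<Sum>q'\<in>F. \<beta>)" using insert by (intro sum_mono insert.prems(3)) auto
    also have "\<dots> = real (card F) * \<beta>" by simp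
    also have "\<dots> \<le> P * \<beta>" using insert.prems(4) insert.hyps assms(5) by (intro mult_right_mono) auto
    finally show ?thesis .
  qed
  moreover have "measure M (E q \<union> ?U) = measure M (E q) + measure M ?U - measure M (E q \<inter> ?U)"
    using measure_Un3[OF Eq U] by simp
  moreover have "\<alpha> \<le> measure M (E q)" using insert by auto
  ultimately show ?case using IH insert.hyps by (simp add: algebra_simps)
qed simp

lemma measure_vec_prod:
  fixes B :: "'n::finite \<Rightarrow> real set"
  assumes "\<And>i. B i \<in> fmeasurable lborel"
  shows "{x::real^'n. \<forall>i. x $ i \<in> B i} \<in> fmeasurable lborel"
    and "measure lborel {x::real^'n. \<forall>i. x $ i \<in> B i} = (\<Prod>i\<in>UNIV. measure lborel (B i))"
proof -
  have [measurable]: "B i \<in> sets borel" for i using assms[of i] by (simp add: fmeasurable_def)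
  have "emeasure lborel {x::real^'n. \<forall>i. x $ i \<in> B i} = (\<Prod>i\<in>UNIV. ennreal (measure lborel (B i)))"
    using assms by (subst emeasure_vec_prod) (auto simp: emeasure_eq_measure2)
  also have "\<dots> = ennreal (\<Prod>i\<in>UNIV. measure lborel (B i))" by (simp add: prod_ennreal)
  finally have e: "emeasure lborel {x::real^'n. \<forall>i. x $ i \<in> B i} = ennreal (\<Prod>i\<in>UNIV. measure lborel (B i))" .
  have "{x::real^'n. \<forall>i. x $ i \<in> B i} \<in> sets borel" by measurable
  then show "{x::real^'n. \<forall>i. x $ i \<in> B i} \<in> fmeasurable lborel" using e by (auto intro: fmeasurableI)
  show "measure lborel {x::real^'n. \<forall>i. x $ i \<in> B i} = (\<Prod>i\<in>UNIV. measure lborel (B i))"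
    using e by (simp add: measure_def prod_nonneg)
qed

lemma card_int_abs_less: 
  assumes "h \<ge> 0"
  shows "finite {z::int. \<bar>real_of_int z\<bar> < h}" "real (card {z::int. \<bar>real_of_int z\<bar> < h}) \<le> 2 * h + 1"
proof -
  have sub: "{z::int. \<bar>real_of_int z\<bar> < h} \<subseteq> {- \<lfloor>h\<rfloor>..\<lfloor>h\<rfloor>}" by (auto simp: abs_less_iff) linarith+
  then show "finite {z::int. \<bar>real_of_int z\<bar> < h}" by (rule finite_subset) simp
  have "card {z::int. \<bar>real_of_int z\<bar> < h} \<le> card {- \<lfloor>h\<rfloor>..\<lfloor>h\<rfloor>}" using sub by (intro card_mono) auto
  also have "\<dots> = nat (2 * \<lfloor>h\<rfloor> + 1)" by simp
  finally have "real (card {z::int. \<bar>real_of_int z\<bar> < h}) \<le> 2 * real_of_int \<lfloor>h\<rfloor> + 1" using assms by linarith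
  then show "real (card {z::int. \<bar>real_of_int z\<bar> < h}) \<le> 2 * h + 1" by linarith
qed

lemma fmeasurable_Ico: "{a..<b::real} \<in> fmeasurable lborel"
  by (cases "a \<le> b") (auto intro!: fmeasurableI)

text \<open>The points less than \<open>w\<close> to the right of a fraction \<open>b / q\<close>, where the unit is the period \<open>2 * pi / L\<close>
of the frequency \<open>L\<close>.\<close>
definition near_rationals :: "nat \<Rightarrow> nat \<Rightarrow> real \<Rightarrow> real \<Rightarrow> real set" where
  "near_rationals q B L w = (\<Union>b<B. {2 * pi * real b / (real q * L)..<2 * pi * real b / (real q * L) + w})"

lemma near_rationals_fmeasurable: "near_rationals q B L w \<in> fmeasurable lborel"
  unfolding near_rationals_def by (intro fmeasurable.finite_UN fmeasurable_Ico) auto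

text \<open>If the intervals at \<open>b / q\<close> and \<open>b' / q'\<close> meet, then \<open>b * q' - b' * q\<close> is one of the few integers of modulus
less than \<open>q * q' * L * w / (2 * pi)\<close>. For a given value of this integer \<open>b\<close> is determined modulo \<open>q\<close>,
and then \<open>b'\<close> is determined, so there is one pair in each of the \<open>J\<close> periods.\<close>
lemma near_rationals_overlap:
  fixes q q' J :: nat and L w :: real
  assumes "prime q" "prime q'" "q \<noteq> q'" "L > 0" "w \<ge> 0"
  shows "measure lborel (near_rationals q (q * J) L w \<inter> near_rationals q' (q' * J) L w)
     \<le> real J * (real q * real q' * L * w / pi + 1) * w"
proof -
  have q: "q > 0" "q' > 0" using assms prime_gt_0_nat by auto
  define I where "I q b = {2 * pi * real b / (real q * L)..<2 * pi * real b / (real q * L) + w}" for q b :: nat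
  define h where "h = real q * real q' * L * w / (2 * pi)"
  have h0: "h \<ge> 0" using assms by (simp add: h_def)
  define P where "P = {(b, b'). b < q * J \<and> b' < q' * J \<and> I q b \<inter> I q' b' \<noteq> {}}"
  define f where "f = (\<lambda>(b::nat, b'::nat). (int b * int q' - int b' * int q, b div q))"
  have finP: "finite P" by (rule finite_subset[of _ "{..<q * J} \<times> {..<q' * J}"]) (auto simp: P_def)
  have fP: "f ` P \<subseteq> {z. \<bar>real_of_int z\<bar> < h} \<times> {..<J}"
  proof (clarsimp simp: f_def P_def, rule conjI)
    fix b b' assume b: "b < q * J" "b' < q' * J" and ne: "I q b \<inter> I q' b' \<noteq> {}"
    then obtain x where "x \<in> I q b" "x \<in> I q' b'" by blast
    then have d: "\<bar>2 * pi * real b / (real q * L) - 2 * pi * real b' / (real q' * L)\<bar> < w"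
      unfolding I_def by auto
    have "2 * pi * real b / (real q * L) - 2 * pi * real b' / (real q' * L)
      = (real b * real q' - real b' * real q) * (2 * pi / (real q * real q' * L))"
      using q assms by (simp add: field_simps)
    then have "\<bar>real b * real q' - real b' * real q\<bar> * (2 * pi / (real q * real q' * L)) < w"
      using d q assms by (simp add: abs_mult)
    then show "\<bar>real b * real q' - real b' * real q\<bar> < h"
      using q assms by (simp add: h_def field_simps)
    show "b div q < J" using b by (simp add: less_mult_imp_div_less mult.commute)
  qed
  have "inj_on f P"
  proof (rule inj_onI, clarsimp simp: f_def)
    fix b b' c c' assume e: "int b * int q' - int b' * int q = int c * int q' - int c' * int q" and d: "b div q = c div q"
    have "(int b - int c) * int q' = (int b' - int c') * int q" using e by (simp add: algebra_simps)
    then have "int q dvd (int b - int c) * int q'" by simp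
    moreover have "coprime (int q) (int q')" using assms primes_coprime by auto
    ultimately have "int q dvd int b - int c" using coprime_dvd_mult_left_iff by blast
    then have "int b mod int q = int c mod int q" by (simp add: mod_eq_dvd_iff)
    then have "b mod q = c mod q" by (metis nat_int nat_mod_distrib of_nat_0_le_iff zmod_int)
    then have "b = c" using d by (metis mult_div_mod_eq)
    moreover from this have "b' = c'" using e q by simp
    ultimately show "b = c \<and> b' = c'" by simp
  qed
  then have "card P = card (f ` P)" by (simp add: card_image)
  also have "\<dots> \<le> card ({z::int. \<bar>real_of_int z\<bar> < h} \<times> {..<J})"
    using fP card_int_abs_less(1)[OF h0] by (intro card_mono) auto
  also have "\<dots> = card {z::int. \<bar>real_of_int z\<bar> < h} * J" by (simp add: card_cartesian_product)
  finally have "real (card P) \<le> real (card {z::int. \<bar>real_of_int z\<bar> < h}) * real J"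
    by (simp only: of_nat_le_iff flip: of_nat_mult)
  also have "\<dots> \<le> (2 * h + 1) * real J" by (intro mult_right_mono card_int_abs_less h0) auto
  finally have cP: "real (card P) \<le> (2 * h + 1) * real J" .
  have "near_rationals q (q * J) L w \<inter> near_rationals q' (q' * J) L w \<subseteq> (\<Union>p\<in>P. I q (fst p))"
    unfolding near_rationals_def P_def I_def by fastforce
  then have "measure lborel (near_rationals q (q * J) L w \<inter> near_rationals q' (q' * J) L w)
     \<le> measure lborel (\<Union>p\<in>P. I q (fst p))"
    using finP near_rationals_fmeasurable
    by (intro measure_mono_fmeasurable fmeasurable.finite_UN fmeasurableD fmeasurable.Int)
      (auto simp: I_def fmeasurable_Ico)
  also have "\<dots> \<le> (\<Sum>p\<in>P. measure lborel (I q (fst p)))"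
    by (intro measure_UNION_le finP) (auto simp: I_def)
  also have "\<dots> = real (card P) * w" using assms by (simp add: I_def)
  also have "\<dots> \<le> (2 * h + 1) * real J * w" using cP assms by (intro mult_right_mono) auto
  also have "2 * h = real q * real q' * L * w / pi" by (simp add: h_def)
  finally show ?thesis by (simp add: mult_ac)
qed

text \<open>Integrating over the offset \<open>u\<close> from the nearest fraction, and summing over the fractions first,
turns a count that is uniform in \<open>u\<close> into a bound for the measure. The bound on \<open>w\<close> keeps the
intervals disjoint.\<close>
lemma near_rationals_density:
  fixes q J :: nat and L w c :: real
  assumes q: "q > 0" and "L > 0" and w: "0 \<le> w" "w * (real q * L) \<le> 2 * pi"
    and [measurable]: "G \<in> sets borel"
    and count: "\<And>u j. 0 \<le> u \<Longrightarrow> u < w \<Longrightarrow> j < J \<Longrightarrow>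
       c \<le> real (card {b\<in>{q * j..<q * j + q}. 2 * pi * real b / (real q * L) + u \<in> G})"
  shows "real J * c * w \<le> measure lborel (near_rationals q (q * J) L w \<inter> G)"
proof -
  define X where "X b = 2 * pi * real b / (real q * L)" for b :: nat
  let ?A = "near_rationals q (q * J) L w"
  have A [measurable]: "?A \<in> sets borel" using near_rationals_fmeasurable by (auto simp: fmeasurable_def)
  have once: "(\<Sum>b<q * J. indicator {X b..<X b + w} y) \<le> (indicator ?A y :: ennreal)" for y
  proof (cases "\<exists>b<q * J. y \<in> {X b..<X b + w}")
    case True
    then obtain b where b: "b < q * J" "y \<in> {X b..<X b + w}" by blast
    have uniq: "b' = b" if "y \<in> {X b'..<X b' + w}" for b'
    proof -
      have "\<bar>X b - X b'\<bar> < w" using b that by auto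
      moreover have "X b - X b' = (real b - real b') * (2 * pi / (real q * L))"
        by (simp add: X_def diff_divide_distrib algebra_simps)
      ultimately have "\<bar>real b - real b'\<bar> * (2 * pi / (real q * L)) < w"
        using q assms(2) by (simp add: abs_mult)
      also have "w \<le> 2 * pi / (real q * L)" using w q assms(2) by (simp add: field_simps)
      finally have "\<bar>real b - real b'\<bar> * (2 * pi / (real q * L)) < 1 * (2 * pi / (real q * L))" by simp
      then have "\<bar>real b - real b'\<bar> < 1" using q assms(2) by (subst (asm) mult_less_cancel_right_pos) auto
      then show ?thesis by linarith
    qed
    have "(indicator {X b'..<X b' + w} y :: ennreal) = (if b' = b then 1 else 0)" for b'
    proof (cases "b' = b")
      case False
      then have "y \<notin> {X b'..<X b' + w}" using uniq by blast
      then show ?thesis using False by (simp only: indicator_simps if_False not_False_eq_True)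
    next
      case True
      then show ?thesis using b(2) by (simp only: indicator_simps if_True refl)
    qed
    then have "(\<Sum>b'<q * J. indicator {X b'..<X b' + w} y) = (\<Sum>b'<q * J. if b' = b then 1 else (0::ennreal))"
      by (simp only:)
    then have "(\<Sum>b<q * J. indicator {X b..<X b + w} y) = (1::ennreal)" using b by simp
    moreover have "y \<in> ?A" using b unfolding near_rationals_def X_def by blast
    ultimately show ?thesis by simp
  next
    case False
    then have "(\<Sum>b<q * J. indicator {X b..<X b + w} y) = (0::ennreal)" by (intro sum.neutral) (auto simp: indicator_def)
    then show ?thesis by simp
  qed
  have low: "ennreal (real J * c) \<le> (\<Sum>b<q * J. indicator G (X b + u))" if u: "0 \<le> u" "u < w" for u
  proof -
    have "real J * c = (\<Sum>j<J. c)" by simp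
    also have "\<dots> \<le> (\<Sum>j<J. real (card {b\<in>{q * j..<q * j + q}. X b + u \<in> G}))"
      using count[OF u] by (intro sum_mono) (auto simp: X_def)
    also have "\<dots> = (\<Sum>j<J. \<Sum>b\<in>{q * j..<q * j + q}. indicator G (X b + u))"
      by (intro sum.cong refl) (simp add: indicator_def sum.If_cases Int_def)
    also have "\<dots> = (\<Sum>b<q * J. indicator G (X b + u))"
      using sum.nat_group[of "\<lambda>b. indicator G (X b + u) :: real" q J] by (simp add: mult.commute)
    finally have "ennreal (real J * c) \<le> ennreal (\<Sum>b<q * J. indicator G (X b + u))" by (rule ennreal_leI)
    also have "\<dots> = (\<Sum>b<q * J. indicator G (X b + u))" by (simp add: sum_ennreal[symmetric] ennreal_indicator)
    finally show ?thesis .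
  qed
  have "ennreal (real J * c) * ennreal w = (\<integral>\<^sup>+u. ennreal (real J * c) * indicator {0..<w} u \<partial>lborel)"
    using w by (subst nn_integral_cmult_indicator) auto
  also have "\<dots> \<le> (\<integral>\<^sup>+u. (\<Sum>b<q * J. indicator {0..<w} u * indicator G (X b + u)) \<partial>lborel)"
    using low by (intro nn_integral_mono) (auto simp: indicator_def split: if_splits)
  also have "\<dots> = (\<Sum>b<q * J. \<integral>\<^sup>+u. indicator {0..<w} u * indicator G (X b + u) \<partial>lborel)"
    by (rule nn_integral_sum) measurable
  also have "\<dots> = (\<Sum>b<q * J. \<integral>\<^sup>+y. indicator {X b..<X b + w} y * indicator G y \<partial>lborel)"
  proof (rule sum.cong[OF refl])
    fix b
    have "(\<integral>\<^sup>+y. indicator {X b..<X b + w} y * indicator G y \<partial>lborel)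
       = ennreal \<bar>1\<bar> * (\<integral>\<^sup>+u. indicator {X b..<X b + w} (X b + 1 * u) * indicator G (X b + 1 * u) \<partial>lborel)"
      by (rule nn_integral_real_affine) auto
    also have "\<dots> = (\<integral>\<^sup>+u. indicator {0..<w} u * indicator G (X b + u) \<partial>lborel)"
      by (auto intro!: nn_integral_cong simp: indicator_def)
    finally show "(\<integral>\<^sup>+u. indicator {0..<w} u * indicator G (X b + u) \<partial>lborel)
      = (\<integral>\<^sup>+y. indicator {X b..<X b + w} y * indicator G y \<partial>lborel)" by simp
  qed
  also have "\<dots> = (\<integral>\<^sup>+y. (\<Sum>b<q * J. indicator {X b..<X b + w} y * indicator G y) \<partial>lborel)"
    by (rule nn_integral_sum[symmetric]) measurable
  also have "\<dots> \<le> (\<integral>\<^sup>+y. indicator (?A \<inter> G) y \<partial>lborel)"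
    unfolding sum_distrib_right[symmetric] indicator_inter_arith
    by (intro nn_integral_mono mult_right_mono once) simp
  also have "\<dots> = emeasure lborel (?A \<inter> G)" by simp
  also have "\<dots> = ennreal (measure lborel (?A \<inter> G))"
  proof (rule emeasure_eq_measure2)
    have "?A \<inter> G \<in> fmeasurable lborel" by (rule fmeasurable_Int_fmeasurable[OF near_rationals_fmeasurable]) simp
    then show "?A \<inter> G \<in> fmeasurable lborel" .
  qed
  finally have "ennreal (real J * c) * ennreal w \<le> ennreal (measure lborel (?A \<inter> G))" .
  then have "ennreal (real J * c * w) \<le> ennreal (measure lborel (?A \<inter> G))"
    by (simp only: ennreal_mult''[OF w(1)])
  then show ?thesis by (simp only: ennreal_le_iff[OF measure_nonneg])
qed

section \<open>The focusing set\<close>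

lemma evolution1_measurable:
  assumes [measurable]: "fourier1 g \<in> borel_measurable borel"
  shows "evolution1 k t g \<in> borel_measurable borel"
proof -
  have "(\<lambda>x. LINT \<xi>|lborel. fourier1 g \<xi> * cis (\<xi> * x + \<xi> ^ k * t)) \<in> borel_measurable borel"
    by (rule lborel.borel_measurable_lebesgue_integral) measurable
  then show ?thesis unfolding evolution1_def[abs_def] by measurable
qed

text \<open>The parameters of the example. The first coordinate has bandwidth \<open>S\<close>, the others carry \<open>N\<close>
frequencies at distance \<open>L\<close>, and the denominators are the primes in \<open>\<Q>\<close>, all within a factor \<open>M\<^sup>2\<close>
below \<open>Q\<close>. The assumption \<open>resolution\<close> says that within the width \<open>1 / S\<close> of the packet of the
first coordinate there is an admissible time for each denominator; \<open>small\<close> makes the errors in the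
other coordinates negligible.\<close>
locale focusing =
  fixes k N :: nat and L S M Q :: real and \<Q> :: "nat set"
  assumes k: "2 \<le> k" and M: "2 \<le> M" and L: "4 * pi * M \<le> L" and N: "1 \<le> N"
    and S: "2 * M \<le> S" "S\<^sup>2 \<le> L * N"
    and finite_\<Q>: "finite \<Q>"
    and \<Q>: "\<And>q. q \<in> \<Q> \<Longrightarrow> prime q" "\<And>q. q \<in> \<Q> \<Longrightarrow> k < q"
      "\<And>q. q \<in> \<Q> \<Longrightarrow> real q \<le> Q" "\<And>q. q \<in> \<Q> \<Longrightarrow> Q \<le> M\<^sup>2 * real q"
    and Q0: "0 < Q" and Q: "Q * M \<le> N" "N \<le> Q\<^sup>2"
    and resolution: "\<And>q. q \<in> \<Q> \<Longrightarrow> S * (2 * pi * k * (L * N) ^ (k - 1) / (q * L ^ k)) \<le> 1 / 2"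
    and moment: "8 * gauss_moment k \<le> M"
    and small: "256 * real k ^ 2 * (2 * (2 * pi / M + 2 / M * gauss_moment k) + 2 / M) \<le> 1"
begin

definition "R = L * N"
text \<open>The distance that the packet of the first coordinate travels between consecutive times
\<open>time q a\<close>.\<close>
definition "\<tau> q = 2 * pi * k * R ^ (k - 1) / (real q * L ^ k)" for q :: nat
definition "time q a = 2 * pi * real_of_int a / (real q * L ^ k)" for q :: nat and a :: int
text \<open>A numerator prime to \<open>q\<close> for which the packet is within \<open>\<tau> q\<close> of the point \<open>x\<close> at \<open>time q a\<close>: one of
two consecutive integers is not a multiple of \<open>q\<close>.\<close>
definition "numerator q x = (let m = \<lfloor>- x / \<tau> q\<rfloor> in if int q dvd m then m + 1 else m)"
definition "base = {- 1 / M..- 1 / (2 * M)}"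
definition "width = 2 * pi / (L * N * M)"
definition "periods = nat \<lfloor>L / (2 * pi * M)\<rfloor>"
definition "level = N / (8 * sqrt Q)"
definition "near q = near_rationals q (q * periods) L width"
definition "large_set q a = near q \<inter> {y. level \<le> norm (evolution1 k (time q a) (packet_sum N L) y)}"

lemma L0: "0 < L" "1 \<le> L"
proof -
  have "4 * 3 * 2 \<le> 4 * pi * M" using M pi_gt3 by (intro mult_mono) auto
  then show "0 < L" "1 \<le> L" using L by linarith+
qed

lemma R1: "1 \<le> R" "S \<le> R" "0 < S"
proof -
  show S0: "0 < S" using S M by linarith
  show "1 \<le> R" using L0 N mult_mono[of 1 L 1 "real N"] by (simp add: R_def)
  have "S * 1 \<le> S * S" using S M by (intro mult_left_mono) auto
  then show "S \<le> R" using S by (simp add: R_def power2_eq_square)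
qed

lemma q_pos: "q \<in> \<Q> \<Longrightarrow> 0 < q" using \<Q>(2) by fastforce

lemma \<tau>_bounds:
  assumes "q \<in> \<Q>" shows "0 < \<tau> q" "S * \<tau> q \<le> 1 / 2" "\<tau> q \<le> 1 / (4 * M)"
proof -
  show t0: "0 < \<tau> q" using q_pos[OF assms] L0 R1 k by (simp add: \<tau>_def)
  show st: "S * \<tau> q \<le> 1 / 2" using resolution[OF assms] by (simp add: \<tau>_def R_def)
  have "2 * M * \<tau> q \<le> S * \<tau> q" using S t0 by (intro mult_right_mono) auto
  then have "2 * M * \<tau> q \<le> 1 / 2" using st by linarith
  then show "\<tau> q \<le> 1 / (4 * M)" using M by (simp add: field_simps)
qed

lemma time_eq: "q \<in> \<Q> \<Longrightarrow> k * R ^ (k - 1) * time q a = a * \<tau> q"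
  by (simp add: time_def \<tau>_def)

lemma numerator:
  assumes q: "q \<in> \<Q>" and x: "x \<in> base"
  defines "a \<equiv> numerator q x"
  shows "\<not> int q dvd a" "0 < time q a" "time q a < 1" "time q a * R ^ (k - 1) \<le> 2 / M"
    "\<bar>x + k * R ^ (k - 1) * time q a\<bar> \<le> \<tau> q" "0 < a" "real_of_int a \<le> 2 / \<tau> q"
proof -
  note t = \<tau>_bounds[OF q]
  define m where "m = \<lfloor>- x / \<tau> q\<rfloor>"
  have q1: "1 < q" using \<Q>(1)[OF q] prime_gt_1_nat by blast
  have "\<not> (int q dvd m \<and> int q dvd m + 1)"
  proof
    assume "int q dvd m \<and> int q dvd m + 1"
    then have "int q dvd (m + 1) - m" using dvd_diff by blast
    then show False using q1 by simp
  qed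
  then show "\<not> int q dvd a" by (auto simp: a_def numerator_def m_def Let_def)
  have am: "a = m \<or> a = m + 1" by (auto simp: a_def numerator_def m_def Let_def)
  have "real_of_int m \<le> - x / \<tau> q" "- x / \<tau> q < real_of_int m + 1" unfolding m_def by linarith+
  then have m: "m * \<tau> q \<le> - x" "- x < m * \<tau> q + \<tau> q"
    using t by (simp_all add: field_simps)
  have ax: "\<bar>x + a * \<tau> q\<bar> \<le> \<tau> q" using am m t by (auto simp: algebra_simps)
  then show "\<bar>x + k * R ^ (k - 1) * time q a\<bar> \<le> \<tau> q" using time_eq[OF q] by simp
  have xb: "1 / (2 * M) \<le> - x" "- x \<le> 1 / M" using x by (auto simp: base_def)
  have M4: "1 / (4 * M) < 1 / (2 * M)" "1 / (4 * M) \<le> 1 / M" "1 / M + 1 / M = 2 / M" using M by (auto simp: field_simps)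
  have a0: "0 < a * \<tau> q" and a2: "a * \<tau> q \<le> 2 / M" using ax xb t M4 by linarith+
  then show "0 < a" using t by (simp add: zero_less_mult_iff)
  show t0: "0 < time q a" using \<open>0 < a\<close> q_pos[OF q] L0 by (simp add: time_def)
  have Rp: "1 \<le> R ^ (k - 1)" using R1 by (intro one_le_power)
  have "2 * (time q a * R ^ (k - 1)) \<le> k * (time q a * R ^ (k - 1))"
    using k t0 Rp by (intro mult_right_mono) auto
  also have "\<dots> \<le> 2 / M" using time_eq[OF q, of a] a2 by (simp add: mult_ac)
  finally have h: "2 * (time q a * R ^ (k - 1)) \<le> 2 / M" .
  moreover have "0 \<le> time q a * R ^ (k - 1)" using t0 Rp by simp
  ultimately show "time q a * R ^ (k - 1) \<le> 2 / M" by linarith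
  have "time q a * 1 \<le> time q a * R ^ (k - 1)" using t0 Rp by (intro mult_left_mono) auto
  moreover have "2 / M \<le> 1" using M by simp
  ultimately show "time q a < 1" using h by linarith
  have "2 / M \<le> 2" using M by (simp add: field_simps)
  then have "a * \<tau> q \<le> 2" using a2 by linarith
  then show "real_of_int a \<le> 2 / \<tau> q" using t by (simp add: field_simps)
qed

lemma first_factor:
  assumes "q \<in> \<Q>" "x \<in> base"
  shows "1 / 2 \<le> norm (evolution1 k (time q (numerator q x)) (packet S R) x)"
proof -
  note n = numerator[OF assms]
  define t where "t = time q (numerator q x)"
  have "\<bar>S * (x + k * R ^ (k - 1) * t)\<bar> \<le> S * \<tau> q"
    using n(5) R1(3) by (simp add: abs_mult t_def)
  also have "\<dots> \<le> 1 / 2" by (rule \<tau>_bounds[OF assms(1)])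
  finally have "\<bar>S * (x + k * R ^ (k - 1) * t)\<bar>\<^sup>2 \<le> (1 / 2)\<^sup>2" by (intro power_mono) auto
  then have "(S * (x + k * R ^ (k - 1) * t))\<^sup>2 \<le> 1 / 4" by (simp add: power2_eq_square)
  then have e: "7 / 8 \<le> exp (- (S * (x + k * R ^ (k - 1) * t))\<^sup>2 / 2)"
    using exp_ge_add_one_self[of "- (S * (x + k * R ^ (k - 1) * t))\<^sup>2 / 2"] by linarith
  have "R ^ (k - 1) = R * R ^ (k - 2)" using k by (simp add: Suc_diff_Suc numeral_2_eq_2 flip: power_Suc)
  moreover have "R ^ (k - 2) * S\<^sup>2 \<le> R ^ (k - 2) * R" using S R1 by (intro mult_left_mono) (auto simp: R_def)
  ultimately have "t * (R ^ (k - 2) * S\<^sup>2) \<le> t * R ^ (k - 1)"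
    using n(2) by (intro mult_left_mono) (auto simp: t_def mult_ac)
  also have "\<dots> \<le> 2 / M" using n(4) by (simp add: t_def)
  finally have "t * (R ^ (k - 2) * S\<^sup>2) * gauss_moment k \<le> 2 / M * gauss_moment k"
    by (rule mult_right_mono) (rule gauss_moment_nonneg)
  also have "\<dots> \<le> 1 / 4" using moment M by (simp add: field_simps)
  finally have "t * R ^ (k - 2) * S\<^sup>2 * gauss_moment k \<le> 1 / 4" by (simp add: mult_ac)
  moreover have "exp (- (S * (x + k * R ^ (k - 1) * t))\<^sup>2 / 2) - t * R ^ (k - 2) * S\<^sup>2 * gauss_moment k
     \<le> norm (evolution1 k t (packet S R) x)"
    by (rule packet_evolution_lower) (use k R1 n(2) in \<open>auto simp: t_def\<close>)
  ultimately show ?thesis using e by (simp add: t_def)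
qed

lemma evolution1_packet_sum_measurable [measurable]:
  "evolution1 k t (packet_sum N L) \<in> borel_measurable borel"
  by (rule evolution1_measurable) (use borel_measurable_integrable[OF integrable_fourier1_packet_sum] in simp)

lemma near_fmeasurable: "near q \<in> fmeasurable lborel"
  unfolding near_def by (rule near_rationals_fmeasurable)

lemma large_set_fmeasurable: "large_set q a \<in> fmeasurable lborel"
  unfolding large_set_def by (rule fmeasurable_Int_fmeasurable[OF near_fmeasurable]) measurable

lemma periods: "L / (4 * pi * M) \<le> periods" "periods \<le> L / (2 * pi * M)"
proof -
  have "2 \<le> L / (2 * pi * M)" using L M by (simp add: field_simps)
  then have p: "real periods = real_of_int \<lfloor>L / (2 * pi * M)\<rfloor>" unfolding periods_def by simp
  show "periods \<le> L / (2 * pi * M)" unfolding p by linarith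
  have "L / (2 * pi * M) = 2 * (L / (4 * pi * M))" by simp
  then show "L / (4 * pi * M) \<le> periods" unfolding p using \<open>2 \<le> L / (2 * pi * M)\<close> by linarith
qed

lemma q_le: "q \<in> \<Q> \<Longrightarrow> real q * M \<le> N"
  using \<Q>(3)[of q] Q(1) M mult_right_mono[of "real q" Q M] by linarith

lemma width0: "0 < width" using L0 N M by (simp add: width_def)

lemma near_range:
  assumes q: "q \<in> \<Q>" and "b < q * periods" "0 \<le> u" "u < width"
  shows "2 * pi * real b / (real q * L) + u \<le> 1 / M"
proof -
  have "real (b + 1) \<le> real (q * periods)" using assms(2) by (intro of_nat_mono) simp
  then have b1: "real b + 1 \<le> real q * real periods" by simp
  have "real q * 2 \<le> N * M"
  proof -
    have "real q * 2 \<le> real q * M" using M by (intro mult_left_mono) auto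
    also have "\<dots> \<le> N" by (rule q_le[OF q])
    also have "real N * 1 \<le> N * M" using M by (intro mult_left_mono) auto
    finally show ?thesis by simp
  qed
  then have "width \<le> 2 * pi / (real q * L)"
    using q_pos[OF q] L0 N M unfolding width_def by (intro divide_left_mono) (auto simp: mult_ac)
  then have "2 * pi * real b / (real q * L) + u \<le> 2 * pi * (real b + 1) / (real q * L)"
    using assms(4) by (simp add: distrib_left add_divide_distrib)
  also have "\<dots> \<le> 2 * pi * (real q * real periods) / (real q * L)"
    using b1 L0 by (intro divide_right_mono mult_left_mono) auto
  also have "\<dots> = 2 * pi * real periods / L" using q_pos[OF q] by simp
  also have "\<dots> \<le> 2 * pi * (L / (2 * pi * M)) / L"
    using periods(2) L0 by (intro divide_right_mono mult_left_mono) auto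
  also have "\<dots> = 1 / M" using L0 by simp
  finally show ?thesis .
qed

lemma near_subset: "q \<in> \<Q> \<Longrightarrow> near q \<subseteq> {0..1 / M}"
proof
  fix y assume q: "q \<in> \<Q>" and "y \<in> near q"
  then obtain b where b: "b < q * periods" "2 * pi * real b / (real q * L) \<le> y" "y < 2 * pi * real b / (real q * L) + width"
    by (auto simp: near_def near_rationals_def)
  have "0 \<le> 2 * pi * real b / (real q * L)" using L0 by simp
  then show "y \<in> {0..1 / M}"
    using b near_range[OF q b(1), of "y - 2 * pi * real b / (real q * L)"] by auto
qed

lemma quotient_bounds:
  assumes q: "q \<in> \<Q>"
  shows "N / (2 * real q) \<le> real (N div q)" "M / 2 \<le> real (N div q)"
proof -
  have q0: "real q > 0" using q_pos[OF q] by simp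
  have "M \<le> N / q" using q_le[OF q] q0 by (simp add: field_simps)
  moreover have "real N / real q \<le> real (N div q) + 1"
  proof -
    have "N < q * (N div q + 1)" using q_pos[OF q] dividend_less_times_div by simp
    then have "real N \<le> real q * (real (N div q) + 1)" by (metis less_imp_le of_nat_1 of_nat_add of_nat_mono of_nat_mult)
    then show ?thesis using q0 by (simp add: field_simps)
  qed
  moreover have "N / (2 * real q) = (N / q) / 2" by simp
  ultimately show "N / (2 * real q) \<le> real (N div q)" "M / 2 \<le> real (N div q)" using M by linarith+
qed

text \<open>The constant is the number of periods, times the number \<open>q / (16 * k\<^sup>2)\<close> of good fractions in a
period, times the width of an interval; the powers of \<open>M\<close> absorb \<open>q \<ge> Q / M\<^sup>2\<close> and the restriction to \<open>[0, 1 / M]\<close>.\<close>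
lemma measure_large_set:
  assumes q: "q \<in> \<Q>" and a: "\<not> int q dvd a" "0 < time q a" "time q a * R ^ (k - 1) \<le> 2 / M"
  shows "Q / (32 * real k ^ 2 * N * M ^ 4) \<le> measure lborel (large_set q a)"
proof -
  have q0: "real q > 0" using q_pos[OF q] by simp
  note J = quotient_bounds[OF q]
  define c where "c = real q / (16 * real k ^ 2)"
  have "real periods * c * width \<le> measure lborel (near_rationals q (q * periods) L width
     \<inter> {y. level \<le> norm (evolution1 k (time q a) (packet_sum N L) y)})"
  proof (rule near_rationals_density)
    show "width * (real q * L) \<le> 2 * pi"
    proof -
      have "width * (real q * L) = 2 * pi * (real q / (N * M))" using L0 by (simp add: width_def)
      also have "real q \<le> N * M"
        using q_le[OF q] M q0 N mult_mono[of 1 M 1 M] by (smt (verit, best) mult_le_cancel_left1 mult_right_mono of_nat_0_le_iff)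
      then have "real q / (N * M) \<le> 1" using N M by simp
      then have "2 * pi * (real q / (N * M)) \<le> 2 * pi * 1" by (intro mult_left_mono) auto
      finally show ?thesis by simp
    qed
    fix u :: real and j :: nat assume u: "0 \<le> u" "u < width" and j: "j < periods"
    define \<beta> where "\<beta> = u * L / (2 * pi)"
    have \<beta>0: "0 \<le> \<beta>" using u L0 by (simp add: \<beta>_def)
    have "u * L \<le> width * L" using u L0 by (intro mult_right_mono) auto
    then have "2 * pi * N * \<beta> \<le> 2 * pi / M"
      using L0 N M by (simp add: \<beta>_def width_def field_simps)
    then have e: "2 * pi * N * \<beta> + time q a * (L * N) ^ (k - 1) * gauss_moment k \<le> 2 * pi / M + 2 / M * gauss_moment k"
      using a(3) by (intro add_mono mult_right_mono gauss_moment_nonneg) (auto simp: R_def)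
    have J1: "1 \<le> N div q" using J(2) M by (simp add: Suc_le_eq flip: of_nat_0_less_iff)
    have le2: "1 / real (N div q) \<le> 2 / M" using J(2) M J1 by (simp add: field_simps)
    have "2 * (2 * pi * N * \<beta> + time q a * (L * N) ^ (k - 1) * gauss_moment k) + 1 / real (N div q)
       \<le> 2 * (2 * pi / M + 2 / M * gauss_moment k) + 2 / M"
      by (rule add_mono[OF mult_left_mono[OF e] le2]) simp
    then have "256 * real k ^ 2 * (2 * (2 * pi * N * \<beta> + time q a * (L * N) ^ (k - 1) * gauss_moment k) + 1 / real (N div q))
       \<le> 256 * real k ^ 2 * (2 * (2 * pi / M + 2 / M * gauss_moment k) + 2 / M)"
      by (rule mult_left_mono) simp
    then have sm: "256 * real k ^ 2 * (2 * (2 * pi * N * \<beta> + time q a * (L * N) ^ (k - 1) * gauss_moment k) + 1 / real (N div q)) \<le> 1"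
      using small by linarith
    have X: "2 * pi * (real b / real q + \<beta>) / L = 2 * pi * real b / (real q * L) + u" for b :: nat
      using L0 by (simp add: \<beta>_def field_simps)
    have range: "2 * pi * (real b / real q + \<beta>) / L \<le> 1" if "b \<in> {q * j..<q * j + q}" for b
    proof -
      have "b < q * Suc j" using that by simp
      also have "\<dots> \<le> q * periods" using j by (intro mult_left_mono) auto
      finally show ?thesis using near_range[OF q _ u] X M by (smt (verit) divide_le_eq_1_pos)
    qed
    have "real q \<le> 16 * real k ^ 2 * card {b\<in>{q * j..<q * j + q}.
       real (N div q) * sqrt q / 4 \<le> norm (evolution1 k (time q a) (packet_sum N L) (2 * pi * (real b / real q + \<beta>) / L))}"
    proof (rule count_large_evolution)
      show "L ^ k * time q a = 2 * pi * real_of_int a / real q" using L0 by (simp add: time_def)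
    qed (use \<Q>[OF q] a k L0 R1 \<beta>0 J1 sm range in \<open>auto simp: R_def\<close>)
    also have "\<dots> \<le> 16 * real k ^ 2 * card {b\<in>{q * j..<q * j + q}.
       2 * pi * real b / (real q * L) + u \<in> {y. level \<le> norm (evolution1 k (time q a) (packet_sum N L) y)}}"
    proof -
      have "level \<le> N / (8 * sqrt q)"
        unfolding level_def using Q0 \<Q>(3)[OF q] q0 by (intro divide_left_mono) auto
      also have "\<dots> = N / (2 * real q) * sqrt q / 4"
        using q0 by (simp add: real_div_sqrt field_simps)
      also have "\<dots> \<le> real (N div q) * sqrt q / 4"
        using J(1) by (intro divide_right_mono mult_right_mono) auto
      finally have "level \<le> real (N div q) * sqrt q / 4" .
      then show ?thesis unfolding X
        by (intro mult_left_mono of_nat_mono card_mono) auto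
    qed
    finally show "c \<le> real (card {b\<in>{q * j..<q * j + q}.
       2 * pi * real b / (real q * L) + u \<in> {y. level \<le> norm (evolution1 k (time q a) (packet_sum N L) y)}})"
      using k by (simp add: c_def field_simps)
  qed (use q_pos[OF q] L0 width0 in auto)
  also have "\<dots> = measure lborel (large_set q a)" by (simp add: large_set_def near_def)
  finally have *: "real periods * c * width \<le> measure lborel (large_set q a)" .
  have "L / (4 * pi * M) * width = 1 / (2 * N * M\<^sup>2)"
    using L0 N M by (simp add: width_def power2_eq_square)
  then have p: "1 / (2 * N * M\<^sup>2) \<le> real periods * width"
    using mult_right_mono[OF periods(1), of width] width0 by simp
  have "Q / (32 * real k ^ 2 * N * M ^ 4) \<le> M\<^sup>2 * real q / (32 * real k ^ 2 * N * M ^ 4)"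
    using \<Q>(4)[OF q] M by (intro divide_right_mono) auto
  also have "\<dots> = 1 / (2 * N * M\<^sup>2) * c"
    using M by (simp add: c_def power2_eq_square power4_eq_xxxx)
  also have "\<dots> \<le> real periods * width * c" by (intro mult_right_mono p) (simp add: c_def)
  finally show ?thesis using * by (simp add: mult_ac)
qed

text \<open>The assumption \<open>N \<le> Q\<^sup>2\<close> makes the expected number of coincidences dominate the single one that
always occurs, at zero.\<close>
lemma measure_near_overlap:
  assumes "q \<in> \<Q>" "q' \<in> \<Q>" "q \<noteq> q'"
  shows "measure lborel (near q \<inter> near q') \<le> (Q / N)\<^sup>2"
proof -
  have "measure lborel (near q \<inter> near q') \<le> real periods * (real q * real q' * L * width / pi + 1) * width"
    unfolding near_def using assms \<Q> L0 width0 by (intro near_rationals_overlap) auto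
  also have "\<dots> \<le> real periods * (2 * (Q\<^sup>2 / N)) * width"
  proof (intro mult_left_mono mult_right_mono)
    have "real q * real q' \<le> Q\<^sup>2" unfolding power2_eq_square using assms \<Q>(3) Q0 by (intro mult_mono) auto
    then have "real q * real q' * (2 / M) \<le> Q\<^sup>2 * 1" using M by (intro mult_mono) auto
    then have "real q * real q' * L * width / pi \<le> Q\<^sup>2 / N"
      using L0 N M by (simp add: width_def field_simps)
    moreover have "1 \<le> Q\<^sup>2 / N" using Q N by simp
    ultimately show "real q * real q' * L * width / pi + 1 \<le> 2 * (Q\<^sup>2 / N)" by linarith
  qed (use width0 in auto)
  also have "\<dots> = (2 * (Q\<^sup>2 / N)) * (real periods * width)" by simp
  also have "\<dots> \<le> (2 * (Q\<^sup>2 / N)) * (L / (2 * pi * M) * width)"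
    using periods(2) width0 by (intro mult_left_mono mult_right_mono) auto
  also have "L / (2 * pi * M) * width = 1 / (N * M\<^sup>2)"
    using L0 N M by (simp add: width_def power2_eq_square)
  also have "(2 * (Q\<^sup>2 / N)) * (1 / (N * M\<^sup>2)) = (Q / N)\<^sup>2 * (2 / M\<^sup>2)"
    by (simp add: power2_eq_square mult_ac)
  also have "\<dots> \<le> (Q / N)\<^sup>2 * 1"
  proof (intro mult_left_mono)
    have "2 * 2 \<le> M * M" using M by (intro mult_mono) auto
    then show "2 / M\<^sup>2 \<le> 1" using M by (simp add: power2_eq_square field_simps)
  qed auto
  finally show ?thesis by simp
qed

end

section \<open>The extremizer and its Sobolev norm\<close>

lemma packet_schwartz1:
  assumes "S > 0"
  shows "packet S \<omega> \<in> schwartz1"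
proof -
  have "packet S \<omega> = (\<lambda>x. 1 * cis (\<omega> * x) * of_real (x ^ 0 * exp (- (S\<^sup>2 / 2) * x\<^sup>2) * logistic 0 0 x ^ 0 * logistic 0 0 x ^ 0))"
    by (rule ext) (simp add: packet_def power_mult_distrib)
  also have "\<dots> \<in> schwartz1" by (rule test_fns_schwartz1[OF test_fns.atom]) (use assms in simp)
  finally show ?thesis .
qed

lemma packet_sum_schwartz1: "packet_sum N L \<in> schwartz1"
proof -
  have atom: "(\<lambda>x. a * packet 1 \<omega> x) \<in> test_fns (1 / 2) 0 0 0 0" for a \<omega>
  proof -
    have "(\<lambda>x. a * packet 1 \<omega> x) = (\<lambda>x. a * cis (\<omega> * x) * of_real (x ^ 0 * exp (- (1 / 2) * x\<^sup>2) * logistic 0 0 x ^ 0 * logistic 0 0 x ^ 0))"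
      by (rule ext) (simp add: packet_def)
    then show ?thesis by (simp only: test_fns.atom)
  qed
  have "packet_sum N L \<in> test_fns (1 / 2) 0 0 0 0"
  proof (induction N)
    case 0
    then show ?case using atom[of 0 0] by (simp add: packet_sum_def[abs_def])
  next
    case (Suc N)
    have "packet_sum (Suc N) L = (\<lambda>x. packet_sum N L x + 1 * packet 1 (L * real N) x)"
      by (rule ext) (simp add: packet_sum_def)
    then show ?case using test_fns.add[OF Suc atom[of 1 "L * real N"]] by simp
  qed
  then show ?thesis by (rule test_fns_schwartz1) simp
qed

text \<open>The power of \<open>v = (1 + \<bar>\<xi>\<bar>\<^sup>2) / R\<^sup>2\<close> is at most \<open>1 + v\<close> because the exponent \<open>s'\<close> lies between zero and one.\<close>
lemma sobolev_weight_bound: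
  fixes \<xi> :: "real^'n::finite" and R s s' :: real
  assumes "1 \<le> R" "0 \<le> s'" "s' \<le> 1" "s \<le> s'"
  shows "(1 + (norm \<xi>)\<^sup>2) powr s \<le> 2 * R powr (2 * s') * (\<Prod>i\<in>UNIV. 1 + (\<xi> $ i)\<^sup>2 / R\<^sup>2)"
proof -
  define w where "w = 1 + (norm \<xi>)\<^sup>2"
  define v where "v = w / R\<^sup>2"
  have w: "1 \<le> w" by (simp add: w_def)
  have v: "0 < v" using w assms by (simp add: v_def)
  have "v powr s' \<le> 1 + v"
  proof (cases "v \<le> 1")
    case True
    then have "v powr s' \<le> 1" using v assms by (intro powr_le1) auto
    then show ?thesis using v by linarith
  next
    case False
    then have "v powr s' \<le> v powr 1" using assms by (intro powr_mono) auto
    then show ?thesis using v by simp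
  qed
  have "w powr s \<le> w powr s'" using w assms by (intro powr_mono) auto
  also have "w powr s' = (R\<^sup>2 * v) powr s'" using assms by (simp add: v_def)
  also have "\<dots> = R powr (2 * s') * v powr s'"
    using assms v by (simp add: powr_mult powr_powr flip: powr_numeral)
  also have "\<dots> \<le> R powr (2 * s') * (1 + v)" using \<open>v powr s' \<le> 1 + v\<close> by (intro mult_left_mono) auto
  also have "1 + v \<le> 2 * (1 + (norm \<xi>)\<^sup>2 / R\<^sup>2)"
  proof -
    have 1: "1 / R\<^sup>2 \<le> 1" using assms one_le_power[of R 2] by simp
    have 2: "v = 1 / R\<^sup>2 + (norm \<xi>)\<^sup>2 / R\<^sup>2" by (simp add: v_def w_def add_divide_distrib)
    have "1 + (z + y) \<le> 2 * (1 + y)" if "z \<le> 1" "0 \<le> y" for z y :: real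
      using that by (simp add: algebra_simps)
    from this[OF 1, of "(norm \<xi>)\<^sup>2 / R\<^sup>2"] show ?thesis unfolding 2 by simp
  qed
  also have "(norm \<xi>)\<^sup>2 / R\<^sup>2 = (\<Sum>i\<in>UNIV. (\<xi> $ i)\<^sup>2 / R\<^sup>2)"
    by (simp add: norm_vec_def L2_set_def sum_nonneg sum_divide_distrib)
  also have "1 + (\<Sum>i\<in>UNIV. (\<xi> $ i)\<^sup>2 / R\<^sup>2) \<le> (\<Prod>i\<in>UNIV. 1 + (\<xi> $ i)\<^sup>2 / R\<^sup>2)"
    by (rule one_plus_sum_le_prod) simp
  finally show ?thesis using assms by (simp add: w_def mult_left_mono mult_ac)
qed

lemma
  fixes F :: "'n::finite \<Rightarrow> real \<Rightarrow> complex" and R s s' :: real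
  assumes R: "1 \<le> R" "0 \<le> s'" "s' \<le> 1" "s \<le> s'"
    and [measurable]: "\<And>i. F i \<in> borel_measurable borel"
    and int: "\<And>i. integrable lborel (\<lambda>\<xi>. (1 + \<xi>\<^sup>2 / R\<^sup>2) * (norm (F i \<xi>))\<^sup>2)"
    and W: "\<And>i. (LINT \<xi>|lborel. (1 + \<xi>\<^sup>2 / R\<^sup>2) * (norm (F i \<xi>))\<^sup>2) \<le> W i"
  shows integrable_sobolev_prod: "integrable lborel (\<lambda>\<xi>::real^'n. (1 + (norm \<xi>)\<^sup>2) powr s * (norm (\<Prod>i\<in>UNIV. F i (\<xi> $ i)))\<^sup>2)"
    and integral_sobolev_prod: "(LINT \<xi>|lborel. (1 + (norm (\<xi>::real^'n))\<^sup>2) powr s * (norm (\<Prod>i\<in>UNIV. F i (\<xi> $ i)))\<^sup>2)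
      \<le> 2 * R powr (2 * s') * (\<Prod>i\<in>UNIV. W i)"
proof -
  define G where "G \<xi> = 2 * R powr (2 * s') * (\<Prod>i\<in>UNIV. (1 + (\<xi> $ i)\<^sup>2 / R\<^sup>2) * (norm (F i (\<xi> $ i)))\<^sup>2)" for \<xi> :: "real^'n"
  have le: "(1 + (norm \<xi>)\<^sup>2) powr s * (norm (\<Prod>i\<in>UNIV. F i (\<xi> $ i)))\<^sup>2 \<le> G \<xi>" for \<xi> :: "real^'n"
  proof -
    have "(1 + (norm \<xi>)\<^sup>2) powr s * (norm (\<Prod>i\<in>UNIV. F i (\<xi> $ i)))\<^sup>2
      \<le> (2 * R powr (2 * s') * (\<Prod>i\<in>UNIV. 1 + (\<xi> $ i)\<^sup>2 / R\<^sup>2)) * (norm (\<Prod>i\<in>UNIV. F i (\<xi> $ i)))\<^sup>2"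
      by (intro mult_right_mono sobolev_weight_bound R) auto
    also have "\<dots> = G \<xi>"
      by (simp add: G_def prod.distrib prod_power_distrib mult.assoc flip: prod_norm)
    finally show ?thesis .
  qed
  have GI: "integrable lborel G"
    unfolding G_def
    by (intro integrable_mult_right integrable_vec_prod[where f="\<lambda>i y. (1 + y\<^sup>2 / R\<^sup>2) * (norm (F i y))\<^sup>2"] int)
  show I: "integrable lborel (\<lambda>\<xi>::real^'n. (1 + (norm \<xi>)\<^sup>2) powr s * (norm (\<Prod>i\<in>UNIV. F i (\<xi> $ i)))\<^sup>2)"
  proof (rule Bochner_Integration.integrable_bound[OF GI])
    show "AE \<xi> in lborel. norm ((1 + (norm \<xi>)\<^sup>2) powr s * (norm (\<Prod>i\<in>UNIV. F i (\<xi> $ i)))\<^sup>2) \<le> norm (G \<xi>)"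
    proof (rule AE_I2)
      fix \<xi> :: "real^'n"
      have "0 \<le> (1 + (norm \<xi>)\<^sup>2) powr s * (norm (\<Prod>i\<in>UNIV. F i (\<xi> $ i)))\<^sup>2" by simp
      then show "norm ((1 + (norm \<xi>)\<^sup>2) powr s * (norm (\<Prod>i\<in>UNIV. F i (\<xi> $ i)))\<^sup>2) \<le> norm (G \<xi>)"
        using le[of \<xi>] unfolding real_norm_def by linarith
    qed
  qed measurable
  have "(LINT \<xi>|lborel. (1 + (norm (\<xi>::real^'n))\<^sup>2) powr s * (norm (\<Prod>i\<in>UNIV. F i (\<xi> $ i)))\<^sup>2) \<le> (LINT \<xi>|lborel. G \<xi>)"
    by (rule integral_mono[OF I GI le])
  also have "\<dots> = 2 * R powr (2 * s') * (\<Prod>i\<in>UNIV. (LINT \<xi>|lborel. (1 + \<xi>\<^sup>2 / R\<^sup>2) * (norm (F i \<xi>))\<^sup>2))"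
    unfolding G_def
    by (simp only: integral_mult_right_zero integral_vec_prod[where f="\<lambda>i y. (1 + y\<^sup>2 / R\<^sup>2) * (norm (F i y))\<^sup>2", OF int])
  also have "\<dots> \<le> 2 * R powr (2 * s') * (\<Prod>i\<in>UNIV. W i)"
    by (intro mult_left_mono prod_mono conjI W integral_nonneg_AE) (auto simp: add_nonneg_nonneg)
  finally show "(LINT \<xi>|lborel. (1 + (norm (\<xi>::real^'n))\<^sup>2) powr s * (norm (\<Prod>i\<in>UNIV. F i (\<xi> $ i)))\<^sup>2)
      \<le> 2 * R powr (2 * s') * (\<Prod>i\<in>UNIV. W i)" .
qed

lemma prod_if_eq:
  fixes i0 :: "'n::finite"
  shows "(\<Prod>i\<in>UNIV. if i = i0 then a else b) = (a :: real) * b ^ (CARD('n) - 1)"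
proof -
  have "(\<Prod>i\<in>UNIV. if i = i0 then a else b) = a * (\<Prod>i\<in>UNIV - {i0}. b)"
    by (subst prod.remove[of UNIV i0]) (auto intro!: prod.cong)
  then show ?thesis by simp
qed

context focusing begin

text \<open>The numerator, hence the time, depends on the first coordinate of the point. It takes finitely
many values, so the set is a finite disjoint union of products of one-dimensional sets, its
slabs.\<close>
definition target :: "'n::finite \<Rightarrow> nat \<Rightarrow> (real^'n) set" where
  "target i0 q = {x. x $ i0 \<in> base \<and> (\<forall>i. i \<noteq> i0 \<longrightarrow> x $ i \<in> large_set q (numerator q (x $ i0)))}"

definition slab :: "nat \<Rightarrow> int \<Rightarrow> 'n::finite \<Rightarrow> 'n \<Rightarrow> real set" where
  "slab q a i0 i = (if i = i0 then {x \<in> base. numerator q x = a} else large_set q a)"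

lemma base_fmeasurable: "base \<in> fmeasurable lborel" "measure lborel base = 1 / (2 * M)"
proof -
  have "- 1 / M \<le> - 1 / (2 * M)" using M by (simp add: field_simps)
  then show "base \<in> fmeasurable lborel" "measure lborel base = 1 / (2 * M)"
    using M by (auto simp: base_def field_simps intro!: fmeasurableI)
qed

lemma slab_base_fmeasurable: "{x \<in> base. numerator q x = a} \<in> fmeasurable lborel"
proof -
  have "numerator q = (\<lambda>m. if int q dvd m then m + 1 else m) \<circ> (\<lambda>x. \<lfloor>- x / \<tau> q\<rfloor>)"
    by (rule ext) (simp add: numerator_def Let_def)
  moreover have "(\<lambda>x. \<lfloor>- x / \<tau> q\<rfloor>) \<in> measurable borel (count_space UNIV)" by measurable
  moreover have "(\<lambda>m. if int q dvd m then m + 1 else m) \<in> measurable (count_space UNIV) (count_space UNIV)" by simp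
  ultimately have "numerator q \<in> measurable borel (count_space UNIV)"
    by (simp only: measurable_comp)
  then have "numerator q -` {a} \<inter> space borel \<in> sets borel" by (rule measurable_sets) simp
  then have "base \<inter> numerator q -` {a} \<in> fmeasurable lborel"
    by (intro fmeasurable_Int_fmeasurable[OF base_fmeasurable(1)]) simp
  moreover have "base \<inter> numerator q -` {a} = {x \<in> base. numerator q x = a}" by auto
  ultimately show ?thesis by simp
qed

lemma slab_fmeasurable: "slab q a i0 i \<in> fmeasurable lborel"
  by (simp add: slab_def slab_base_fmeasurable large_set_fmeasurable)

lemma target_eq: "target i0 q = (\<Union>a\<in>numerator q ` base. {x. \<forall>i. x $ i \<in> slab q a i0 i})"
proof (rule subset_antisym; rule subsetI)
  fix x assume "x \<in> target i0 q"
  then show "x \<in> (\<Union>a\<in>numerator q ` base. {x. \<forall>i. x $ i \<in> slab q a i0 i})"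
    by (intro UN_I[of "numerator q (x $ i0)"]) (auto simp: target_def slab_def)
next
  fix x assume "x \<in> (\<Union>a\<in>numerator q ` base. {x. \<forall>i. x $ i \<in> slab q a i0 i})"
  then obtain a where a: "\<And>i. x $ i \<in> slab q a i0 i" by blast
  have "x $ i0 \<in> base" "numerator q (x $ i0) = a" using a[of i0] by (auto simp: slab_def)
  moreover have "x $ i \<in> large_set q a" if "i \<noteq> i0" for i using a[of i] that by (simp add: slab_def)
  ultimately show "x \<in> target i0 q" by (simp add: target_def)
qed

lemma finite_numerators: "q \<in> \<Q> \<Longrightarrow> finite (numerator q ` base)"
proof (rule finite_subset)
  assume q: "q \<in> \<Q>"
  show "numerator q ` base \<subseteq> {0..\<lfloor>2 / \<tau> q\<rfloor>}"
    using numerator(6,7)[OF q] by (auto simp: le_floor_iff less_imp_le)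
qed simp

lemma target_fmeasurable: "q \<in> \<Q> \<Longrightarrow> target i0 q \<in> fmeasurable lborel"
  unfolding target_eq
  by (intro fmeasurable.finite_UN finite_numerators measure_vec_prod(1) slab_fmeasurable)

definition "large_bound = Q / (32 * real k ^ 2 * N * M ^ 4)"

lemma large_bound_nonneg: "0 \<le> large_bound"
  using Q0 M by (simp add: large_bound_def)

lemma measure_target:
  fixes i0 :: "'n::finite"
  assumes q: "q \<in> \<Q>"
  shows "large_bound ^ (CARD('n) - 1) / (2 * M) \<le> measure lborel (target i0 q)"
proof -
  define A where "A = numerator q ` base"
  have fA: "finite A" unfolding A_def by (rule finite_numerators[OF q])
  have "1 / (2 * M) = measure lborel (\<Union>a\<in>A. {x \<in> base. numerator q x = a})"
  proof -
    have "(\<Union>a\<in>A. {x \<in> base. numerator q x = a}) = base" by (auto simp: A_def)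
    then show ?thesis by (simp add: base_fmeasurable)
  qed
  also have "\<dots> = (\<Sum>a\<in>A. measure lborel {x \<in> base. numerator q x = a})"
    using slab_base_fmeasurable by (intro measure_finite_Union fA) (auto simp: disjoint_family_on_def fmeasurable_def less_top[symmetric])
  finally have tot: "1 / (2 * M) = (\<Sum>a\<in>A. measure lborel {x \<in> base. numerator q x = a})" .
  have "large_bound ^ (CARD('n) - 1) / (2 * M) = 1 / (2 * M) * large_bound ^ (CARD('n) - 1)" by simp
  also have "\<dots> = (\<Sum>a\<in>A. measure lborel {x \<in> base. numerator q x = a} * large_bound ^ (CARD('n) - 1))"
    by (simp only: tot sum_distrib_right)
  also have "\<dots> \<le> (\<Sum>a\<in>A. measure lborel {x::real^'n. \<forall>i. x $ i \<in> slab q a i0 i})"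
  proof (rule sum_mono)
    fix a assume "a \<in> A"
    then obtain x where x: "x \<in> base" "a = numerator q x" by (auto simp: A_def)
    note n = numerator[OF q x(1), folded x(2)]
    have lb: "large_bound \<le> measure lborel (large_set q a)"
      unfolding large_bound_def by (rule measure_large_set[OF q n(1) n(2) n(4)])
    have "measure lborel {x \<in> base. numerator q x = a} * large_bound ^ (CARD('n) - 1)
       = (\<Prod>i\<in>UNIV. if i = i0 then measure lborel {x \<in> base. numerator q x = a} else large_bound)"
      by (simp add: prod_if_eq)
    also have "\<dots> \<le> (\<Prod>i\<in>UNIV. measure lborel (slab q a i0 i))"
      using lb large_bound_nonneg by (intro prod_mono) (auto simp: slab_def)
    also have "\<dots> = measure lborel {x::real^'n. \<forall>i. x $ i \<in> slab q a i0 i}"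
      by (rule measure_vec_prod(2)[symmetric]) (rule slab_fmeasurable)
    finally show "measure lborel {x \<in> base. numerator q x = a} * large_bound ^ (CARD('n) - 1)
       \<le> measure lborel {x::real^'n. \<forall>i. x $ i \<in> slab q a i0 i}" .
  qed
  also have "\<dots> = measure lborel (target i0 q)"
  proof -
    have sv: "{x::real^'n. \<forall>i. x $ i \<in> slab q a i0 i} \<in> fmeasurable lborel" for a
      by (rule measure_vec_prod(1)) (rule slab_fmeasurable)
    show ?thesis
    unfolding target_eq A_def[symmetric]
  proof (rule measure_finite_Union[symmetric, OF fA])
    show "disjoint_family_on (\<lambda>a. {x::real^'n. \<forall>i. x $ i \<in> slab q a i0 i}) A"
      by (auto simp: disjoint_family_on_def slab_def)
  qed (use sv in \<open>auto simp: fmeasurable_def less_top[symmetric]\<close>)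
  qed
  finally show ?thesis .
qed

lemma measure_target_overlap:
  fixes i0 :: "'n::finite"
  assumes "q \<in> \<Q>" "q' \<in> \<Q>" "q \<noteq> q'"
  shows "measure lborel (target i0 q \<inter> target i0 q') \<le> ((Q / N)\<^sup>2) ^ (CARD('n) - 1) / (2 * M)"
proof -
  define B where "B i = (if i = i0 then base else near q \<inter> near q')" for i
  have B: "B i \<in> fmeasurable lborel" for i
    by (auto simp: B_def base_fmeasurable near_fmeasurable fmeasurable.Int)
  have "target i0 q \<inter> target i0 q' \<subseteq> {x. \<forall>i. x $ i \<in> B i}"
    by (auto simp: target_def B_def large_set_def)
  then have "measure lborel (target i0 q \<inter> target i0 q') \<le> measure lborel {x::real^'n. \<forall>i. x $ i \<in> B i}"
    using target_fmeasurable[OF assms(1), of i0] target_fmeasurable[OF assms(2), of i0]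
    by (intro measure_mono_fmeasurable measure_vec_prod(1) B) (auto simp: fmeasurable_def)
  also have "\<dots> = (\<Prod>i\<in>UNIV. measure lborel (B i))" by (rule measure_vec_prod(2)[OF B])
  also have "\<dots> \<le> (\<Prod>i\<in>UNIV. if i = i0 then 1 / (2 * M) else (Q / N)\<^sup>2)"
    using measure_near_overlap[OF assms] by (intro prod_mono) (auto simp: B_def base_fmeasurable)
  also have "\<dots> = ((Q / N)\<^sup>2) ^ (CARD('n) - 1) / (2 * M)" by (simp add: prod_if_eq)
  finally show ?thesis .
qed

definition extremizer :: "'n::finite \<Rightarrow> real^'n \<Rightarrow> complex" where
  "extremizer i0 x = (\<Prod>i\<in>UNIV. (if i = i0 then packet S R else packet_sum N L) (x $ i))"

lemma target_evolution:
  fixes i0 :: "'n::finite" and x :: "real^'n"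
  assumes q: "q \<in> \<Q>" and x: "x \<in> target i0 q"
  shows "level ^ (CARD('n) - 1) / 2 \<le> norm (T_schwartz k (time q (numerator q (x $ i0))) (extremizer i0) x)"
proof -
  define t where "t = time q (numerator q (x $ i0))"
  define f where "f i = (if i = i0 then packet S R else packet_sum N L)" for i
  have xb: "x $ i0 \<in> base" and xl: "\<And>i. i \<noteq> i0 \<Longrightarrow> x $ i \<in> large_set q (numerator q (x $ i0))"
    using x by (auto simp: target_def)
  have "T_schwartz k t (extremizer i0) x = (\<Prod>i\<in>UNIV. evolution1 k t (f i) (x $ i))"
    unfolding extremizer_def[abs_def] f_def[symmetric]
    by (rule T_schwartz_vec_prod)
      (auto simp: f_def R1 integrable_packet integrable_fourier1_packet integrable_packet_sum integrable_fourier1_packet_sum)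
  then have "norm (T_schwartz k t (extremizer i0) x) = (\<Prod>i\<in>UNIV. norm (evolution1 k t (f i) (x $ i)))"
    by (simp add: prod_norm)
  moreover have "(\<Prod>i\<in>UNIV. if i = i0 then 1 / 2 else level) \<le> (\<Prod>i\<in>UNIV. norm (evolution1 k t (f i) (x $ i)))"
  proof (intro prod_mono conjI)
    fix i
    show "0 \<le> (if i = i0 then 1 / 2 else level)" using Q0 by (simp add: level_def)
    show "(if i = i0 then 1 / 2 else level) \<le> norm (evolution1 k t (f i) (x $ i))"
      using first_factor[OF q xb] xl[of i] by (auto simp: f_def t_def large_set_def)
  qed
  ultimately show ?thesis by (simp add: prod_if_eq t_def)
qed

lemma target_subset_ball:
  fixes i0 :: "'n::finite"
  assumes "q \<in> \<Q>" "real CARD('n) < M"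
  shows "target i0 q \<subseteq> ball (0 :: real^'n) 1"
proof
  fix x :: "real^'n" assume x: "x \<in> target i0 q"
  have "\<bar>x $ i\<bar> \<le> 1 / M" for i
  proof (cases "i = i0")
    case True
    then have "x $ i \<in> base" using x by (simp add: target_def)
    moreover have "- 1 / (2 * M) \<le> 0" using M by simp
    ultimately show ?thesis unfolding base_def by auto
  next
    case False
    then have "x $ i \<in> near q" using x by (auto simp: target_def large_set_def)
    then show ?thesis using near_subset[OF assms(1)] by auto
  qed
  then have "norm x \<le> (\<Sum>i\<in>(UNIV::'n set). 1 / M)"
    by (intro order_trans[OF norm_le_l1_cart] sum_mono)
  also have "\<dots> < 1" using assms(2) M by simp
  finally show "x \<in> ball 0 1" by simp
qed

text \<open>The maximal inequality for \<open>extremizer\<close>, with the union of the targets on the left. The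
assumption \<open>sparse\<close> limits the number of denominators so that the overlaps take away at most half of
the measure.\<close>
lemma maximal_inequality_consequence:
  fixes s s' C :: real
  assumes hyp: "\<forall>f \<in> (sobolev_space s :: 'n::finite distribution set).
           \<exists>u. is_T_of s k f u \<and>
               (\<integral>\<^sup>+x\<in>ball 0 1. (SUP t\<in>{0<..<1}. ennreal (norm (u t x))) \<partial>lborel)
                 \<le> ennreal (C * sobolev_norm s f)"
    and s': "0 \<le> s'" "s' \<le> 1" "s \<le> s'"
    and n: "real CARD('n) < M" and L2: "8 * real N \<le> L\<^sup>2"
    and sparse: "real (card \<Q>) * ((Q / N)\<^sup>2) ^ (CARD('n) - 1) \<le> large_bound ^ (CARD('n) - 1) / 2"
  shows "level ^ (CARD('n) - 1) / 2 * (real (card \<Q>) * (large_bound ^ (CARD('n) - 1) / (4 * M)))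
    \<le> \<bar>C\<bar> * sqrt (2 * (L * N) powr (2 * s') * (packet_const / S * (4 * packet_const * N) ^ (CARD('n) - 1)))"
proof -
  obtain i0 :: 'n where "i0 \<in> UNIV" by blast
  define f where "f i = (if i = i0 then packet S R else packet_sum N L)" for i
  have fi: "integrable lborel (f i)" and ffi: "integrable lborel (fourier1 (f i))" for i
    by (auto simp: f_def R1 integrable_packet integrable_fourier1_packet integrable_packet_sum integrable_fourier1_packet_sum)
  have extremizer_eq: "extremizer i0 = (\<lambda>x. \<Prod>i\<in>UNIV. f i (x $ i))"
    by (rule ext) (simp add: extremizer_def f_def)
  have four: "fourier (extremizer i0) = (\<lambda>\<xi>. \<Prod>i\<in>UNIV. fourier1 (f i) (\<xi> $ i))"
    unfolding extremizer_eq by (rule ext) (rule fourier_vec_prod[OF fi])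
  have "sqrt 2 \<le> 4 * pi * M"
  proof -
    have "sqrt 2 \<le> 2" by (intro real_le_lsqrt) auto
    moreover have "4 * 3 * 2 \<le> 4 * pi * M" using M pi_gt3 by (intro mult_mono) auto
    ultimately show ?thesis by linarith
  qed
  also have "\<dots> \<le> L * 1" using L by simp
  also have "\<dots> \<le> R" unfolding R_def using L0 N by (intro mult_left_mono) auto
  finally have R2: "sqrt 2 \<le> R" .
  define W where "W i = (if i = i0 then packet_const / S else 4 * packet_const * N)" for i
  have sob: "integrable lborel (\<lambda>\<xi>. (1 + \<xi>\<^sup>2 / R\<^sup>2) * (norm (fourier1 (f i) \<xi>))\<^sup>2)"
    "(LINT \<xi>|lborel. (1 + \<xi>\<^sup>2 / R\<^sup>2) * (norm (fourier1 (f i) \<xi>))\<^sup>2) \<le> W i" for i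
    using integrable_weighted_packet[OF R1(3,2)] integral_weighted_packet[OF R1(3,2)]
      integrable_weighted_packet_sum[of L N R] integral_weighted_packet_sum[of L N R] R2 L0 L2
    by (auto simp: f_def W_def R_def)
  have ffm: "fourier1 (f i) \<in> borel_measurable borel" for i
    using borel_measurable_integrable[OF ffi[of i]] by simp
  note SI = integrable_sobolev_prod[OF R1(1) s' ffm sob] and SB = integral_sobolev_prod[OF R1(1) s' ffm sob]
  define \<Omega> where "\<Omega> = (\<Union>q\<in>\<Q>. target i0 q)"
  define \<Theta> where "\<Theta> = (\<lambda>(q, a). time q a) ` (\<Q> \<times> UNIV) \<inter> {0<..<1}"
  have level0: "0 \<le> level ^ (CARD('n) - 1) / 2" using Q0 by (simp add: level_def)
  have main: "level ^ (CARD('n) - 1) / 2 * measure lborel \<Omega> \<le> \<bar>C\<bar> * sqrt (1 / (2 * pi) ^ CARD('n) *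
     (LINT \<xi>|lborel. (1 + (norm \<xi>)\<^sup>2) powr s * (norm (fourier (extremizer i0) \<xi>))\<^sup>2))"
  proof (rule schwartz_maximal_lower_bound[OF hyp, where \<Theta>=\<Theta>])
    show "extremizer i0 \<in> schwartz"
      unfolding extremizer_eq by (rule schwartz_vec_prod) (auto simp: f_def R1 packet_schwartz1 packet_sum_schwartz1)
    show "integrable lborel (fourier (extremizer i0))" unfolding four by (rule integrable_vec_prod[OF ffi])
    show "integrable lborel (\<lambda>\<xi>. (1 + (norm \<xi>)\<^sup>2) powr s * (norm (fourier (extremizer i0) \<xi>))\<^sup>2)"
      unfolding four by (rule SI)
    have "countable (\<Q> \<times> (UNIV :: int set))" using finite_\<Q> by (intro countable_SIGMA) (auto simp: countable_finite)
    then show "countable \<Theta>" unfolding \<Theta>_def by (intro countable_Int1 countable_image)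
    show "\<Theta> \<subseteq> {0<..<1}" by (simp add: \<Theta>_def)
    show "\<Omega> \<in> sets borel"
      unfolding \<Omega>_def using target_fmeasurable finite_\<Q> by (intro sets.finite_UN) (auto simp: fmeasurable_def)
    show "\<Omega> \<subseteq> ball 0 1" unfolding \<Omega>_def using target_subset_ball[OF _ n] by blast
    fix x assume "x \<in> \<Omega>"
    then obtain q where q: "q \<in> \<Q>" "x \<in> target i0 q" by (auto simp: \<Omega>_def)
    then have "x $ i0 \<in> base" by (simp add: target_def)
    from numerator(2,3)[OF q(1) this] have "time q (numerator q (x $ i0)) \<in> \<Theta>"
      using q(1) by (force simp: \<Theta>_def)
    then show "\<exists>t\<in>\<Theta>. level ^ (CARD('n) - 1) / 2 \<le> norm (T_schwartz k t (extremizer i0) x)"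
      using target_evolution[OF q] by blast
  qed (rule level0)
  have "real (card \<Q>) * (large_bound ^ (CARD('n) - 1) / (2 * M) - real (card \<Q>) * (((Q / N)\<^sup>2) ^ (CARD('n) - 1) / (2 * M)))
     \<le> measure lborel \<Omega>"
    unfolding \<Omega>_def
    by (rule measure_union_pairwise_small)
      (use finite_\<Q> target_fmeasurable measure_target measure_target_overlap M in auto)
  moreover have "large_bound ^ (CARD('n) - 1) / (4 * M)
     \<le> large_bound ^ (CARD('n) - 1) / (2 * M) - real (card \<Q>) * (((Q / N)\<^sup>2) ^ (CARD('n) - 1) / (2 * M))"
  proof -
    have "real (card \<Q>) * ((Q / N)\<^sup>2) ^ (CARD('n) - 1) / (2 * M) \<le> large_bound ^ (CARD('n) - 1) / 2 / (2 * M)"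
      using sparse M by (intro divide_right_mono) auto
    then show ?thesis by (simp add: field_simps)
  qed
  then have "real (card \<Q>) * (large_bound ^ (CARD('n) - 1) / (4 * M))
     \<le> real (card \<Q>) * (large_bound ^ (CARD('n) - 1) / (2 * M) - real (card \<Q>) * (((Q / N)\<^sup>2) ^ (CARD('n) - 1) / (2 * M)))"
    by (rule mult_left_mono) simp
  ultimately have "real (card \<Q>) * (large_bound ^ (CARD('n) - 1) / (4 * M)) \<le> measure lborel \<Omega>" by linarith
  then have "level ^ (CARD('n) - 1) / 2 * (real (card \<Q>) * (large_bound ^ (CARD('n) - 1) / (4 * M)))
    \<le> level ^ (CARD('n) - 1) / 2 * measure lborel \<Omega>"
    using level0 by (rule mult_left_mono)
  also note main
  also have "\<bar>C\<bar> * sqrt (1 / (2 * pi) ^ CARD('n) * (LINT \<xi>|lborel. (1 + (norm \<xi>)\<^sup>2) powr s * (norm (fourier (extremizer i0) \<xi>))\<^sup>2))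
     \<le> \<bar>C\<bar> * sqrt (2 * (L * N) powr (2 * s') * (packet_const / S * (4 * packet_const * N) ^ (CARD('n) - 1)))"
  proof (intro mult_left_mono real_sqrt_le_mono)
    define X where "X = (LINT \<xi>|lborel. (1 + (norm \<xi>)\<^sup>2) powr s * (norm (fourier (extremizer i0) \<xi>))\<^sup>2)"
    have X0: "0 \<le> X" unfolding X_def by (intro integral_nonneg_AE) auto
    have "1 \<le> (2 * pi) ^ CARD('n)" using pi_gt3 by (intro one_le_power) simp
    then have "1 / (2 * pi) ^ CARD('n) * X \<le> 1 * X" using X0 by (intro mult_right_mono) auto
    also have "1 * X \<le> 2 * R powr (2 * s') * (\<Prod>i\<in>UNIV. W i)" unfolding X_def four using SB by simp
    also have "(\<Prod>i\<in>UNIV. W i) = packet_const / S * (4 * packet_const * N) ^ (CARD('n) - 1)"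
      unfolding W_def by (rule prod_if_eq)
    finally show "1 / (2 * pi) ^ CARD('n) * (LINT \<xi>|lborel. (1 + (norm \<xi>)\<^sup>2) powr s * (norm (fourier (extremizer i0) \<xi>))\<^sup>2)
      \<le> 2 * (L * N) powr (2 * s') * (packet_const / S * (4 * packet_const * N) ^ (CARD('n) - 1))"
      by (simp add: X_def R_def)
  qed simp
  finally show ?thesis .
qed

end

section \<open>The choice of the parameters\<close>

lemma many_primes:
  fixes e :: nat
  assumes "e \<ge> 1"
  shows "\<forall>\<^sub>F m in sequentially. even m \<longrightarrow> m ^ e \<le> m * card {p. prime p \<and> p \<le> m ^ e}"
proof -
  have "\<forall>\<^sub>F m in sequentially. 4 * real e * ln (real m) \<le> real m" by real_asymp
  moreover have "\<forall>\<^sub>F m in sequentially. 4 \<le> (m::nat)" by (rule eventually_ge_at_top)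
  ultimately show ?thesis
  proof eventually_elim
    case (elim m)
    show ?case
    proof
      assume "even m"
      define Q where "Q = m ^ e"
      define h where "h = Q div 2"
      define P where "P = card {p. prime p \<and> p \<le> Q}"
      have "even Q" using \<open>even m\<close> assms by (simp add: Q_def)
      then have Qh: "Q = 2 * h" by (simp add: h_def)
      have "4 ^ 1 \<le> m ^ e" using elim(2) assms by (intro order_trans[OF _ power_increasing[of 1 e m]]) auto
      then have Q4: "4 \<le> Q" by (simp add: Q_def)
      have "4 ^ h \<le> 2 * Q ^ P"
        using four_power_le_power_prime_count[of h] Q4 by (simp add: P_def Qh)
      moreover have "(4::nat) ^ h = 2 ^ Q" by (simp add: Qh power_mult)
      ultimately have "2 ^ Q \<le> 2 * Q ^ P" by simp
      then have "real (2 ^ Q) \<le> real (2 * Q ^ P)" by (rule of_nat_mono)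
      then have "ln (2 ^ Q) \<le> ln (2 * real Q ^ P)" using Q4 by (subst ln_le_cancel_iff) auto
      then have "real Q * ln 2 \<le> ln 2 + real P * ln (real Q)"
        using Q4 by (simp add: ln_mult ln_realpow)
      moreover have "(real Q - 1) * (2 / 3) \<le> (real Q - 1) * ln 2"
        using ln2_ge_two_thirds Q4 by (intro mult_left_mono) auto
      moreover have "(real Q - 1) * ln 2 = real Q * ln 2 - ln 2" by (simp add: algebra_simps)
      moreover have "real Q / 2 \<le> (real Q - 1) * (2 / 3)" using Q4 by (simp add: field_simps)
      ultimately have "real Q / 2 \<le> real P * ln (real Q)" by linarith
      also have "ln (real Q) = real e * ln (real m)" using elim(2) by (simp add: Q_def ln_realpow)
      also have "real P * (real e * ln (real m)) \<le> real P * (real m / 4)"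
        using elim(1) by (intro mult_left_mono) auto
      finally have "real Q \<le> real (m * P)" using Q4 by (simp add: mult.commute)
      then show "m ^ e \<le> m * card {p. prime p \<and> p \<le> m ^ e}" by (simp only: of_nat_le_iff Q_def P_def)
    qed
  qed
qed

text \<open>The primes below the window are fewer than \<open>Q / M\<^sup>2 + 1\<close>, which is negligible against \<open>Q / M\<close>.\<close>
lemma many_primes_in_window:
  fixes m e :: nat
  defines "M \<equiv> real m" and "Q \<equiv> real m ^ e"
  assumes count: "m ^ e \<le> m * card {p. prime p \<and> p \<le> m ^ e}" and M3: "3 \<le> M" and e: "2 \<le> e"
  shows "Q / M\<^sup>2 \<le> card {p. prime p \<and> real p \<le> Q \<and> Q \<le> M\<^sup>2 * real p}"
proof -
  define P where "P = {p. prime p \<and> real p \<le> Q \<and> Q \<le> M\<^sup>2 * real p}"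
  have M0: "0 < M" "1 \<le> M" using M3 by auto
  have Qm: "Q = real (m ^ e)" by (simp add: Q_def)
  have MQ: "M\<^sup>2 \<le> Q" unfolding Q_def M_def[symmetric] using M0 e by (intro power_increasing) auto
  then have Q0: "0 < Q" using M0 by (smt (verit) zero_less_power)
  have b: "1 \<le> Q / M\<^sup>2" using MQ M0 by (subst pos_le_divide_eq) auto
  have "{p. prime p \<and> p \<le> m ^ e} \<subseteq> P \<union> {..<nat \<lceil>Q / M\<^sup>2\<rceil>}"
  proof
    fix p assume p: "p \<in> {p. prime p \<and> p \<le> m ^ e}"
    then have "real p \<le> Q" unfolding Qm by (simp only: of_nat_le_iff mem_Collect_eq)
    moreover have "p < nat \<lceil>Q / M\<^sup>2\<rceil>" if "\<not> Q \<le> M\<^sup>2 * real p"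
    proof -
      have "real p < Q / M\<^sup>2" using that M0 by (simp add: field_simps)
      then show ?thesis by linarith
    qed
    ultimately show "p \<in> P \<union> {..<nat \<lceil>Q / M\<^sup>2\<rceil>}" using p by (auto simp: P_def)
  qed
  moreover have finP: "finite P"
    by (rule finite_subset[of _ "{..nat \<lfloor>Q\<rfloor>}"]) (auto simp: P_def le_nat_floor)
  ultimately have "card {p. prime p \<and> p \<le> m ^ e} \<le> card (P \<union> {..<nat \<lceil>Q / M\<^sup>2\<rceil>})"
    by (intro card_mono) auto
  also have "\<dots> \<le> card P + nat \<lceil>Q / M\<^sup>2\<rceil>" using card_Un_le[of P "{..<nat \<lceil>Q / M\<^sup>2\<rceil>}"] by simp
  finally have *: "card {p. prime p \<and> p \<le> m ^ e} \<le> card P + nat \<lceil>Q / M\<^sup>2\<rceil>" .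
  have "m ^ e \<le> m * (card P + nat \<lceil>Q / M\<^sup>2\<rceil>)"
    using count mult_le_mono2[OF *] by (rule order_trans)
  then have "real (m ^ e) \<le> real (m * (card P + nat \<lceil>Q / M\<^sup>2\<rceil>))" by (rule of_nat_mono)
  then have "Q \<le> M * (real (card P) + real (nat \<lceil>Q / M\<^sup>2\<rceil>))" by (simp add: Qm M_def)
  also have "real (nat \<lceil>Q / M\<^sup>2\<rceil>) \<le> Q / M\<^sup>2 + 1" using Q0 by (simp add: of_nat_nat)
  finally have "Q \<le> M * (real (card P) + (Q / M\<^sup>2 + 1))" using M0 by (simp add: mult_left_mono)
  then have "Q / M \<le> real (card P) + (Q / M\<^sup>2 + 1)"
    using M0(1) by (simp only: pos_divide_le_eq mult.commute)
  then have cP: "Q / M - Q / M\<^sup>2 - 1 \<le> real (card P)" by simp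
  have "3 * (Q / M\<^sup>2) \<le> M * (Q / M\<^sup>2)" using M3 Q0 by (intro mult_right_mono) auto
  also have "M * (Q / M\<^sup>2) = Q / M" using M0 by (simp add: power2_eq_square)
  finally show ?thesis using b cP unfolding P_def by linarith
qed

text \<open>The value of \<open>D\<close> is determined by the assumption \<open>resolution\<close>: it makes the exponents of \<open>X\<close> in
\<open>S * (L * N) ^ (k - 1)\<close> and in \<open>Q * L ^ k\<close> equal, so that only powers of \<open>M\<close> remain.\<close>
lemma focusing_powers:
  fixes k n' D K m :: nat and X :: real and \<Q> :: "nat set"
  defines "M \<equiv> real m"
  assumes k2: "2 \<le> k" and n': "1 \<le> n'" and D: "D = (k - 1) * (n' + 1) + 1" and K6: "6 \<le> K" and X: "X = real m ^ K"
    and MB: "32 * real k ^ 2 < real m" "8 * gauss_moment k < real m"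
      "256 * real k ^ 2 * (2 * (2 * pi + 2 * gauss_moment k) + 2) < real m"
    and P: "\<Q> \<subseteq> {p. prime p \<and> real p \<le> X ^ n' \<and> X ^ n' \<le> (real m)\<^sup>2 * real p}"
  shows "focusing k (m ^ (K * (n' + 1))) (X ^ (2 * D - (n' + 1))) (X ^ D / real m ^ 3) (real m) (X ^ n') \<Q>"
proof -
  define n N Q L S where "n = n' + 1" and "N = m ^ (K * n)" and "Q = X ^ n'"
    and "L = X ^ (2 * D - n)" and "S = X ^ D / M ^ 3"
  have n2: "2 \<le> n" and nn': "n = n' + 1" using n' by (auto simp: n_def)
  have D1: "1 \<le> D" "n + 1 \<le> D"
  proof -
    have "1 * n \<le> (k - 1) * n" using k2 by (intro mult_right_mono) auto
    then show "1 \<le> D" "n + 1 \<le> D" by (auto simp: D n_def)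
  qed
  have kn: "k * n = D + n'" using k2 by (cases k) (auto simp: D n_def)
  have k4: "4 \<le> real k ^ 2" using k2 power_mono[of 2 "real k" 2] by simp
  have M128: "128 \<le> M" using MB(1) k4 by (simp add: M_def)
  then have M0: "0 < M" "1 \<le> M" by auto
  have X_def: "X = M ^ K" by (simp add: X M_def)
  have X0: "0 < X" using M0 by (simp add: X_def)
  have XM: "M ^ 6 \<le> X" unfolding X_def using K6 M0 by (intro power_increasing) auto
  have M6: "M \<le> M ^ 6" "M ^ 5 \<le> M ^ 6" using M0 by (auto intro: self_le_power power_increasing)
  have X1: "1 \<le> X" using XM M6 M0 by linarith
  have NX: "real N = X ^ n" by (simp add: N_def X_def M_def power_mult)
  have Q0: "0 < Q" using X0 by (simp add: Q_def)
  have QX: "X \<le> Q" unfolding Q_def using X1 n' by (intro self_le_power) auto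
  have NQ: "real N = Q * X" by (simp add: NX Q_def nn')
  have LN: "L * real N = X ^ (2 * D)" using D1 by (simp add: L_def NX flip: power_add)
  have "focusing k N L S M Q \<Q>"
  proof
    show "2 \<le> k" by (rule k2)
    show "2 \<le> M" using M128 by simp
    have XL: "X \<le> L" unfolding L_def using X1 D1 by (intro self_le_power) auto
    have "4 * pi * M \<le> M * M" using M128 pi_less_4 by (intro mult_right_mono) auto
    also have "\<dots> \<le> M ^ 6" using M0 power_increasing[of 2 6 M] by (simp add: power2_eq_square)
    finally show "4 * pi * M \<le> L" using XM XL by linarith
    have "1 \<le> real N" unfolding NX using X1 by (rule one_le_power)
    then show "1 \<le> N" by simp
    have XD: "X \<le> X ^ D" using X1 D1 by (intro self_le_power) auto
    have "2 * M * M ^ 3 \<le> M * M * M ^ 3" using M128 by (intro mult_right_mono) auto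
    also have "\<dots> = M ^ 5" by (simp add: eval_nat_numeral)
    also have "\<dots> \<le> X ^ D" using M6 XM XD by linarith
    finally show "2 * M \<le> S" using M0 by (simp add: S_def pos_le_divide_eq)
    have "S\<^sup>2 = X ^ (2 * D) / (M ^ 3)\<^sup>2" by (simp add: S_def power_divide power_mult mult.commute flip: power_mult)
    also have "\<dots> \<le> X ^ (2 * D) / 1" using X0 M0 by (intro divide_left_mono one_le_power) auto
    finally show "S\<^sup>2 \<le> L * real N" by (simp add: LN)
    show "finite \<Q>"
      by (rule finite_subset[of _ "{..nat \<lfloor>Q\<rfloor>}"]) (use P in \<open>auto simp: Q_def le_nat_floor\<close>)
    show "0 < Q" by (rule Q0)
    have "M \<le> X" using M6 XM by linarith
    then show "Q * M \<le> real N" using Q0 by (simp add: NQ)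
    show "real N \<le> Q\<^sup>2" using QX Q0 by (simp add: NQ power2_eq_square)
    show "8 * gauss_moment k \<le> M" using MB(2)[folded M_def] by simp
    have "256 * real k ^ 2 * (2 * (2 * pi / M + 2 / M * gauss_moment k) + 2 / M)
       = 256 * real k ^ 2 * (2 * (2 * pi + 2 * gauss_moment k) + 2) / M"
      using M0 by (simp add: field_simps)
    also have "\<dots> \<le> 1" using MB(3)[folded M_def] M0 by simp
    finally show "256 * real k ^ 2 * (2 * (2 * pi / M + 2 / M * gauss_moment k) + 2 / M) \<le> 1" .
    fix q assume "q \<in> \<Q>"
    then have q: "prime q" "real q \<le> Q" "Q \<le> M\<^sup>2 * real q" using P by (auto simp: Q_def M_def)
    then show "prime q" "real q \<le> Q" "Q \<le> M\<^sup>2 * real q" by auto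
    have "M ^ 2 * M ^ 4 \<le> M\<^sup>2 * real q" using q(3) QX XM by (simp flip: power_add)
    then have "M ^ 4 \<le> real q" using M0 by (subst (asm) mult_le_cancel_left_pos) auto
    moreover have "M \<le> M ^ 4" using M0 by (intro self_le_power) auto
    moreover have "real k \<le> real k ^ 2" using k2 by (intro self_le_power) auto
    ultimately have "real k < real q" using MB(1)[folded M_def] k4 by linarith
    then show "k < q" by simp
    have q0: "0 < real q" using \<open>real k < real q\<close> by simp
    have exps: "2 * D * (k - 1) + D = (2 * D - n) * k + n'"
    proof -
      have "2 * D * (k - 1) + D + (k * n) = 2 * D * k + n'"
        using k2 kn by (cases k) (auto simp: algebra_simps)
      moreover have "(2 * D - n) * k + k * n = 2 * D * k"
        using D1 by (simp add: diff_mult_distrib algebra_simps)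
      ultimately show ?thesis by linarith
    qed
    have "X ^ D * (L * real N) ^ (k - 1) = L ^ k * Q"
      unfolding LN unfolding L_def Q_def using exps by (simp add: mult.commute add.commute flip: power_mult power_add)
    then have "S * (2 * pi * real k * (L * real N) ^ (k - 1) / (real q * L ^ k))
       = 2 * pi * real k * (Q / (M ^ 3 * real q))"
      using X0 M0 q0 by (simp add: S_def L_def field_simps)
    also have "\<dots> \<le> 2 * pi * real k * (1 / M)"
    proof (intro mult_left_mono)
      have "Q * M \<le> M\<^sup>2 * real q * M" using q(3) M0 by (intro mult_right_mono) auto
      then show "Q / (M ^ 3 * real q) \<le> 1 / M" using M0 q0 by (simp add: field_simps power2_eq_square power3_eq_cube)
    qed auto
    also have "\<dots> \<le> 1 / 2"
    proof -
      have "4 * pi * real k \<le> 4 * 4 * real k" using pi_less_4 by (intro mult_right_mono) auto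
      also have "\<dots> \<le> 32 * real k ^ 2" using \<open>real k \<le> real k ^ 2\<close> zero_le_power2[of "real k"] by linarith
      finally show ?thesis using MB(1)[folded M_def] M0 by (simp add: field_simps)
    qed
    finally show "S * (2 * pi * real k * (L * real N) ^ (k - 1) / (real q * L ^ k)) \<le> 1 / 2" .
  qed
  then show ?thesis by (simp add: N_def L_def S_def Q_def M_def n_def)
qed

theorem theorem1p1:
  fixes k :: nat and s C :: real
  assumes "CARD('n::finite) \<ge> 2" and "k \<ge> 2"
    and "\<forall>f \<in> (sobolev_space s :: 'n distribution set).
           \<exists>u. is_T_of s k f u \<and>
               (\<integral>\<^sup>+x\<in>ball 0 1. (SUP t\<in>{0<..<1}. ennreal (norm (u t x))) \<partial>lborel)
                 \<le> ennreal (C * sobolev_norm s f)"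
  shows "s \<ge> 1 / 4 + (real CARD('n) - 1) / (4 * ((real k - 1) * real CARD('n) + 1))"
proof (rule ccontr)
  define n where "n = CARD('n)"
  define n' where "n' = n - 1"
  define D where "D = (k - 1) * n + 1"
  define s' where "s' = max s 0"
  \<comment> \<open>The gain: the two sides of the inequality will differ by the factor \<open>X powr \<epsilon>\<close>, up to a power of
\<open>M\<close> and a constant.\<close>
  define \<epsilon> where "\<epsilon> = real n' + real D - 4 * real D * s'"
  assume "\<not> s \<ge> 1 / 4 + (real CARD('n) - 1) / (4 * ((real k - 1) * real CARD('n) + 1))"
  moreover have n2: "2 \<le> n" and nn': "n = n' + 1" using assms(1) by (auto simp: n_def n'_def)
  moreover have Dr: "real D = (real k - 1) * real n + 1" using assms(2) by (simp add: D_def of_nat_diff)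
  ultimately have s: "s < 1 / 4 + real n' / (4 * real D)" by (simp add: n_def)
  have D1: "1 \<le> D" "n + 1 \<le> D"
  proof -
    have "1 * n \<le> (k - 1) * n" using assms(2) by (intro mult_right_mono) auto
    then show "1 \<le> D" "n + 1 \<le> D" by (auto simp: D_def)
  qed
  have s'1: "s' < 1 / 4 + real n' / (4 * real D)" using s D1 by (simp add: s'_def add_pos_nonneg)
  have "real n' / (4 * real D) \<le> 1 / 4" using D1 nn' by (simp add: field_simps)
  then have s'b: "0 \<le> s'" "s' \<le> 1" "s \<le> s'" using s'1 by (auto simp: s'_def)
  have "4 * real D * s' < 4 * real D * (1 / 4 + real n' / (4 * real D))"
    using s'1 D1 by (intro mult_strict_left_mono) auto
  moreover have "4 * real D * (1 / 4 + real n' / (4 * real D)) = real D + real n'"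
    using D1 by (simp add: distrib_left)
  ultimately have \<epsilon>: "0 < \<epsilon>" by (simp add: \<epsilon>_def)
  \<comment> \<open>The losses amount to \<open>M ^ (22 * n' + 5)\<close>, so this \<open>K\<close> leaves a factor \<open>M\<close>.\<close>
  obtain K0 :: nat where K0: "real (22 * n' + 6) / \<epsilon> \<le> real K0" using real_arch_simple by blast
  define K where "K = K0 + 6"
  have K6: "6 \<le> K" by (simp add: K_def)
  have "real (22 * n' + 6) / \<epsilon> \<le> real K" using K0 by (simp add: K_def)
  then have K\<epsilon>: "real (22 * n' + 6) \<le> real K * \<epsilon>" using \<epsilon> by (simp add: pos_divide_le_eq)
  define C3 where "C3 = 128 * C\<^sup>2 * packet_const ^ n * 4 ^ n' * 64 ^ n'"
  define B where "B = Max {C3, real n, 32 * real k ^ 2, 8 * gauss_moment k,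
      256 * real k ^ 2 * (2 * (2 * pi + 2 * gauss_moment k) + 2)}"
  have Kn': "2 \<le> K * n'" using mult_le_mono[of 2 K 1 n'] K6 nn' n2 by simp
  then have "1 \<le> K * n'" by linarith
  from many_primes[OF this] obtain m0 where
    m0: "\<And>m. m \<ge> m0 \<Longrightarrow> even m \<Longrightarrow> m ^ (K * n') \<le> m * card {p. prime p \<and> p \<le> m ^ (K * n')}"
    by (auto simp: eventually_sequentially)
  \<comment> \<open>Even, as the count of primes is for an even bound.\<close>
  define m where "m = 2 * (m0 + nat \<lceil>B\<rceil> + 1)"
  define M where "M = real m"
  have "B < M" unfolding M_def m_def using real_nat_ceiling_ge[of B] by simp
  then have MB: "C3 < M" "real n < M" "32 * real k ^ 2 < M" "8 * gauss_moment k < M"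
      "256 * real k ^ 2 * (2 * (2 * pi + 2 * gauss_moment k) + 2) < M"
    by (auto simp: B_def)
  have k4: "4 \<le> real k ^ 2" using assms(2) power_mono[of 2 "real k" 2] by simp
  have M128: "128 \<le> M" using MB(3) k4 by linarith
  then have M0: "0 < M" "1 \<le> M" by auto
  define X where "X = M ^ K"
  have X0: "0 < X" using M0 by (simp add: X_def)
  have XM: "M ^ 6 \<le> X" unfolding X_def using K6 M0 by (intro power_increasing) auto
  have M6: "M \<le> M ^ 6" "M ^ 5 \<le> M ^ 6" using M0 by (auto intro: self_le_power power_increasing)
  have X1: "1 \<le> X" using XM M6 M0 by linarith
  define N where "N = m ^ (K * n)"
  define Q where "Q = X ^ n'"
  define L where "L = X ^ (2 * D - n)"
  define S where "S = X ^ D / M ^ 3"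
  have NX: "real N = X ^ n" by (simp add: N_def X_def M_def power_mult)
  have Q0: "0 < Q" using X0 by (simp add: Q_def)
  have NQ: "real N = Q * X" by (simp add: NX Q_def nn')
  have LN: "L * real N = X ^ (2 * D)"
    using D1 by (simp add: L_def NX flip: power_add)
  define P where "P = {p. prime p \<and> real p \<le> Q \<and> Q \<le> M\<^sup>2 * real p}"
  \<comment> \<open>As many denominators as the overlaps permit; there are more primes than that, because the loss
in their count is only a factor \<open>M\<close>.\<close>
  define P1 where "P1 = m ^ ((K - 6) * n')"
  have P1X: "real P1 = (X / M ^ 6) ^ n'"
  proof -
    have "X = M ^ (K - 6) * M ^ 6" unfolding X_def using K6 by (simp flip: power_add)
    then show ?thesis using M0 by (simp add: P1_def M_def power_mult)
  qed
  have "P1 \<le> card P"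
  proof -
    have "(M ^ 6) ^ 1 \<le> (M ^ 6) ^ n'" using nn' n2 M0 by (intro power_increasing one_le_power) auto
    then have "real P1 \<le> Q / M ^ 6"
      unfolding P1X Q_def power_divide using X0 M0 by (intro divide_left_mono) auto
    also have "\<dots> \<le> Q / M ^ 2" using Q0 M0 by (intro divide_left_mono power_increasing) auto
    finally have "real P1 \<le> Q / M\<^sup>2" .
    moreover have "m ^ (K * n') \<le> m * card {p. prime p \<and> p \<le> m ^ (K * n')}"
      by (rule m0) (simp_all add: m_def)
    then have "Q / M\<^sup>2 \<le> real (card P)"
      using many_primes_in_window[of m "K * n'"] M128 Kn'
      by (simp add: P_def Q_def X_def M_def power_mult)
    ultimately show ?thesis by simp
  qed
  then obtain \<Q> where cQ: "\<Q> \<subseteq> P" "card \<Q> = P1" by (metis obtain_subset_with_card_n)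
  have X8: "8 \<le> X" using XM M6 M128 by linarith
  have MX: "32 * real k ^ 2 < real m" "8 * gauss_moment k < real m"
    "256 * real k ^ 2 * (2 * (2 * pi + 2 * gauss_moment k) + 2) < real m"
    using MB by (simp_all add: M_def)
  interpret focusing k N L S M Q \<Q>
    using focusing_powers[OF assms(2) _ _ K6 _ MX, of n' D X \<Q>] nn' n2 cQ(1)
    by (simp add: N_def L_def S_def M_def Q_def X_def D_def P_def)
  have N0: "0 < real N" using N by simp
  have lb: "1 / (X * M ^ 5) \<le> large_bound"
  proof -
    have "32 * real k ^ 2 * N * M ^ 4 \<le> M * N * M ^ 4" using MB(3) M0 by (intro mult_right_mono) auto
    also have "\<dots> = Q * (X * M ^ 5)" by (simp add: NQ eval_nat_numeral)
    finally have "Q / (Q * (X * M ^ 5)) \<le> Q / (32 * real k ^ 2 * N * M ^ 4)"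
      using Q0 M0 X0 assms(2) N0 by (intro divide_left_mono) auto
    then show ?thesis using Q0 by (simp add: large_bound_def)
  qed
  have lb0: "0 < 1 / (X * M ^ 5)" using X0 M0 by simp
  have fin: "level ^ n' / 2 * (real P1 * (large_bound ^ n' / (4 * M)))
    \<le> \<bar>C\<bar> * sqrt (2 * (L * N) powr (2 * s') * (packet_const / S * (4 * packet_const * N) ^ n'))"
  proof -
    have "8 * real N \<le> L\<^sup>2"
    proof -
      have "8 * real N \<le> X * X ^ n" unfolding NX using X8 X0 by (intro mult_right_mono) auto
      also have "\<dots> = X ^ (n + 1)" by simp
      also have "\<dots> \<le> X ^ ((2 * D - n) * 2)" using X1 D1 by (intro power_increasing) auto
      finally show ?thesis by (simp add: L_def power_mult)
    qed
    moreover have "real (card \<Q>) * ((Q / N)\<^sup>2) ^ n' \<le> large_bound ^ n' / 2"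
    proof -
      have "real (card \<Q>) * ((Q / N)\<^sup>2) ^ n' = (X / M ^ 6 * (1 / X)\<^sup>2) ^ n'"
        unfolding cQ P1X NQ power_mult_distrib using Q0 by simp
      also have "X / M ^ 6 * (1 / X)\<^sup>2 = 1 / (X * M ^ 5) * (1 / M)"
        using X0 M0 by (simp add: eval_nat_numeral)
      also have "(1 / (X * M ^ 5) * (1 / M)) ^ n' = (1 / (X * M ^ 5)) ^ n' * (1 / M) ^ n'"
        by (rule power_mult_distrib)
      also have "\<dots> \<le> large_bound ^ n' * (1 / 2)"
      proof (intro mult_mono power_mono lb)
        have "(1 / M) ^ n' \<le> (1 / M) ^ 1" using M0 nn' n2 by (intro power_decreasing) auto
        also have "\<dots> \<le> 1 / 2" using M128 by simp
        finally show "(1 / M) ^ n' \<le> 1 / 2" .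
      qed (use lb0 M0 large_bound_nonneg in \<open>auto intro: less_imp_le\<close>)
      finally show ?thesis by simp
    qed
    ultimately show ?thesis
      using maximal_inequality_consequence[OF assms(3) s'b] MB(2) by (simp add: n_def n'_def cQ)
  qed
  define Y where "Y = (L * N) powr (2 * s')"
  have pc: "0 \<le> packet_const" by (rule packet_const_nonneg)
  have S0: "0 < S" using X0 M0 by (simp add: S_def)
  have level2: "level\<^sup>2 = real N * X / 64"
    using Q0 by (simp add: level_def power_divide power_mult_distrib NQ power2_eq_square)
  have lev0: "0 < level" using Q0 N by (simp add: level_def)
  have "level ^ n' / 2 * (real P1 * ((1 / (X * M ^ 5)) ^ n' / (4 * M)))
     \<le> \<bar>C\<bar> * sqrt (2 * Y * (packet_const / S * (4 * packet_const * N) ^ n'))"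
    unfolding Y_def
    using lb lb0 lev0 M0
    by (intro order_trans[OF _ fin] mult_left_mono divide_right_mono power_mono) auto
  then have "(level ^ n' / 2 * (real P1 * ((1 / (X * M ^ 5)) ^ n' / (4 * M))))\<^sup>2
     \<le> (\<bar>C\<bar> * sqrt (2 * Y * (packet_const / S * (4 * packet_const * N) ^ n')))\<^sup>2"
    using lev0 X0 M0 by (intro power_mono) auto
  also have "\<dots> = C\<^sup>2 * (2 * Y * (packet_const / S * (4 * packet_const * N) ^ n'))"
    using pc S0 by (simp add: power_mult_distrib Y_def)
  also have "(level ^ n' / 2 * (real P1 * ((1 / (X * M ^ 5)) ^ n' / (4 * M))))\<^sup>2
     = (level\<^sup>2 * (X / M ^ 6)\<^sup>2 * (1 / (X * M ^ 5))\<^sup>2) ^ n' / (64 * M\<^sup>2)"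
    by (simp add: P1X power_mult_distrib power_divide mult.commute flip: power_mult)
  also have "level\<^sup>2 * (X / M ^ 6)\<^sup>2 * (1 / (X * M ^ 5))\<^sup>2 = real N * (X / (64 * M ^ 22))"
    unfolding level2 using X0 M0 by (simp add: power_divide power_mult_distrib flip: power_mult power_add)
  finally have "(real N * (X / (64 * M ^ 22))) ^ n' / (64 * M\<^sup>2)
     \<le> C\<^sup>2 * (2 * Y * (packet_const / S * (4 * packet_const * N) ^ n'))" .
  then have "real N ^ n' * (X ^ n' * S) \<le> real N ^ n' * (Y * M ^ (22 * n' + 2) * C3)"
    using M0 S0
    by (simp add: C3_def nn' power_mult_distrib power_divide field_simps power_add power2_eq_square flip: power_mult)
  then have "X ^ n' * S \<le> Y * M ^ (22 * n' + 2) * C3"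
    using N by (subst (asm) mult_le_cancel_left_pos) auto
  then have main: "X ^ (n' + D) \<le> Y * M ^ (22 * n' + 5) * C3"
    using M0 by (simp add: S_def field_simps power_add eval_nat_numeral)
  have "Y = X powr (4 * real D * s')"
    unfolding Y_def LN using X0 by (simp add: powr_powr mult_ac flip: powr_realpow)
  moreover have "X ^ (n' + D) = X powr (4 * real D * s') * X powr \<epsilon>"
    using X0 by (simp add: \<epsilon>_def flip: powr_realpow powr_add)
  ultimately have "X powr (4 * real D * s') * X powr \<epsilon> \<le> X powr (4 * real D * s') * (M ^ (22 * n' + 5) * C3)"
    using main by (simp add: mult.assoc)
  then have 1: "X powr \<epsilon> \<le> M ^ (22 * n' + 5) * C3"
    using X0 by (subst (asm) mult_le_cancel_left_pos) auto
  have "M ^ (22 * n' + 5) * M = M powr real (22 * n' + 6)"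
    using M0 by (simp only: powr_realpow) (simp add: power_add eval_nat_numeral)
  also have "\<dots> \<le> M powr (real K * \<epsilon>)" using K\<epsilon> M0 by (intro powr_mono) auto
  also have "\<dots> = X powr \<epsilon>" using M0 by (simp add: X_def powr_powr flip: powr_realpow)
  also note 1
  finally have "M \<le> C3" using M0 by (subst (asm) mult_le_cancel_left_pos) auto
  then show False using MB(1) by simp
qed

end
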